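(* Let $f\in H^1(L^2(\Omega;\mathbb R^d))$, let $(u,v,q)\in H^1(\mathcal H)$ be the solution of $$Q^{-1}(\dot u,\dot v,\dot q)+\mathcal A(u,v,q)\ni Rf,\qquad(u,v,q)(0)=(u_0,v_0,q_0),$$ and let $(u_n,v_n,q_n)\in H^1(\mathcal H)$ be, for every $n\in\mathbb N$, the solution of $$Q^{-1}(\dot u_n,\dot v_n,\dot q_n)+\mathcal A_{\lambda_n}(u_n,v_n,q_n)=Rf,\qquad(u_n,v_n,q_n)(0)=(u_0,v_0,q_0),$$ where $(\lambda_n)_{n\in\mathbb N}\subset(0,\infty)$, $\lambda_n\searrow0$. Then $(u_n,v_n,q_n)\to(u,v,q)$ in $H^1(\mathcal H)$.
   Context: Domain: $d\in\mathbb N$, $\Omega\subset\mathbb R^d$ is a bounded domain with Lipschitz boundary $\Gamma=\Gamma_N\cup\Gamma_D$ (disjoint, measurable), $\Gamma_N$ relatively open, $\Gamma_D$ relatively closed with positive boundary measure, and $\Omega\cup\Gamma_N$ is regular in the sense of Gröger: for each $x\in\partial\Omega$ there are an open neighbourhood $U$ of $x$ and a bi-Lipschitz map $\Phi$ from $U$ onto an open set such that $\Phi(U\cap(\Omega\cup\Gamma_N))$ is one of $\{|y|<1,y_d<0\}$, $\{|y|<1,y_d\le0\}$, $\{|y|<1,\ y_d<0\text{ or }(y_d=0,y_1>0)\}$. $\rho>0$ is a constant. Tensors: $\mathbb R^{d\times d}_s$ is the space of symmetric matrices with the Frobenius inner product. $\mathbb C,\mathbb B\in L(\mathbb R^{d\times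 d}_s)$ are symmetric and coercive, $\mathbb D:=\mathbb B(\mathbb C+\mathbb B)^{-1}\mathbb C$ (symmetric and coercive), $\mathbb E:=\mathbb C(\mathbb C+\mathbb B)^{-1}$, $\mathbb E^\top$ is the adjoint of $\mathbb E$. Spaces: $H^1_D(\Omega;\mathbb R^d)$ consists of the $H^1$ functions with zero trace on $\Gamma_D$; $\nabla^s=\frac12(\nabla+\nabla^\top)$, and $\langle-\operatorname{div}\tau,v\rangle=\int_\Omega\tau:\nabla^sv$ for $v\in H^1_D(\Omega;\mathbb R^d)$. For fixed $T>0$, $L^2(X),H^1(X)$ denote the Bochner-type spaces on $[0,T]$ with values in $X$; operators act pointwise in time. Flow rule: $A:L^2(\Omega;\mathbb R^{d\times d}_s)\to2^{L^2(\Omega;\mathbb R^{d\times d}_s)}$ is maximal monotone with domain $D(A)$, and for every $\lambda>0$ its resolvent $R_\lambda=(I+\lambda A)^{-1}$ acts pointwise, i.e. $R_\lambda(\tau)(x)=R_\lambda(\tau(x))$ a.e. for a function $R_\lambda:\mathbb R^{d\times d}_s\to\mathbb R^{d\times d}_s$ (same symbol). Operators: $\mathcal H:=H^1_D(\Omega;\mathbb R^d)\times L^2(\Omega;\mathbb R^d)\times L^2(\Omega;\mathbb R^{d\times d}_s)$ with inner product $((u_1,v_1,q_1),(u_2,v_2,q_2))_{\mathcal H}=(\mathbb D\nabla^su_1,\nabla^su_2)_{L^2}+(v_1,v_2)_{L^2}+(q_1,q_2)_{L^2}$. $\mathcal A:D(\mathcal A)\to2^{\mathcal H}$, $\mathcal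 A(u,v,q)=\big(-v,\ -\operatorname{div}(\mathbb D\nabla^su+\mathbb Eq),\ A(q)-\mathbb E^\top\nabla^sv\big)$ with $D(\mathcal A)=\{(u,v,q)\in H^1_D(\Omega;\mathbb R^d)\times H^1_D(\Omega;\mathbb R^d)\times D(A):\operatorname{div}(\mathbb D\nabla^su+\mathbb Eq)\in L^2(\Omega;\mathbb R^d)\}$; $\mathcal A$ is maximal monotone and $\mathcal A_\lambda=\frac1\lambda(I-(I+\lambda\mathcal A)^{-1})$, $\lambda>0$, is its Yosida approximation. $Rf:=(0,f,0)$, $Q(a,b,c):=(a,b/\rho,(\mathbb C+\mathbb B)c)$. Inclusions and equations hold for almost all $t\in[0,T]$. Initial data (fixed): $u_0,v_0\in H^1_D(\Omega;\mathbb R^d)$, $z_0\in L^2(\Omega;\mathbb R^{d\times d}_s)$, $q_0:=\mathbb C\nabla^su_0-(\mathbb C+\mathbb B)z_0$, with $(u_0,v_0,q_0)\in D(\mathcal A)$. *)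

theory Defs
  imports "HOL-Analysis.Analysis" "HOL-Library.Function_Algebras"
begin

text \<open>\<open>'d rvec\<close> is \<^typ>\<open>real^'d\<close>, without the implicit sort constraint of the infix syntax.\<close>

type_synonym 'd rvec = "(real, 'd) vec"


section \<open>Symmetric matrices\<close>

text \<open>
  The inner product inherited from \<^typ>\<open>real^'d^'d\<close> is the Frobenius inner product.
\<close>

typedef ('d::finite) symmat = "{M :: real^'d^'d. transpose M = M}"
  by (rule exI[of _ "mat 1"]) simp

lemma subspace_symmetric: "subspace {M :: real^('d::finite)^'d. transpose M = M}"
  by (auto simp: subspace_def transpose_def vec_eq_iff)

instantiation symmat :: (finite) real_vector
begin
definition "0 = Abs_symmat 0"
definition "M + N = Abs_symmat (Rep_symmat M + Rep_symmat N)"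
definition "M - N = Abs_symmat (Rep_symmat M - Rep_symmat N)"
definition "- M = Abs_symmat (- Rep_symmat M)"
definition "c *\<^sub>R M = Abs_symmat (c *\<^sub>R Rep_symmat M)"

lemma Rep_symmat_zero: "Rep_symmat 0 = 0"
  unfolding zero_symmat_def by (rule Abs_symmat_inverse[OF subspace_0[OF subspace_symmetric]])

lemma Rep_symmat_add: "Rep_symmat (M + N) = Rep_symmat M + Rep_symmat N"
  unfolding plus_symmat_def by (rule Abs_symmat_inverse[OF subspace_add[OF subspace_symmetric Rep_symmat Rep_symmat]])

lemma Rep_symmat_diff: "Rep_symmat (M - N) = Rep_symmat M - Rep_symmat N"
  unfolding minus_symmat_def by (rule Abs_symmat_inverse[OF subspace_diff[OF subspace_symmetric Rep_symmat Rep_symmat]])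

lemma Rep_symmat_uminus: "Rep_symmat (- M) = - Rep_symmat M"
  unfolding uminus_symmat_def by (rule Abs_symmat_inverse[OF subspace_neg[OF subspace_symmetric Rep_symmat]])

lemma Rep_symmat_scaleR: "Rep_symmat (c *\<^sub>R M) = c *\<^sub>R Rep_symmat M"
  unfolding scaleR_symmat_def by (rule Abs_symmat_inverse[OF subspace_scale[OF subspace_symmetric Rep_symmat]])

lemmas Rep_symmat_ops =
  Rep_symmat_zero Rep_symmat_add Rep_symmat_diff Rep_symmat_uminus Rep_symmat_scaleR

instance
  by standard (simp_all add: Rep_symmat_inject[symmetric] Rep_symmat_ops algebra_simps)
end

instantiation symmat :: (finite) real_inner
begin
definition "inner M N = inner (Rep_symmat M) (Rep_symmat N)"
definition "norm M = norm (Rep_symmat M)" for M :: "'a symmat"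
definition "sgn M = M /\<^sub>R norm M" for M :: "'a symmat"
definition "dist M N = norm (M - N)" for M N :: "'a symmat"
definition "(uniformity :: ('a symmat \<times> 'a symmat) filter)
    = (INF e\<in>{0<..}. principal {(M, N). dist M N < e})"
definition "open (S :: 'a symmat set)
    = (\<forall>M\<in>S. \<forall>\<^sub>F (M', N) in uniformity. M' = M \<longrightarrow> N \<in> S)"

instance
proof
  fix M :: "'a symmat"
  show "(inner M M = 0) = (M = 0)"
    by (simp add: inner_symmat_def Rep_symmat_inject[symmetric] Rep_symmat_ops)
next
  fix M N :: "'a symmat"
  show "inner M N = inner N M"
    by (simp add: inner_symmat_def inner_commute)
qed (simp_all add: inner_symmat_def norm_symmat_def sgn_symmat_def dist_symmat_def
       uniformity_symmat_def open_symmat_def Rep_symmat_ops inner_add_left norm_eq_sqrt_inner)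
end

definition is_onb :: "'a::real_inner set \<Rightarrow> bool" where
  "is_onb B \<longleftrightarrow> B \<noteq> {} \<and> finite B \<and> (\<forall>u\<in>B. \<forall>v\<in>B. inner u v = (if u = v then 1 else 0))
     \<and> (\<forall>x. (\<forall>u\<in>B. inner x u = 0) \<longleftrightarrow> x = 0)"

lemma ex_onb_symmat: "\<exists>B :: ('d::finite) symmat set. is_onb B"
proof -
  let ?S = "{M :: real^'d^'d. transpose M = M}"
  obtain B where B: "B \<subseteq> ?S" "pairwise orthogonal B" "\<And>x. x \<in> B \<Longrightarrow> norm x = 1"
      "independent B" "card B = dim ?S" "span B = ?S"
    using orthonormal_basis_subspace[OF subspace_symmetric] by blast
  have fin: "finite B" using B(4) independent_imp_finite by blast
  have one: "(mat 1 :: real^'d^'d) \<in> ?S" by simp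
  have "(mat 1 :: real^'d^'d) \<noteq> 0"
    by (auto simp: mat_def vec_eq_iff)
  hence ne: "B \<noteq> {}" using B(6) one by auto
  let ?B = "Abs_symmat ` B"
  have rep: "Rep_symmat (Abs_symmat b) = b" if "b \<in> B" for b
    using that B(1) by (auto intro!: Abs_symmat_inverse)
  have "is_onb ?B"
    unfolding is_onb_def
  proof (intro conjI ballI allI iffI)
    show "?B \<noteq> {}" "finite ?B" using ne fin by auto
  next
    fix u v assume "u \<in> ?B" "v \<in> ?B"
    then obtain a b where ab: "a \<in> B" "b \<in> B" "u = Abs_symmat a" "v = Abs_symmat b" by auto
    have "u = v \<longleftrightarrow> a = b" using ab rep by metis
    moreover have "inner u v = inner a b" using ab rep by (simp add: inner_symmat_def)
    moreover have "inner a b = (if a = b then 1 else 0)"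
      using ab B(2,3) by (auto simp: pairwise_def orthogonal_def norm_eq_1)
    ultimately show "inner u v = (if u = v then 1 else 0)" by simp
  next
    fix x :: "'d symmat" assume *: "\<forall>u\<in>?B. inner x u = 0"
    have "orthogonal (Rep_symmat x) b" if "b \<in> B" for b
      using * that rep by (auto simp: orthogonal_def inner_symmat_def)
    hence "orthogonal (Rep_symmat x) (Rep_symmat x)"
      using orthogonal_to_span[of "Rep_symmat x" B] Rep_symmat[of x] B(6) by blast
    thus "x = 0"
      by (simp add: orthogonal_def Rep_symmat_inject[symmetric] Rep_symmat_ops)
  qed auto
  thus ?thesis by blast
qed

instantiation symmat :: (finite) euclidean_space
begin
definition "(Basis :: 'a symmat set) = (SOME B. is_onb B)"
instance
proof
  have *: "is_onb (Basis :: 'a symmat set)"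
    unfolding Basis_symmat_def by (rule someI_ex[OF ex_onb_symmat])
  note * = *[unfolded is_onb_def]
  show "(Basis :: 'a symmat set) \<noteq> {}" "finite (Basis :: 'a symmat set)"
    using * by auto
  fix x u v :: "'a symmat"
  show "(\<forall>u\<in>Basis. inner x u = 0) \<longleftrightarrow> x = 0" using * by blast
  assume "u \<in> Basis" "v \<in> Basis"
  thus "inner u v = (if u = v then 1 else 0)" using * by blast
qed
end

definition sym_part :: "real^('d::finite)^'d \<Rightarrow> 'd symmat" where
  "sym_part M = Abs_symmat ((1/2) *\<^sub>R (M + transpose M))"


section \<open>Functions as vectors\<close>

text \<open>
  Elements of function spaces are represented by functions; equality in a space is equality up to
  null vectors of its semi-inner product.  This pointwise structure extends to the triples of
  functions used below.
\<close>

instantiation "fun" :: (type, real_vector) real_vector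
begin
definition "c *\<^sub>R f = (\<lambda>x. c *\<^sub>R f x)"
instance
  by standard (simp_all add: scaleR_fun_def fun_eq_iff algebra_simps)
end


section \<open>Spaces of functions in space\<close>

definition Lsq :: "'x measure \<Rightarrow> ('x \<Rightarrow> 'b::euclidean_space) set" where
  "Lsq M = {f. f \<in> borel_measurable M \<and> integrable M (\<lambda>x. (norm (f x))\<^sup>2)}"

definition Lsq_inner :: "'x measure \<Rightarrow> ('x \<Rightarrow> 'b::euclidean_space) \<Rightarrow> ('x \<Rightarrow> 'b) \<Rightarrow> real" where
  "Lsq_inner M f g = (\<integral>x. f x \<bullet> g x \<partial>M)"

definition seminorm :: "('h \<Rightarrow> 'h \<Rightarrow> real) \<Rightarrow> 'h \<Rightarrow> real" where
  "seminorm ip x = sqrt (ip x x)"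

fun C_k :: "nat \<Rightarrow> ('a::euclidean_space \<Rightarrow> 'b::real_normed_vector) \<Rightarrow> bool" where
  "C_k 0 f \<longleftrightarrow> continuous_on UNIV f"
| "C_k (Suc k) f \<longleftrightarrow> (\<forall>x. f differentiable (at x))
     \<and> (\<forall>b\<in>Basis. C_k k (\<lambda>x. frechet_derivative f (at x) b))"

definition C_infinity :: "('a::euclidean_space \<Rightarrow> 'b::real_normed_vector) \<Rightarrow> bool" where
  "C_infinity f \<longleftrightarrow> (\<forall>k. C_k k f)"

definition test_function :: "'a::euclidean_space set \<Rightarrow> ('a \<Rightarrow> real) \<Rightarrow> bool" where
  "test_function S \<phi> \<longleftrightarrow> C_infinity \<phi> \<and> compact (closure {x. \<phi> x \<noteq> 0})
     \<and> closure {x. \<phi> x \<noteq> 0} \<subseteq> S"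

text \<open>Row \<open>i\<close>, column \<open>j\<close> of the gradient is the \<open>j\<close>-th partial derivative of component \<open>i\<close>.\<close>

definition has_weak_gradient ::
    "(real^'d) set \<Rightarrow> (real^'d \<Rightarrow> real^'d) \<Rightarrow> (real^'d \<Rightarrow> real^('d::finite)^'d) \<Rightarrow> bool" where
  "has_weak_gradient \<Omega> u G \<longleftrightarrow> (\<forall>\<phi>. test_function \<Omega> \<phi> \<longrightarrow> (\<forall>i j.
     (\<integral>x. u x $ i * frechet_derivative \<phi> (at x) (axis j 1) \<partial>lebesgue_on \<Omega>)
       = - (\<integral>x. G x $ i $ j * \<phi> x \<partial>lebesgue_on \<Omega>)))"

definition H1 :: "(real^'d) set \<Rightarrow> (real^'d \<Rightarrow> real^('d::finite)) set" where
  "H1 \<Omega> = {u \<in> Lsq (lebesgue_on \<Omega>). \<exists>G \<in> Lsq (lebesgue_on \<Omega>). has_weak_gradient \<Omega> u G}"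

definition weak_gradient ::
    "(real^'d) set \<Rightarrow> (real^'d \<Rightarrow> real^'d) \<Rightarrow> real^'d \<Rightarrow> real^('d::finite)^'d" where
  "weak_gradient \<Omega> u = (SOME G. G \<in> Lsq (lebesgue_on \<Omega>) \<and> has_weak_gradient \<Omega> u G)"

definition sym_gradient ::
    "(real^'d) set \<Rightarrow> (real^'d \<Rightarrow> real^'d) \<Rightarrow> real^'d \<Rightarrow> ('d::finite) symmat" where
  "sym_gradient \<Omega> u x = sym_part (weak_gradient \<Omega> u x)"

definition H1_norm :: "(real^'d) set \<Rightarrow> (real^'d \<Rightarrow> real^('d::finite)) \<Rightarrow> real" where
  "H1_norm \<Omega> u = sqrt (Lsq_inner (lebesgue_on \<Omega>) u u
     + Lsq_inner (lebesgue_on \<Omega>) (weak_gradient \<Omega> u) (weak_gradient \<Omega> u))"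


section \<open>Boundary measure, traces and the geometry of the domain\<close>

definition hausdorff_covers :: "real \<Rightarrow> 'a::metric_space set \<Rightarrow> (nat \<Rightarrow> 'a set) set" where
  "hausdorff_covers \<delta> S = {U. S \<subseteq> (\<Union>i. U i) \<and> (\<forall>i. bounded (U i) \<and> diameter (U i) \<le> \<delta>)}"

text \<open>
  In dimension \<open>s = 0\<close> nonempty sets have weight \<open>1\<close>, giving the counting measure.
  The customary constant factor normalising the Hausdorff measure is dropped: only null sets
  and convergence in the corresponding \<open>L\<^sup>2\<close> space are used.
\<close>

definition hausdorff_weight :: "nat \<Rightarrow> 'a::metric_space set \<Rightarrow> ennreal" where
  "hausdorff_weight s U = (if U = {} then 0 else ennreal (diameter U ^ s))"

definition hausdorff_pre :: "nat \<Rightarrow> real \<Rightarrow> 'a::metric_space set \<Rightarrow> ennreal" where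
  "hausdorff_pre s \<delta> S = (INF U\<in>hausdorff_covers \<delta> S. \<Sum>i. hausdorff_weight s (U i))"

definition hausdorff_outer :: "nat \<Rightarrow> 'a::metric_space set \<Rightarrow> ennreal" where
  "hausdorff_outer s S = (SUP \<delta>\<in>{0<..}. hausdorff_pre s \<delta> S)"

definition hausdorff_measure :: "nat \<Rightarrow> 'a::metric_space measure" where
  "hausdorff_measure s = measure_of UNIV (sets borel) (hausdorff_outer s)"

text \<open>
  \<open>hausdorff_outer\<close> is a metric outer measure, hence countably additive on Borel sets, so that
  \<open>hausdorff_measure\<close> is not the degenerate result of \<open>measure_of\<close>.
\<close>

lemma hausdorff_weight_empty [simp]: "hausdorff_weight s {} = 0"
  by (simp add: hausdorff_weight_def)

lemma hausdorff_pre_mono: "S \<subseteq> S' \<Longrightarrow> hausdorff_pre s \<delta> S \<le> hausdorff_pre s \<delta> S'"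
  unfolding hausdorff_pre_def by (rule INF_superset_mono) (auto simp: hausdorff_covers_def)

lemma hausdorff_pre_antimono: "\<delta> \<le> \<delta>' \<Longrightarrow> hausdorff_pre s \<delta>' S \<le> hausdorff_pre s \<delta> S"
  unfolding hausdorff_pre_def
  by (rule INF_superset_mono) (auto simp: hausdorff_covers_def intro: order_trans)

lemma hausdorff_outer_mono: "S \<subseteq> S' \<Longrightarrow> hausdorff_outer s S \<le> hausdorff_outer s S'"
  unfolding hausdorff_outer_def by (rule SUP_mono) (auto intro: hausdorff_pre_mono)

lemma hausdorff_outer_empty: "hausdorff_outer s {} = 0"
proof -
  have "hausdorff_pre s \<delta> {} \<le> 0" if "0 < \<delta>" for \<delta>
    unfolding hausdorff_pre_def
    by (rule INF_lower2[of "\<lambda>_. {}"]) (use that in \<open>auto simp: hausdorff_covers_def\<close>)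
  then have "hausdorff_outer s {} \<le> 0"
    unfolding hausdorff_outer_def by (intro SUP_least) auto
  then show ?thesis by simp
qed

lemma hausdorff_pre_subadditive:
  fixes A :: "nat \<Rightarrow> 'a::metric_space set"
  shows "hausdorff_pre s \<delta> (\<Union>i. A i) \<le> (\<Sum>i. hausdorff_pre s \<delta> (A i))"
proof (rule ennreal_le_epsilon)
  let ?O = "hausdorff_pre s \<delta>"
  fix e :: real assume e: "0 < e" and fin: "(\<Sum>n. ?O (A n)) < top"
  then have *: "\<And>n. ?O (A n) < ?O (A n) + e * (1/2)^Suc n"
    by (auto simp add: less_top dest!: ennreal_suminf_lessD)
  have "\<exists>B. B \<in> hausdorff_covers \<delta> (A n)
      \<and> (\<Sum>i. hausdorff_weight s (B i)) \<le> ?O (A n) + e * (1/2)^Suc n" for n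
    using *[of n] unfolding hausdorff_pre_def INF_less_iff by (blast intro: less_imp_le)
  then obtain B where B: "\<And>n. B n \<in> hausdorff_covers \<delta> (A n)"
    and Ble: "\<And>n. (\<Sum>i. hausdorff_weight s (B n i)) \<le> ?O (A n) + e * (1/2)^Suc n"
    by metis
  define C where "C = case_prod B o prod_decode"
  have Bsub: "A n \<subseteq> (\<Union>i. B n i)" and Bbd: "bounded (B n i) \<and> diameter (B n i) \<le> \<delta>" for n i
    using B[of n] unfolding hausdorff_covers_def by blast+
  have "(\<Union>i. A i) \<subseteq> (\<Union>i. C i)"
  proof
    fix x assume "x \<in> (\<Union>i. A i)"
    then obtain n i where "x \<in> B n i" using Bsub by blast
    then have "x \<in> C (prod_encode (n, i))" by (simp add: C_def)
    then show "x \<in> (\<Union>i. C i)" by blast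
  qed
  then have "C \<in> hausdorff_covers \<delta> (\<Union>i. A i)"
    using Bbd by (simp add: hausdorff_covers_def C_def split_def)
  then have "?O (\<Union>i. A i) \<le> (\<Sum>i. hausdorff_weight s (C i))"
    unfolding hausdorff_pre_def by (rule INF_lower)
  also have "\<dots> = (\<Sum>n. \<Sum>i. hausdorff_weight s (B n i))"
    unfolding C_def comp_def by (intro suminf_ennreal_2dimen) auto
  also have "\<dots> \<le> (\<Sum>n. ?O (A n) + e * (1/2) ^ Suc n)"
    by (intro suminf_le allI Ble) auto
  also have "\<dots> = (\<Sum>n. ?O (A n)) + (\<Sum>n. ennreal e * ennreal ((1/2) ^ Suc n))"
    using \<open>0 < e\<close> by (subst suminf_add[symmetric])
                     (auto simp del: ennreal_suminf_cmult simp add: ennreal_mult[symmetric])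
  also have "\<dots> = (\<Sum>n. ?O (A n)) + e"
    unfolding ennreal_suminf_cmult
    by (subst suminf_ennreal_eq[OF zero_le_power power_half_series]) auto
  finally show "?O (\<Union>i. A i) \<le> (\<Sum>n. ?O (A n)) + e" .
qed

lemma hausdorff_outer_subadditive:
  "hausdorff_outer s (\<Union>i. A i) \<le> (\<Sum>i. hausdorff_outer s (A (i::nat)))"
  unfolding hausdorff_outer_def[of s "\<Union>i. A i"]
proof (rule SUP_least)
  fix \<delta> :: real assume "\<delta> \<in> {0<..}"
  then have "hausdorff_pre s \<delta> (A i) \<le> hausdorff_outer s (A i)" for i
    unfolding hausdorff_outer_def by (rule SUP_upper)
  then have "(\<Sum>i. hausdorff_pre s \<delta> (A i)) \<le> (\<Sum>i. hausdorff_outer s (A i))"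
    by (intro suminf_le) auto
  then show "hausdorff_pre s \<delta> (\<Union>i. A i) \<le> (\<Sum>i. hausdorff_outer s (A i))"
    using hausdorff_pre_subadditive order_trans by blast
qed

lemma outer_measure_space_hausdorff: "outer_measure_space (Pow UNIV) (hausdorff_outer s)"
  by (simp add: outer_measure_space_def positive_def increasing_def countably_subadditive_def
      hausdorff_outer_empty hausdorff_outer_mono hausdorff_outer_subadditive)

lemma hausdorff_outer_Un: "hausdorff_outer s (X \<union> Y) \<le> hausdorff_outer s X + hausdorff_outer s Y"
proof -
  have "(\<Union>i. binaryset X Y i) = X \<union> Y" by (rule UN_binaryset_eq)
  then show ?thesis
    using hausdorff_outer_subadditive[of s "binaryset X Y"]
      suminf_binaryset_eq[of "hausdorff_outer s" X Y] by (simp add: hausdorff_outer_empty)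
qed

lemma hausdorff_outer_separated:
  assumes "0 < r" and sep: "\<And>x y. x \<in> X \<Longrightarrow> y \<in> Y \<Longrightarrow> r \<le> dist x y"
  shows "hausdorff_outer s X + hausdorff_outer s Y \<le> hausdorff_outer s (X \<union> Y)"
proof -
  have pre: "hausdorff_pre s \<delta> X + hausdorff_pre s \<delta> Y \<le> hausdorff_pre s \<delta> (X \<union> Y)"
    if d: "0 < \<delta>" "\<delta> < r" for \<delta>
    unfolding hausdorff_pre_def[of s \<delta> "X \<union> Y"]
  proof (rule INF_greatest)
    fix U assume "U \<in> hausdorff_covers \<delta> (X \<union> Y)"
    then have U: "X \<union> Y \<subseteq> (\<Union>i. U i)" "\<And>i. bounded (U i)" "\<And>i. diameter (U i) \<le> \<delta>"
      by (auto simp: hausdorff_covers_def)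
    let ?V = "\<lambda>i. if U i \<inter> X = {} then {} else U i"
    let ?W = "\<lambda>i. if U i \<inter> X = {} then U i else {}"
    have disj: "U i \<inter> X = {} \<or> U i \<inter> Y = {}" for i
    proof (rule ccontr)
      assume "\<not> ?thesis"
      then obtain x y where "x \<in> U i" "x \<in> X" "y \<in> U i" "y \<in> Y" by blast
      then show False
        using sep[of x y] diameter_bounded_bound[OF U(2), of x i y] U(3)[of i] d(2) by linarith
    qed
    have "X \<subseteq> (\<Union>i. ?V i)"
    proof
      fix x assume x: "x \<in> X"
      then obtain i where "x \<in> U i" using U(1) by blast
      then have "x \<in> ?V i" using x by (simp add: disjoint_iff) blast
      then show "x \<in> (\<Union>i. ?V i)" by (rule UN_I[OF UNIV_I])
    qed
    then have "?V \<in> hausdorff_covers \<delta> X"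
      using U(2,3) d(1) by (simp add: hausdorff_covers_def)
    moreover have "Y \<subseteq> (\<Union>i. ?W i)"
    proof
      fix y assume y: "y \<in> Y"
      then obtain i where "y \<in> U i" using U(1) by blast
      then have "y \<in> ?W i" using y disj[of i] by (simp add: disjoint_iff) blast
      then show "y \<in> (\<Union>i. ?W i)" by (rule UN_I[OF UNIV_I])
    qed
    then have "?W \<in> hausdorff_covers \<delta> Y"
      using U(2,3) d(1) by (simp add: hausdorff_covers_def)
    ultimately have "hausdorff_pre s \<delta> X + hausdorff_pre s \<delta> Y
        \<le> (\<Sum>i. hausdorff_weight s (?V i)) + (\<Sum>i. hausdorff_weight s (?W i))"
      unfolding hausdorff_pre_def by (intro add_mono INF_lower)
    also have "\<dots> = (\<Sum>i. hausdorff_weight s (?V i) + hausdorff_weight s (?W i))"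
      by (rule suminf_add) auto
    also have "\<dots> = (\<Sum>i. hausdorff_weight s (U i))"
      by (rule arg_cong[where f = suminf]) auto
    finally show "hausdorff_pre s \<delta> X + hausdorff_pre s \<delta> Y \<le> (\<Sum>i. hausdorff_weight s (U i))" .
  qed
  have "hausdorff_outer s X + hausdorff_outer s Y
      = (SUP \<delta>\<in>{0<..}. hausdorff_pre s \<delta> X + hausdorff_pre s \<delta> Y)"
    unfolding hausdorff_outer_def
  proof (rule SUP_add_directed_ennreal[symmetric])
    fix i j :: real assume "i \<in> {0<..}" "j \<in> {0<..}"
    then show "\<exists>k\<in>{0<..}. hausdorff_pre s i X + hausdorff_pre s j Y
        \<le> hausdorff_pre s k X + hausdorff_pre s k Y"
      by (intro bexI[of _ "min i j"] add_mono hausdorff_pre_antimono) auto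
  qed
  also have "\<dots> \<le> hausdorff_outer s (X \<union> Y)"
  proof (rule SUP_least)
    fix \<delta> :: real assume \<delta>: "\<delta> \<in> {0<..}"
    let ?d = "min \<delta> (r / 2)"
    have "hausdorff_pre s \<delta> X + hausdorff_pre s \<delta> Y \<le> hausdorff_pre s ?d X + hausdorff_pre s ?d Y"
      by (intro add_mono hausdorff_pre_antimono) auto
    also have "\<dots> \<le> hausdorff_pre s ?d (X \<union> Y)"
      using \<delta> \<open>0 < r\<close> by (intro pre) auto
    also have "\<dots> \<le> hausdorff_outer s (X \<union> Y)"
      unfolding hausdorff_outer_def by (rule SUP_upper) (use \<delta> \<open>0 < r\<close> in auto)
    finally show "hausdorff_pre s \<delta> X + hausdorff_pre s \<delta> Y \<le> hausdorff_outer s (X \<union> Y)" .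
  qed
  finally show ?thesis .
qed

lemma hausdorff_outer_closed:
  fixes C :: "'a::metric_space set"
  assumes "closed C"
  shows "hausdorff_outer s (X \<inter> C) + hausdorff_outer s (X - C) \<le> hausdorff_outer s X"
proof (cases "C = {} \<or> hausdorff_outer s X = \<infinity>")
  case True
  then show ?thesis by (auto simp: hausdorff_outer_empty)
next
  case False
  then have ne: "C \<noteq> {}" and fin: "hausdorff_outer s X < \<infinity>"
    by (auto simp: less_top)
  let ?H = "hausdorff_outer s"
  define A where "A n = {x \<in> X - C. 1 / real (Suc n) \<le> infdist x C}" for n
  define R where "R n = A (Suc n) - A n" for n
  have AX: "A n \<subseteq> X - C" for n by (auto simp: A_def)
  have A_mono: "A m \<subseteq> A n" if "m \<le> n" for m n
  proof -
    have "1 / real (Suc n) \<le> 1 / real (Suc m)"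
      using that by (intro divide_left_mono) auto
    then show ?thesis by (auto simp: A_def)
  qed
  have CA: "?H (X \<inter> C) + ?H (A n) \<le> ?H X" for n
  proof -
    have "?H (X \<inter> C) + ?H (A n) \<le> ?H (X \<inter> C \<union> A n)"
    proof (rule hausdorff_outer_separated)
      show "0 < 1 / real (Suc n)" by simp
      fix x y assume "x \<in> X \<inter> C" "y \<in> A n"
      then show "1 / real (Suc n) \<le> dist x y"
        using infdist_le[of x C y] by (auto simp: A_def dist_commute)
    qed
    also have "\<dots> \<le> ?H X" by (rule hausdorff_outer_mono) (use AX in auto)
    finally show ?thesis .
  qed
  have AR: "?H (A n) + ?H (R (Suc n)) \<le> ?H (A (Suc (Suc n)))" for n
  proof -
    have "?H (A n) + ?H (R (Suc n)) \<le> ?H (A n \<union> R (Suc n))"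
    proof (rule hausdorff_outer_separated)
      have "1 / real (Suc (Suc n)) < 1 / real (Suc n)"
        by (intro divide_strict_left_mono) auto
      then show "0 < 1 / real (Suc n) - 1 / real (Suc (Suc n))" by simp
      fix x y assume x: "x \<in> A n" and y: "y \<in> R (Suc n)"
      have "infdist x C \<le> infdist y C + dist x y" by (rule infdist_triangle)
      moreover have "1 / real (Suc n) \<le> infdist x C" using x by (simp add: A_def)
      moreover have "infdist y C < 1 / real (Suc (Suc n))"
        using y AX[of "Suc (Suc n)"] by (auto simp: R_def A_def)
      ultimately show "1 / real (Suc n) - 1 / real (Suc (Suc n)) \<le> dist x y" by linarith
    qed
    also have "\<dots> \<le> ?H (A (Suc (Suc n)))"
      by (rule hausdorff_outer_mono) (use A_mono[of n "Suc (Suc n)"] in \<open>auto simp: R_def\<close>)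
    finally show ?thesis .
  qed
  have part: "(\<Sum>j<m. ?H (R (2 * j + i + 1))) \<le> ?H (A (2 * m + i))" for m i
  proof (induction m)
    case (Suc m)
    have "(\<Sum>j<Suc m. ?H (R (2 * j + i + 1))) \<le> ?H (A (2 * m + i)) + ?H (R (Suc (2 * m + i)))"
      using Suc by (simp add: add_mono)
    also have "\<dots> \<le> ?H (A (2 * Suc m + i))" using AR[of "2 * m + i"] by simp
    finally show ?case .
  qed simp
  let ?f = "\<lambda>k. ?H (R (Suc k))"
  have sum_split: "(\<Sum>k<2*m. ?f k) = (\<Sum>j<m. ?H (R (2 * j + 0 + 1))) + (\<Sum>j<m. ?H (R (2 * j + 1 + 1)))" for m
    by (induction m) (simp_all add: ac_simps)
  have bnd: "(\<Sum>k<n. ?f k) \<le> ?H X + ?H X" for n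
  proof -
    have "(\<Sum>k<n. ?f k) \<le> (\<Sum>k<2*n. ?f k)" by (rule sum_mono2) auto
    also have "\<dots> \<le> ?H (A (2 * n + 0)) + ?H (A (2 * n + 1))"
      unfolding sum_split by (intro add_mono part)
    also have "\<dots> \<le> ?H X + ?H X"
      using AX by (intro add_mono hausdorff_outer_mono) auto
    finally show ?thesis .
  qed
  have "(\<Sum>k. ?f k) \<le> ?H X + ?H X"
    unfolding suminf_eq_SUP by (rule SUP_least) (rule bnd)
  then have Sfin: "(\<Sum>k. ?f k) < top"
    using fin by (auto simp: less_top[symmetric] top_unique)
  have tail: "(\<Sum>k. ?f (k + n)) = (\<Sum>k. ?f k) - (\<Sum>k<n. ?f k)" for n
  proof -
    have "(\<Sum>k. ?f k) = (\<Sum>k. ?f (k + n)) + (\<Sum>k<n. ?f k)"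
      by (rule suminf_offset) simp
    moreover have "(\<Sum>k<n. ?f k) < top"
      using fin by (intro le_less_trans[OF bnd]) (simp add: ennreal_add_less_top)
    ultimately show ?thesis by (simp add: less_top)
  qed
  have "(\<lambda>n. (\<Sum>k. ?f k) - (\<Sum>k<n. ?f k)) \<longlonglongrightarrow> (\<Sum>k. ?f k) - (\<Sum>k. ?f k)"
    using Sfin by (intro tendsto_diff_ennreal tendsto_const summable_LIMSEQ) (auto simp: less_top)
  then have lim: "(\<lambda>n. \<Sum>k. ?f (k + n)) \<longlonglongrightarrow> 0"
    unfolding tail using Sfin by (simp add: diff_eq_0_iff_ennreal)
  have Y: "?H (X - C) \<le> ?H (A (Suc n)) + (\<Sum>k. ?f (k + n))" for n
  proof -
    have "X - C \<subseteq> A (Suc n) \<union> (\<Union>k. R (Suc (k + n)))"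
    proof
      fix x assume x: "x \<in> X - C"
      then have "infdist x C \<noteq> 0" using in_closed_iff_infdist_zero[OF assms ne] by blast
      then have "0 < infdist x C" using infdist_nonneg[of x C] by linarith
      then obtain N where "inverse (real (Suc N)) < infdist x C" using reals_Archimedean by blast
      then have ex: "x \<in> A N" using x by (simp add: A_def inverse_eq_divide)
      define M where "M = (LEAST N. x \<in> A N)"
      have M: "x \<in> A M" "\<And>k. k < M \<Longrightarrow> x \<notin> A k"
        unfolding M_def using ex by (auto intro: LeastI dest: not_less_Least)
      show "x \<in> A (Suc n) \<union> (\<Union>k. R (Suc (k + n)))"
      proof (cases "M \<le> Suc n")
        case True
        then show ?thesis using A_mono M by blast
      next
        case False
        then have "M = Suc (Suc ((M - 2 - n) + n))" by linarith
        then have "x \<in> R (Suc ((M - 2 - n) + n))"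
          using M by (metis DiffI R_def lessI)
        then show ?thesis by blast
      qed
    qed
    then have "?H (X - C) \<le> ?H (A (Suc n)) + ?H (\<Union>k. R (Suc (k + n)))"
      by (meson hausdorff_outer_Un hausdorff_outer_mono order_trans)
    also have "\<dots> \<le> ?H (A (Suc n)) + (\<Sum>k. ?f (k + n))"
      by (intro add_left_mono hausdorff_outer_subadditive)
    finally show ?thesis .
  qed
  have le: "?H (X \<inter> C) + ?H (X - C) \<le> ?H X + (\<Sum>k. ?f (k + n))" for n
  proof -
    have "?H (X \<inter> C) + ?H (X - C) \<le> ?H (X \<inter> C) + (?H (A (Suc n)) + (\<Sum>k. ?f (k + n)))"
      by (intro add_left_mono Y)
    also have "\<dots> \<le> ?H X + (\<Sum>k. ?f (k + n))"
      unfolding add.assoc[symmetric] by (intro add_right_mono CA)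
    finally show ?thesis .
  qed
  have "(\<lambda>n. ?H X + (\<Sum>k. ?f (k + n))) \<longlonglongrightarrow> ?H X + 0"
    by (intro tendsto_add tendsto_const lim)
  then show ?thesis
    using le by (intro LIMSEQ_le_const[of _ "?H X"]) auto
qed

lemma emeasure_hausdorff_measure:
  fixes S :: "'a::metric_space set"
  assumes "S \<in> sets borel"
  shows "emeasure (hausdorff_measure s) S = hausdorff_outer s S"
proof -
  let ?L = "lambda_system (UNIV :: 'a set) (Pow UNIV) (hausdorff_outer s)"
  have ms: "measure_space UNIV ?L (hausdorff_outer s)"
    by (rule sigma_algebra.caratheodory_lemma[OF sigma_algebra_Pow outer_measure_space_hausdorff])
  have L: "sigma_algebra UNIV ?L" using ms by (simp add: measure_space_def)
  have "C \<in> ?L" if "closed C" for C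
  proof -
    have "hausdorff_outer s (C \<inter> X) + hausdorff_outer s ((UNIV - C) \<inter> X) = hausdorff_outer s X" for X
    proof (rule antisym)
      have "(UNIV - C) \<inter> X = X - C" by auto
      then show "hausdorff_outer s (C \<inter> X) + hausdorff_outer s ((UNIV - C) \<inter> X) \<le> hausdorff_outer s X"
        using hausdorff_outer_closed[OF that, of s X] by (simp add: Int_commute)
      have "X = C \<inter> X \<union> (UNIV - C) \<inter> X" by auto
      then show "hausdorff_outer s X \<le> hausdorff_outer s (C \<inter> X) + hausdorff_outer s ((UNIV - C) \<inter> X)"
        by (metis hausdorff_outer_Un)
    qed
    then show ?thesis by (simp add: lambda_system_def)
  qed
  then have sub: "sigma_sets UNIV (Collect closed) \<subseteq> ?L"
    by (intro sigma_algebra.sigma_sets_subset[OF L]) auto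
  have borel: "sets (borel :: 'a measure) = sigma_sets UNIV (Collect closed)"
    by (simp add: borel_eq_closed)
  have "measure_space UNIV (sets (borel :: 'a measure)) (hausdorff_outer s)"
    by (rule measure_down[OF ms]) (use sub borel sets.sigma_algebra_axioms[of "borel :: 'a measure"] in auto)
  then show ?thesis
    using assms unfolding hausdorff_measure_def measure_space_def
    by (intro emeasure_measure_of_sigma) auto
qed

definition surface_measure :: "(real^'d) set \<Rightarrow> (real^('d::finite)) measure" where
  "surface_measure \<Omega> = restrict_space (hausdorff_measure (CARD('d) - 1)) (frontier \<Omega>)"

text \<open>The trace operator is the continuous extension of restriction to the boundary.\<close>

definition has_trace ::
    "(real^'d) set \<Rightarrow> (real^'d \<Rightarrow> real^'d) \<Rightarrow> (real^'d \<Rightarrow> real^('d::finite)) \<Rightarrow> bool" where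
  "has_trace \<Omega> u g \<longleftrightarrow> u \<in> H1 \<Omega> \<and> g \<in> Lsq (surface_measure \<Omega>)
     \<and> (\<exists>\<phi>. (\<forall>k. C_infinity (\<phi> k))
          \<and> (\<lambda>k::nat. H1_norm \<Omega> (\<phi> k - u)) \<longlonglongrightarrow> 0
          \<and> (\<lambda>k. \<integral>\<^sup>+x. ennreal ((norm (\<phi> k x - g x))\<^sup>2) \<partial>surface_measure \<Omega>) \<longlonglongrightarrow> 0)"

definition H1_D :: "(real^'d) set \<Rightarrow> (real^'d) set \<Rightarrow> (real^'d \<Rightarrow> real^('d::finite)) set" where
  "H1_D \<Omega> \<Gamma>D = {u. \<exists>g. has_trace \<Omega> u g \<and> (AE x in surface_measure \<Omega>. x \<in> \<Gamma>D \<longrightarrow> g x = 0)}"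

definition bounded_domain :: "'a::euclidean_space set \<Rightarrow> bool" where
  "bounded_domain \<Omega> \<longleftrightarrow> open \<Omega> \<and> connected \<Omega> \<and> \<Omega> \<noteq> {} \<and> bounded \<Omega>"

text \<open>
  Near each boundary point, the domain lies below the graph, in some direction \<open>e\<close>, of a Lipschitz
  function on the orthogonal complement of \<open>e\<close>.
\<close>

definition lipschitz_boundary :: "'a::euclidean_space set \<Rightarrow> bool" where
  "lipschitz_boundary \<Omega> \<longleftrightarrow> (\<forall>x\<in>frontier \<Omega>. \<exists>U e L \<gamma>.
     open U \<and> x \<in> U \<and> norm e = 1 \<and> L-lipschitz_on {z. z \<bullet> e = 0} (\<gamma> :: 'a \<Rightarrow> real)
     \<and> \<Omega> \<inter> U = {y \<in> U. y \<bullet> e < \<gamma> (y - (y \<bullet> e) *\<^sub>R e)})"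

definition bilipschitz_on :: "'a::metric_space set \<Rightarrow> ('a \<Rightarrow> 'b::metric_space) \<Rightarrow> bool" where
  "bilipschitz_on U \<Phi> \<longleftrightarrow> (\<exists>L>0. \<forall>x\<in>U. \<forall>y\<in>U.
     dist x y / L \<le> dist (\<Phi> x) (\<Phi> y) \<and> dist (\<Phi> x) (\<Phi> y) \<le> L * dist x y)"

text \<open>\<open>Min UNIV\<close> and \<open>Max UNIV\<close> are the first and the last coordinate index.\<close>

definition groeger_models :: "('d::{finite,linorder}) rvec set set" where
  "groeger_models =
     {{y. norm y < 1 \<and> y $ Max UNIV < 0},
      {y. norm y < 1 \<and> y $ Max UNIV \<le> 0},
      {y. norm y < 1 \<and> (y $ Max UNIV < 0 \<or> (y $ Max UNIV = 0 \<and> y $ Min UNIV > 0))}}"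

definition groeger_regular ::
    "('d::{finite,linorder}) rvec set \<Rightarrow> 'd rvec set \<Rightarrow> bool" where
  "groeger_regular \<Omega> \<Gamma>N \<longleftrightarrow> (\<forall>x\<in>frontier \<Omega>. \<exists>U (\<Phi> :: 'd rvec \<Rightarrow> 'd rvec).
     open U \<and> x \<in> U \<and> open (\<Phi> ` U) \<and> bilipschitz_on U \<Phi> \<and> \<Phi> ` (U \<inter> (\<Omega> \<union> \<Gamma>N)) \<in> groeger_models)"

definition boundary_partition ::
    "(real^('d::finite)) set \<Rightarrow> (real^'d) set \<Rightarrow> (real^'d) set \<Rightarrow> bool" where
  "boundary_partition \<Omega> \<Gamma>N \<Gamma>D \<longleftrightarrow> \<Gamma>N \<union> \<Gamma>D = frontier \<Omega> \<and> \<Gamma>N \<inter> \<Gamma>D = {}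
     \<and> \<Gamma>N \<in> sets (surface_measure \<Omega>) \<and> \<Gamma>D \<in> sets (surface_measure \<Omega>)
     \<and> openin (top_of_set (frontier \<Omega>)) \<Gamma>N \<and> closedin (top_of_set (frontier \<Omega>)) \<Gamma>D
     \<and> 0 < emeasure (surface_measure \<Omega>) \<Gamma>D"


section \<open>Monotone operators\<close>

text \<open>
  A set-valued operator is a relation on the representatives of a space with carrier \<open>V\<close> and
  semi-inner product \<open>ip\<close>.  Maximality forces such a relation to be closed under equality up to
  null vectors, so it is an operator on the space itself.
\<close>

definition monotone_rel :: "('h::real_vector \<Rightarrow> 'h \<Rightarrow> real) \<Rightarrow> ('h \<times> 'h) set \<Rightarrow> bool" where
  "monotone_rel ip A \<longleftrightarrow> (\<forall>(x, y)\<in>A. \<forall>(x', y')\<in>A. 0 \<le> ip (x - x') (y - y'))"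

definition maximal_monotone ::
    "'h::real_vector set \<Rightarrow> ('h \<Rightarrow> 'h \<Rightarrow> real) \<Rightarrow> ('h \<times> 'h) set \<Rightarrow> bool" where
  "maximal_monotone V ip A \<longleftrightarrow> A \<subseteq> V \<times> V \<and> monotone_rel ip A
     \<and> (\<forall>B. A \<subseteq> B \<and> B \<subseteq> V \<times> V \<and> monotone_rel ip B \<longrightarrow> B = A)"

text \<open>The relations \<open>(I + \<mu>A)\<inverse>\<close> and \<open>(1/\<mu>)(I - (I + \<mu>A)\<inverse>)\<close>.\<close>

definition resolvent :: "real \<Rightarrow> ('h::real_vector \<times> 'h) set \<Rightarrow> ('h \<times> 'h) set" where
  "resolvent \<mu> A = {(x + \<mu> *\<^sub>R y, x) | x y. (x, y) \<in> A}"

definition yosida :: "real \<Rightarrow> ('h::real_vector \<times> 'h) set \<Rightarrow> ('h \<times> 'h) set" where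
  "yosida \<mu> A = {(x, (1 / \<mu>) *\<^sub>R (x - y)) | x y. (x, y) \<in> resolvent \<mu> A}"

definition pointwise_resolvents ::
    "'x measure \<Rightarrow> (('x \<Rightarrow> 'b::real_vector) \<times> ('x \<Rightarrow> 'b)) set \<Rightarrow> bool" where
  "pointwise_resolvents M A \<longleftrightarrow> (\<forall>\<mu>>0. \<exists>r :: 'b \<Rightarrow> 'b.
     \<forall>(\<tau>, \<sigma>)\<in>resolvent \<mu> A. AE x in M. \<sigma> x = r (\<tau> x))"


section \<open>Bochner-type spaces in time\<close>

text \<open>
  The target space is again given by a carrier \<open>V\<close> and a semi-inner product \<open>ip\<close>, so that the
  Bochner integral of the library, which needs a normed target type, does not apply; the
  definitions follow it, with \<open>seminorm ip\<close> in place of the norm.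
\<close>

definition simple_into :: "'h set \<Rightarrow> 't measure \<Rightarrow> ('t \<Rightarrow> 'h) \<Rightarrow> bool" where
  "simple_into V M s \<longleftrightarrow> simple_function M s \<and> s ` space M \<subseteq> V"

definition strongly_measurable ::
    "'h::real_vector set \<Rightarrow> ('h \<Rightarrow> 'h \<Rightarrow> real) \<Rightarrow> 't measure \<Rightarrow> ('t \<Rightarrow> 'h) \<Rightarrow> bool" where
  "strongly_measurable V ip M w \<longleftrightarrow> (AE t in M. w t \<in> V)
     \<and> (\<exists>s. (\<forall>k::nat. simple_into V M (s k))
          \<and> (AE t in M. (\<lambda>k. seminorm ip (s k t - w t)) \<longlonglongrightarrow> 0))"

definition has_bochner_integral_in ::
    "'h::real_vector set \<Rightarrow> ('h \<Rightarrow> 'h \<Rightarrow> real) \<Rightarrow> 't measure \<Rightarrow> ('t \<Rightarrow> 'h) \<Rightarrow> 'h \<Rightarrow> bool" where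
  "has_bochner_integral_in V ip M w I \<longleftrightarrow> I \<in> V \<and> strongly_measurable V ip M w
     \<and> (\<exists>s. (\<forall>k::nat. simple_into V M (s k))
          \<and> (\<lambda>k. \<integral>\<^sup>+t. ennreal (seminorm ip (s k t - w t)) \<partial>M) \<longlonglongrightarrow> 0
          \<and> (\<lambda>k. seminorm ip (Bochner_Integration.simple_bochner_integral M (s k) - I)) \<longlonglongrightarrow> 0)"

definition L2_time ::
    "'h::real_vector set \<Rightarrow> ('h \<Rightarrow> 'h \<Rightarrow> real) \<Rightarrow> real \<Rightarrow> (real \<Rightarrow> 'h) set" where
  "L2_time V ip T = {w. strongly_measurable V ip (lebesgue_on {0..T}) w
     \<and> (\<integral>\<^sup>+t. ennreal ((seminorm ip (w t))\<^sup>2) \<partial>lebesgue_on {0..T}) < \<infinity>}"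

definition has_weak_time_derivative ::
    "'h::real_vector set \<Rightarrow> ('h \<Rightarrow> 'h \<Rightarrow> real) \<Rightarrow> real \<Rightarrow> (real \<Rightarrow> 'h) \<Rightarrow> (real \<Rightarrow> 'h) \<Rightarrow> bool" where
  "has_weak_time_derivative V ip T w w' \<longleftrightarrow> (\<forall>\<phi>. test_function {0<..<T} \<phi> \<longrightarrow>
     (\<exists>I. has_bochner_integral_in V ip (lebesgue_on {0..T}) (\<lambda>t. deriv \<phi> t *\<^sub>R w t) I
        \<and> has_bochner_integral_in V ip (lebesgue_on {0..T}) (\<lambda>t. \<phi> t *\<^sub>R w' t) (- I)))"

definition H1_time ::
    "'h::real_vector set \<Rightarrow> ('h \<Rightarrow> 'h \<Rightarrow> real) \<Rightarrow> real \<Rightarrow> (real \<Rightarrow> 'h) set" where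
  "H1_time V ip T = {w \<in> L2_time V ip T. \<exists>w'\<in>L2_time V ip T. has_weak_time_derivative V ip T w w'}"

definition time_derivative ::
    "'h::real_vector set \<Rightarrow> ('h \<Rightarrow> 'h \<Rightarrow> real) \<Rightarrow> real \<Rightarrow> (real \<Rightarrow> 'h) \<Rightarrow> real \<Rightarrow> 'h" where
  "time_derivative V ip T w =
     (SOME w'. w' \<in> L2_time V ip T \<and> has_weak_time_derivative V ip T w w')"

definition H1_time_norm ::
    "'h::real_vector set \<Rightarrow> ('h \<Rightarrow> 'h \<Rightarrow> real) \<Rightarrow> real \<Rightarrow> (real \<Rightarrow> 'h) \<Rightarrow> real" where
  "H1_time_norm V ip T w =
     sqrt ((\<integral>t. (seminorm ip (w t))\<^sup>2 \<partial>lebesgue_on {0..T})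
         + (\<integral>t. (seminorm ip (time_derivative V ip T w t))\<^sup>2 \<partial>lebesgue_on {0..T}))"

text \<open>The value at time \<open>0\<close> is that of the continuous representative.\<close>

definition has_initial_value ::
    "'h::real_vector set \<Rightarrow> ('h \<Rightarrow> 'h \<Rightarrow> real) \<Rightarrow> real \<Rightarrow> (real \<Rightarrow> 'h) \<Rightarrow> 'h \<Rightarrow> bool" where
  "has_initial_value V ip T w x \<longleftrightarrow> (\<exists>c. (\<forall>t\<in>{0..T}. c t \<in> V)
     \<and> (\<forall>t\<in>{0..T}. ((\<lambda>s. seminorm ip (c s - c t)) \<longlongrightarrow> 0) (at t within {0..T}))
     \<and> (AE t in lebesgue_on {0..T}. seminorm ip (c t - w t) = 0)
     \<and> seminorm ip (c 0 - x) = 0)"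


section \<open>The evolution problem\<close>

definition coercive_tensor :: "(('d::finite) symmat \<Rightarrow> 'd symmat) \<Rightarrow> bool" where
  "coercive_tensor C \<longleftrightarrow> linear C \<and> (\<forall>x y. C x \<bullet> y = x \<bullet> C y) \<and> (\<exists>c>0. \<forall>x. c * (norm x)\<^sup>2 \<le> C x \<bullet> x)"

definition D_tensor ::
    "('d symmat \<Rightarrow> 'd symmat) \<Rightarrow> ('d symmat \<Rightarrow> 'd symmat) \<Rightarrow> ('d::finite) symmat \<Rightarrow> 'd symmat" where
  "D_tensor C B = B \<circ> inv (\<lambda>x. C x + B x) \<circ> C"

definition E_tensor ::
    "('d symmat \<Rightarrow> 'd symmat) \<Rightarrow> ('d symmat \<Rightarrow> 'd symmat) \<Rightarrow> ('d::finite) symmat \<Rightarrow> 'd symmat" where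
  "E_tensor C B = C \<circ> inv (\<lambda>x. C x + B x)"

type_synonym 'd state = "(real^'d \<Rightarrow> real^'d) \<times> (real^'d \<Rightarrow> real^'d) \<times> (real^'d \<Rightarrow> 'd symmat)"

definition H_space :: "(real^'d) set \<Rightarrow> (real^'d) set \<Rightarrow> ('d::finite) state set" where
  "H_space \<Omega> \<Gamma>D = H1_D \<Omega> \<Gamma>D \<times> Lsq (lebesgue_on \<Omega>) \<times> Lsq (lebesgue_on \<Omega>)"

definition H_inner ::
    "(real^'d) set \<Rightarrow> ('d symmat \<Rightarrow> 'd symmat) \<Rightarrow> ('d symmat \<Rightarrow> 'd symmat)
       \<Rightarrow> ('d::finite) state \<Rightarrow> 'd state \<Rightarrow> real" where
  "H_inner \<Omega> C B = (\<lambda>(u1, v1, q1) (u2, v2, q2).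
     Lsq_inner (lebesgue_on \<Omega>) (\<lambda>x. D_tensor C B (sym_gradient \<Omega> u1 x)) (sym_gradient \<Omega> u2)
     + Lsq_inner (lebesgue_on \<Omega>) v1 v2 + Lsq_inner (lebesgue_on \<Omega>) q1 q2)"

text \<open>
  \<open>b\<close> is \<open>- div \<tau>\<close>, i.e. the functional \<open>- div \<tau>\<close> on \<open>H1_D\<close> is represented by the square-integrable
  function \<open>b\<close>.
\<close>

definition is_neg_div ::
    "(real^'d) set \<Rightarrow> (real^'d) set \<Rightarrow> (real^'d \<Rightarrow> ('d::finite) symmat) \<Rightarrow> (real^'d \<Rightarrow> real^'d) \<Rightarrow> bool" where
  "is_neg_div \<Omega> \<Gamma>D \<tau> b \<longleftrightarrow> b \<in> Lsq (lebesgue_on \<Omega>)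
     \<and> (\<forall>\<phi>\<in>H1_D \<Omega> \<Gamma>D. Lsq_inner (lebesgue_on \<Omega>) \<tau> (sym_gradient \<Omega> \<phi>) = Lsq_inner (lebesgue_on \<Omega>) b \<phi>)"

definition evolution_operator ::
    "(real^'d) set \<Rightarrow> (real^'d) set \<Rightarrow> ('d symmat \<Rightarrow> 'd symmat) \<Rightarrow> ('d symmat \<Rightarrow> 'd symmat)
       \<Rightarrow> ((real^'d \<Rightarrow> 'd symmat) \<times> (real^'d \<Rightarrow> 'd symmat)) set
       \<Rightarrow> (('d::finite) state \<times> 'd state) set" where
  "evolution_operator \<Omega> \<Gamma>D C B A = {((u, v, q), (a, b, c)) | u v q a b c.
     u \<in> H1_D \<Omega> \<Gamma>D \<and> v \<in> H1_D \<Omega> \<Gamma>D \<and> (a, b, c) \<in> H_space \<Omega> \<Gamma>D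
     \<and> (AE x in lebesgue_on \<Omega>. a x = - v x)
     \<and> is_neg_div \<Omega> \<Gamma>D (\<lambda>x. D_tensor C B (sym_gradient \<Omega> u x) + E_tensor C B (q x)) b
     \<and> (\<exists>s. (q, s) \<in> A
          \<and> (AE x in lebesgue_on \<Omega>. c x = s x - adjoint (E_tensor C B) (sym_gradient \<Omega> v x)))}"

definition R_map :: "(real^'d \<Rightarrow> real^'d) \<Rightarrow> ('d::finite) state" where
  "R_map f = (0, f, 0)"

definition Q_map ::
    "('d symmat \<Rightarrow> 'd symmat) \<Rightarrow> ('d symmat \<Rightarrow> 'd symmat) \<Rightarrow> real \<Rightarrow> ('d::finite) state \<Rightarrow> 'd state" where
  "Q_map C B \<rho> = (\<lambda>(a, b, c). (a, \<lambda>x. (1 / \<rho>) *\<^sub>R b x, \<lambda>x. C (c x) + B (c x)))"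

text \<open>\<open>w\<close> solves \<open>Q\<inverse> w' + A w \<ni> R f\<close> almost everywhere in time, with initial value \<open>w0\<close>.\<close>

definition solves ::
    "(real^'d) set \<Rightarrow> (real^'d) set \<Rightarrow> ('d symmat \<Rightarrow> 'd symmat) \<Rightarrow> ('d symmat \<Rightarrow> 'd symmat) \<Rightarrow> real \<Rightarrow> real
       \<Rightarrow> ('d state \<times> 'd state) set \<Rightarrow> (real \<Rightarrow> real^'d \<Rightarrow> real^'d) \<Rightarrow> ('d::finite) state
       \<Rightarrow> (real \<Rightarrow> 'd state) \<Rightarrow> bool" where
  "solves \<Omega> \<Gamma>D C B \<rho> T A f w0 w \<longleftrightarrow>
     w \<in> H1_time (H_space \<Omega> \<Gamma>D) (H_inner \<Omega> C B) T
     \<and> has_initial_value (H_space \<Omega> \<Gamma>D) (H_inner \<Omega> C B) T w w0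
     \<and> (AE t in lebesgue_on {0..T}.
          (w t, R_map (f t)
             - inv (Q_map C B \<rho>) (time_derivative (H_space \<Omega> \<Gamma>D) (H_inner \<Omega> C B) T w t)) \<in> A)"

end

theory Submission
  imports Defs
begin

text \<open>
  Write \<open>w\<close> for the solution, \<open>w\<^sub>n\<close> for the approximations, \<open>P = Q\<inverse>\<close>, \<open>a = R f - P w'\<close>,
  \<open>a\<^sub>n = R f - P w\<^sub>n'\<close> and \<open>p = a - a\<^sub>n = P (w\<^sub>n' - w')\<close>.  By definition of the Yosida approximation,
  \<open>w\<^sub>n = y + \<lambda>\<^sub>n a\<^sub>n\<close> with \<open>(y, a\<^sub>n)\<close> in the operator, so monotonicity gives
  \<open>(p, w\<^sub>n - w) \<le> \<lambda>\<^sub>n ((p, a) - \<parallel>p\<parallel>\<^sup>2)\<close> at almost every time.  The left-hand side is half the time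
  derivative of \<open>(P (w\<^sub>n - w), w\<^sub>n - w)\<close>, which vanishes at time \<open>0\<close>.  Integrating up to \<open>\<tau>\<close> shows that
  \<open>\<parallel>w\<^sub>n(\<tau>) - w(\<tau>)\<parallel>\<^sup>2\<close> is of order \<open>\<lambda>\<^sub>n\<close>; integrating up to \<open>T\<close> and dividing by \<open>\<lambda>\<^sub>n\<close> shows
  \<open>\<integral>\<parallel>p\<parallel>\<^sup>2 \<le> \<integral>(p, a)\<close>.  Hence \<open>p\<close> is bounded in \<open>L\<^sup>2\<close>, so \<open>w\<^sub>n' - w'\<close> converges weakly to \<open>0\<close>, and then
  \<open>\<integral>(p, a)\<close>, and with it \<open>\<integral>\<parallel>p\<parallel>\<^sup>2\<close>, tends to \<open>0\<close>.

  The elements of the spaces are functions rather than classes of functions, so bilinearity of the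
  inner product rests on the uniqueness of weak gradients almost everywhere.
\<close>

section \<open>Smooth functions and test functions\<close>

text \<open>States are triples of functions in a carrier with a semi-inner product, not elements of
  a normed type. Vector-valued statements in time are therefore reduced to scalar ones by testing
  with fixed vectors: increments, uniqueness of the derivative and weak convergence all become
  statements on \<open>ip (w t) x\<close>. The obstacle is the product rule behind the energy, where
  both factors vary in time. It is replaced by an increment estimate: the energy minus its supposed
  integral changes by at most a multiple of the squared variation of the path, and such a function
  is constant. The estimates close because they are tested with \<open>a\<close>, which belongs to
  the fixed solution and is square-integrable in time. The same choice makes the right-hand side
  linear in \<open>p\<close>, so that a weak limit is enough to turn boundedness of \<open>p\<close>
  into strong convergence. The weak limit itself comes from the smallness of the path at every
  single time: integrals of the derivative over intervals are increments of the path, and the bound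
  in L2 extends this from intervals to all test functions.\<close>

lemma C_k_differentiable: "C_k (Suc k) f \<Longrightarrow> f differentiable (at x)"
  by simp

lemma C_k_SucD: "C_k (Suc k) f \<Longrightarrow> C_k k f"
proof (induction k arbitrary: f)
  case 0
  then show ?case
    by (auto intro!: continuous_at_imp_continuous_on differentiable_imp_continuous_within)
qed simp

text \<open>\<open>C_k\<close> speaks of \<open>frechet_derivative\<close>, which is a choice.
  Uniqueness of derivatives lets any derivative computed by hand take its place; the closure
  properties below enter \<open>C_k\<close> this way.\<close>

lemma C_k_SucI:
  assumes "\<And>x. (f has_derivative f' x) (at x)" "\<And>b. b \<in> Basis \<Longrightarrow> C_k k (\<lambda>x. f' x b)"
  shows "C_k (Suc k) f"
proof -
  have "frechet_derivative f (at x) = f' x" for x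
    using assms(1) by (metis frechet_derivative_at)
  then show ?thesis
    using assms by (simp only: C_k.simps differentiable_def) blast
qed

lemma C_k_SucD_derivative:
  assumes "C_k (Suc k) f"
  shows "(f has_derivative frechet_derivative f (at x)) (at x)"
    "b \<in> Basis \<Longrightarrow> C_k k (\<lambda>x. frechet_derivative f (at x) b)"
  using assms by (simp_all only: C_k.simps frechet_derivative_works[symmetric])

lemma C_k_const: "C_k k (\<lambda>x. c)"
proof (induction k arbitrary: c)
  case (Suc k)
  show ?case
    by (rule C_k_SucI[where f' = "\<lambda>x y. 0"]) (auto simp: Suc)
qed simp

lemma C_k_add: "C_k k f \<Longrightarrow> C_k k g \<Longrightarrow> C_k k (\<lambda>x. f x + g x)"
proof (induction k arbitrary: f g)
  case (Suc k)
  note f = C_k_SucD_derivative[OF Suc.prems(1)] and g = C_k_SucD_derivative[OF Suc.prems(2)]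
  show ?case
    by (rule C_k_SucI, rule has_derivative_add[OF f(1) g(1)], rule Suc.IH[OF f(2) g(2)])
qed (simp add: continuous_on_add)

lemma C_k_scaleR: "C_k k f \<Longrightarrow> C_k k (\<lambda>x. c *\<^sub>R f x)"
proof (induction k arbitrary: f)
  case (Suc k)
  note D = C_k_SucD_derivative(1)[OF Suc.prems] and C = C_k_SucD_derivative(2)[OF Suc.prems]
  show ?case
    by (rule C_k_SucI, rule has_derivative_scaleR_right[OF D], rule Suc.IH[OF C])
qed (simp add: continuous_on_scaleR)

text \<open>The derivative of the product contains \<open>f\<close> and \<open>g\<close> themselves,
  and the induction hypothesis needs them at order \<open>k\<close>; \<open>C_k_SucD\<close> lowers
  them to it.\<close>

lemma C_k_mult:
  fixes f g :: "'a::euclidean_space \<Rightarrow> real"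
  shows "C_k k f \<Longrightarrow> C_k k g \<Longrightarrow> C_k k (\<lambda>x. f x * g x)"
proof (induction k arbitrary: f g)
  case (Suc k)
  note f = C_k_SucD_derivative[OF Suc.prems(1)] and g = C_k_SucD_derivative[OF Suc.prems(2)]
  show ?case
  proof (rule C_k_SucI, rule has_derivative_mult[OF f(1) g(1)])
    fix b :: 'a assume b: "b \<in> Basis"
    show "C_k k (\<lambda>x. f x * frechet_derivative g (at x) b + frechet_derivative f (at x) b * g x)"
      by (intro C_k_add Suc.IH f(2) g(2) b Suc.prems[THEN C_k_SucD])
  qed
qed (simp add: continuous_on_mult)

lemma C_k_affine:
  assumes "C_k k f" shows "C_k k (\<lambda>x. f (c *\<^sub>R x + d))"
  using assms
proof (induction k arbitrary: f)
  case 0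
  have "continuous_on UNIV (f \<circ> (\<lambda>x. c *\<^sub>R x + d))"
    by (intro continuous_on_compose continuous_intros) (use 0 in \<open>auto intro: continuous_on_subset\<close>)
  then show ?case by (simp add: o_def)
next
  case (Suc k)
  note D = C_k_SucD_derivative(1)[OF Suc.prems] and C = C_k_SucD_derivative(2)[OF Suc.prems]
  show ?case
  proof (rule C_k_SucI)
    fix x
    have "((\<lambda>x. f (c *\<^sub>R x + d)) has_derivative (\<lambda>h. frechet_derivative f (at (c *\<^sub>R x + d)) (c *\<^sub>R h))) (at x)"
      by (rule has_derivative_compose[OF _ D, of "\<lambda>x. c *\<^sub>R x + d"]) (auto intro!: derivative_eq_intros)
    then show "((\<lambda>x. f (c *\<^sub>R x + d)) has_derivative (\<lambda>h. c *\<^sub>R frechet_derivative f (at (c *\<^sub>R x + d)) h)) (at x)"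
      using has_derivative_bounded_linear[OF D] by (simp add: linear_cmul bounded_linear.linear)
  qed (use Suc.IH C in \<open>auto intro: C_k_scaleR\<close>)
qed

text \<open>A directional derivative of \<open>G j\<close> along the affine function is a constant
  multiple of \<open>G (Suc j)\<close>. The induction on the order thus needs the whole chain of
  derivatives, with \<open>j\<close> arbitrary; the chain it is meant for is
  \<open>flat_deriv\<close>.\<close>

lemma C_k_inner_compose:
  fixes e :: "'a::euclidean_space"
  assumes "\<And>j x. (G j has_real_derivative G (Suc j) x) (at x)"
  shows "C_k k (\<lambda>x. G j (c * (x \<bullet> e) + d))"
proof (induction k arbitrary: j)
  case 0
  have "continuous_on UNIV (G j)"
    using assms by (auto intro!: continuous_at_imp_continuous_on DERIV_isCont)
  then have "continuous_on UNIV (G j \<circ> (\<lambda>x. c * (x \<bullet> e) + d))"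
    by (intro continuous_on_compose continuous_intros) (auto intro: continuous_on_subset)
  then show ?case by (simp add: o_def)
next
  case (Suc k)
  show ?case
  proof (rule C_k_SucI)
    fix x
    have "(G j has_derivative (*) (G (Suc j) (c * (x \<bullet> e) + d))) (at (c * (x \<bullet> e) + d))"
      using assms by (simp add: has_field_derivative_def)
    then show "((\<lambda>x. G j (c * (x \<bullet> e) + d)) has_derivative (\<lambda>h. (c * (h \<bullet> e)) *\<^sub>R G (Suc j) (c * (x \<bullet> e) + d))) (at x)"
      by (rule has_derivative_compose[rotated, THEN has_derivative_eq_rhs]) (auto intro!: derivative_eq_intros)
  qed (intro C_k_scaleR Suc)
qed

lemma C_infinity_add: "C_infinity f \<Longrightarrow> C_infinity g \<Longrightarrow> C_infinity (\<lambda>x. f x + g x)"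
  by (simp add: C_infinity_def C_k_add)

lemma C_infinity_scaleR: "C_infinity f \<Longrightarrow> C_infinity (\<lambda>x. c *\<^sub>R f x)"
  by (simp add: C_infinity_def C_k_scaleR)

lemma C_infinity_mult:
  fixes f g :: "'a::euclidean_space \<Rightarrow> real"
  shows "C_infinity f \<Longrightarrow> C_infinity g \<Longrightarrow> C_infinity (\<lambda>x. f x * g x)"
  by (simp add: C_infinity_def C_k_mult)

lemma C_infinity_prod:
  fixes f :: "'i \<Rightarrow> 'a::euclidean_space \<Rightarrow> real"
  assumes "\<And>i. i \<in> I \<Longrightarrow> C_infinity (f i)"
  shows "C_infinity (\<lambda>x. \<Prod>i\<in>I. f i x)"
  using assms
proof (induction I rule: infinite_finite_induct)
  case (insert i I)
  then show ?case by (simp add: C_infinity_mult)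
qed (simp_all add: C_infinity_def C_k_const)

lemma C_infinity_antiderivative:
  fixes f g :: "real \<Rightarrow> real"
  assumes "\<And>x. (f has_real_derivative g x) (at x)" "C_infinity g"
  shows "C_infinity f"
  unfolding C_infinity_def
proof
  fix k
  have "C_k (Suc k) f"
  proof (rule C_k_SucI)
    show "(f has_derivative (\<lambda>h. h *\<^sub>R g x)) (at x)" for x
      using assms(1)[of x] by (simp add: has_field_derivative_def mult.commute[of _ "g x"])
  qed (use assms(2) in \<open>auto simp: C_infinity_def intro!: C_k_scaleR\<close>)
  then show "C_k k f" by (rule C_k_SucD)
qed

lemma C_infinity_has_derivative:
  "C_infinity f \<Longrightarrow> (f has_derivative frechet_derivative f (at x)) (at x)"
  unfolding C_infinity_def frechet_derivative_works[symmetric] by (blast intro: C_k_differentiable)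

lemma C_infinity_continuous: "C_infinity f \<Longrightarrow> continuous_on A f"
  unfolding C_infinity_def using continuous_on_subset C_k.simps(1) by blast

lemma C_infinity_continuous_derivative:
  "C_infinity f \<Longrightarrow> b \<in> Basis \<Longrightarrow> continuous_on A (\<lambda>x. frechet_derivative f (at x) b)"
  unfolding C_infinity_def
  using continuous_on_subset[OF C_k.simps(1)[THEN iffD1]] C_k.simps(2)[of 0 f] by blast

section \<open>The function exp(-1/t) and smooth approximations of indicators of boxes\<close>

definition flat :: "real \<Rightarrow> real" where
  "flat t = (if 0 < t then exp (- inverse t) else 0)"

lemma flat_nonneg: "0 \<le> flat t" and flat_le_1: "flat t \<le> 1"
  by (auto simp: flat_def)

lemma flat_pos: "0 < t \<Longrightarrow> 0 < flat t"
  by (auto simp: flat_def)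

lemma flat_eq_0: "t \<le> 0 \<Longrightarrow> flat t = 0"
  by (auto simp: flat_def)

text \<open>With y = 1/t, the derivative of p(y) exp(-y) in t is y^2 (p(y) - p'(y)) exp(-y). The
  recursion records the polynomial factor of the \<open>j\<close>-th derivative of
  exp(-1/t).\<close>

fun flat_poly :: "nat \<Rightarrow> real poly" where
  "flat_poly 0 = 1"
| "flat_poly (Suc j) = [:0, 0, 1:] * (flat_poly j - pderiv (flat_poly j))"

definition flat_deriv :: "nat \<Rightarrow> real \<Rightarrow> real" where
  "flat_deriv j t = (if 0 < t then poly (flat_poly j) (inverse t) * exp (- inverse t) else 0)"

lemma poly_exp_tendsto_0: "((\<lambda>y. poly p y * exp (- y)) \<longlongrightarrow> (0::real)) at_top"
proof -
  have "((\<lambda>y. coeff p i * (y ^ i / exp y)) \<longlongrightarrow> coeff p i * 0) at_top" for i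
    by (intro tendsto_mult tendsto_const tendsto_power_div_exp_0)
  then have "((\<lambda>y. \<Sum>i\<le>degree p. coeff p i * (y ^ i / exp y)) \<longlongrightarrow> (\<Sum>i\<le>degree p. 0)) at_top"
    by (intro tendsto_sum) simp
  moreover have "poly p y * exp (- y) = (\<Sum>i\<le>degree p. coeff p i * (y ^ i / exp y))" for y
    by (simp add: poly_altdef sum_distrib_right exp_minus divide_inverse mult.assoc)
  ultimately show ?thesis by simp
qed

lemma flat_deriv_has_derivative: "(flat_deriv j has_real_derivative flat_deriv (Suc j) t) (at t)"
proof -
  consider "t < 0" | "t = 0" | "0 < t" by linarith
  then show ?thesis
  proof cases
    case 1
    have "((\<lambda>_. 0) has_real_derivative 0) (at t)" by simp
    then have "(flat_deriv j has_real_derivative 0) (at t)"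
      by (rule has_field_derivative_transform_within_open[where S = "{..<0}"])
         (use 1 in \<open>auto simp: flat_deriv_def\<close>)
    then show ?thesis using 1 by (simp add: flat_deriv_def)
  next
    case 3
    have "((\<lambda>t. poly (flat_poly j) (inverse t) * exp (- inverse t)) has_real_derivative
        poly (flat_poly (Suc j)) (inverse t) * exp (- inverse t)) (at t)"
      using 3 by (auto intro!: derivative_eq_intros poly_DERIV simp: algebra_simps power2_eq_square)
    then have "(flat_deriv j has_real_derivative
        poly (flat_poly (Suc j)) (inverse t) * exp (- inverse t)) (at t)"
      by (rule has_field_derivative_transform_within_open[where S = "{0<..}"])
         (use 3 in \<open>auto simp: flat_deriv_def\<close>)
    then show ?thesis using 3 by (simp add: flat_deriv_def)
  next
    case 2
    \<comment> \<open>This is the difference quotient at 0. In y = 1/t it reads y p(y) exp(-y),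
      which explains the factor \<open>[:0, 1:]\<close> below; exponential decay beats every
      polynomial.\<close>
    have "((\<lambda>t. flat_deriv j t / t) \<longlongrightarrow> 0) (at_right 0)"
    proof -
      have "filterlim inverse at_top (at_right (0::real))"
        by (rule filterlim_inverse_at_top_right)
      from filterlim_compose[OF poly_exp_tendsto_0[of "[:0, 1:] * flat_poly j"] this]
      show ?thesis
        by (rule Lim_transform_eventually)
           (auto simp: eventually_at_filter flat_deriv_def divide_inverse ac_simps)
    qed
    moreover have "((\<lambda>t. flat_deriv j t / t) \<longlongrightarrow> 0) (at_left 0)"
      by (rule Lim_transform_eventually[OF tendsto_const])
         (auto simp: eventually_at_filter flat_deriv_def)
    ultimately have "((\<lambda>t. flat_deriv j t / t) \<longlongrightarrow> 0) (at 0)"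
      by (simp add: filterlim_split_at)
    then show ?thesis
      using 2 by (simp add: DERIV_def flat_deriv_def)
  qed
qed

lemma flat_deriv_0: "flat_deriv 0 = flat"
  by (auto simp: flat_deriv_def flat_def)

lemma C_infinity_flat: "C_infinity (\<lambda>x::'a::euclidean_space. flat (c * (x \<bullet> e) + d))"
  unfolding C_infinity_def flat_deriv_0[symmetric]
  by (intro allI C_k_inner_compose flat_deriv_has_derivative)

lemma flat_tendsto_1:
  assumes "0 < t" shows "(\<lambda>k. flat (real k * t)) \<longlonglongrightarrow> 1"
proof -
  have "(\<lambda>k. exp (- inverse (real k * t))) \<longlonglongrightarrow> exp (- (0 * inverse t))"
    unfolding inverse_mult_distrib by (intro tendsto_intros lim_inverse_n)
  then have "(\<lambda>k. exp (- inverse (real k * t))) \<longlonglongrightarrow> 1" by simp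
  then show ?thesis
    by (rule Lim_transform_eventually)
       (rule eventually_mono[OF eventually_gt_at_top[of "0::nat"]], use assms in \<open>simp add: flat_def\<close>)
qed

text \<open>\<open>k\<close> multiplies the arguments, so it sharpens the profile while every bump
  vanishes outside the same box: \<open>flat (real k * t)\<close> tends to 1 for t > 0 and is 0 for
  t \<le> 0. Hence the pointwise limit is the indicator of the open box, and a single inclusion of
  the closed box makes all bumps test functions.\<close>

definition box_bump :: "'a::euclidean_space \<Rightarrow> 'a \<Rightarrow> nat \<Rightarrow> 'a \<Rightarrow> real" where
  "box_bump l u k x = (\<Prod>b\<in>Basis. flat (real k * (x \<bullet> b - l \<bullet> b)) * flat (real k * (u \<bullet> b - x \<bullet> b)))"

lemma C_infinity_box_bump: "C_infinity (box_bump l u k)"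
proof -
  have "C_infinity (\<lambda>x::'a. \<Prod>b\<in>Basis. flat (real k * (x \<bullet> b) + (- real k * (l \<bullet> b)))
      * flat (- real k * (x \<bullet> b) + (real k * (u \<bullet> b))))"
    by (intro C_infinity_prod C_infinity_mult C_infinity_flat)
  then show ?thesis
    by (simp add: box_bump_def[abs_def] algebra_simps)
qed

lemma box_bump_bounds: "0 \<le> box_bump l u k x" "box_bump l u k x \<le> 1"
  unfolding box_bump_def
  by (auto intro!: prod_nonneg prod_le_1 mult_nonneg_nonneg mult_le_one flat_nonneg flat_le_1)

lemma box_bump_outside: "x \<notin> box l u \<Longrightarrow> box_bump l u k x = 0"
  unfolding box_bump_def by (force simp: mem_box not_less flat_eq_0 mult_nonneg_nonpos prod_zero_iff)

lemma box_bump_tendsto: "(\<lambda>k. box_bump l u k x) \<longlonglongrightarrow> indicator (box l u) x"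
proof (cases "x \<in> box l u")
  case True
  have "(\<lambda>k. box_bump l u k x) \<longlonglongrightarrow> (\<Prod>b\<in>(Basis::'a set). 1 * 1)"
    unfolding box_bump_def
    by (intro tendsto_prod tendsto_mult flat_tendsto_1) (use True in \<open>auto simp: mem_box\<close>)
  then show ?thesis using True by simp
qed (simp add: box_bump_outside)

lemma test_function_box_bump:
  assumes "cbox l u \<subseteq> S" shows "test_function S (box_bump l u k)"
proof -
  have "closure {x. box_bump l u k x \<noteq> 0} \<subseteq> cbox l u"
    by (intro closure_minimal closed_cbox) (use box_bump_outside box_subset_cbox in fastforce)
  then show ?thesis
    using assms C_infinity_box_bump
    using bounded_subset[OF bounded_cbox, OF \<open>_ \<subseteq> cbox l u\<close>]
    by (auto simp: test_function_def compact_eq_bounded_closed)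
qed

section \<open>The fundamental lemma of the calculus of variations\<close>

lemma AE_lebesgue_on_not_in:
  assumes "S \<in> sets lebesgue" "negligible N"
  shows "AE x in lebesgue_on S. x \<notin> N"
proof -
  have "AE x in lebesgue. x \<notin> N"
    using assms(2) by (intro AE_not_in) (simp add: negligible_iff_null_sets)
  then have "AE x in lebesgue. x \<in> S \<longrightarrow> x \<notin> N" by (rule eventually_mono) blast
  then show ?thesis using assms(1) by (simp add: AE_restrict_space_iff)
qed

text \<open>A Lebesgue set is a Borel set up to a null set. This carries conclusions obtained from
  generators of the Borel sets over to all measurable sets of the complete measure.\<close>

lemma lebesgue_on_sets_borel:
  assumes S: "S \<in> sets lebesgue" and A: "A \<in> sets (lebesgue_on S)"
  obtains B where "B \<in> sets borel" "AE x in lebesgue_on S. indicator A x = (indicator B x :: real)"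
proof -
  from A obtain A0 where A0: "A0 \<in> sets lebesgue" "A = S \<inter> A0" by (auto simp: sets_restrict_space)
  from A0(1) obtain B N N' where B: "A0 = B \<union> N" "N \<subseteq> N'" "N' \<in> null_sets lborel" "B \<in> sets lborel"
    by (rule sets_completionE)
  have "negligible N"
    using B(2,3) by (auto simp: negligible_iff_null_sets intro: null_sets_completion_subset null_sets_completionI)
  from AE_lebesgue_on_not_in[OF S this] AE_space
  have "AE x in lebesgue_on S. indicator A x = (indicator B x :: real)"
    by eventually_elim (auto simp: A0(2) B(1) indicator_def)
  then show ?thesis using that B(4) by simp
qed

text \<open>Boxes form an intersection-stable generator of the Borel sets, and the sets over which
  \<open>f\<close> integrates to 0 are closed under complements, by the assumption on the total
  integral, and under countable disjoint unions. So \<open>f\<close> integrates to 0 over every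
  Borel set, hence over every measurable one, and vanishes almost everywhere.\<close>

lemma AE_eq_0_of_box_integrals:
  assumes S: "S \<in> lmeasurable" and f: "integrable (lebesgue_on S) (f :: 'a::euclidean_space \<Rightarrow> real)"
    and tot: "integral\<^sup>L (lebesgue_on S) f = 0"
    and box: "\<And>l u. (\<integral>x. indicator (box l u) x * f x \<partial>lebesgue_on S) = 0"
  shows "AE x in lebesgue_on S. f x = 0"
proof -
  let ?M = "lebesgue_on S"
  have meas: "A \<inter> S \<in> sets ?M" if "A \<in> sets borel" for A
    using that S by (auto simp: sets_restrict_space fmeasurableD)
  have int: "integrable ?M (\<lambda>x. indicator A x * f x)" if "A \<in> sets borel" for A
  proof -
    have "integrable ?M (\<lambda>x. indicator (A \<inter> S) x *\<^sub>R f x)"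
      by (rule integrable_mult_indicator[OF meas[OF that] f])
    then show ?thesis
      by (rule Bochner_Integration.integrable_cong[THEN iffD1, rotated 2]) (auto simp: indicator_def)
  qed
  have borel0: "(\<integral>x. indicator A x * f x \<partial>?M) = 0" if "A \<in> sets borel" for A
  proof -
    have "Int_stable (range (\<lambda>(a, b). box a b :: 'a set))"
      by (auto simp: Int_stable_def box_Int_box)
    moreover have "range (\<lambda>(a, b). box a b :: 'a set) \<subseteq> Pow UNIV" by auto
    moreover have "A \<in> sigma_sets UNIV (range (\<lambda>(a, b). box a b :: 'a set))"
      using that unfolding borel_eq_box by simp
    ultimately show ?thesis
    proof (induction rule: sigma_sets_induct_disjoint)
      case (basic A) then show ?case using box by auto
    next
      case empty show ?case by simp
    next
      case (compl A)
      then have "A \<in> sets borel" by (simp add: borel_eq_box)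
      moreover have "indicator (UNIV - A) x * f x = f x - indicator A x * f x" for x
        by (auto simp: indicator_def)
      ultimately show ?case using compl tot int f by simp
    next
      case (union F)
      then have F: "F i \<in> sets borel" for i by (auto simp: borel_eq_box)
      have "(\<integral>x. (\<Sum>i. indicator (F i) x * f x) \<partial>?M) = (\<Sum>i. \<integral>x. indicator (F i) x * f x \<partial>?M)"
      proof (rule integral_suminf)
        have sm: "(\<lambda>i. indicat_real (F i) x) sums indicat_real (\<Union>i. F i) x" for x
          by (rule indicator_sums) (use union.hyps in \<open>auto simp: disjoint_family_on_def\<close>)
        show "AE x in ?M. summable (\<lambda>i. norm (indicat_real (F i) x * f x))"
          using sm by (auto simp: abs_mult summable_mult2 sums_iff)
        \<comment> \<open>Disjointness bounds the sum of the indicators by 1, so all partial sums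
          stay below the integral of \<open>norm (f x)\<close>.\<close>
        show "summable (\<lambda>i. \<integral>x. norm (indicat_real (F i) x * f x) \<partial>?M)"
        proof (rule summableI_nonneg_bounded)
          fix n
          have "(\<Sum>i<n. \<integral>x. norm (indicat_real (F i) x * f x) \<partial>?M)
             = (\<integral>x. (\<Sum>i<n. norm (indicat_real (F i) x * f x)) \<partial>?M)"
            using int[OF F] by (subst Bochner_Integration.integral_sum) (auto simp: integrable_norm[OF int[OF F], simplified])
          also have "\<dots> \<le> (\<integral>x. norm (f x) \<partial>?M)"
          proof (rule integral_mono)
            show "integrable ?M (\<lambda>x. \<Sum>i<n. norm (indicat_real (F i) x * f x))"
              by (intro Bochner_Integration.integrable_sum integrable_norm int F)
            fix x
            have "(\<Sum>i<n. indicat_real (F i) x) \<le> (\<Sum>i. indicat_real (F i) x)"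
              using sm[of x] by (intro sum_le_suminf) (auto simp: sums_iff)
            also have "\<dots> \<le> 1" using sm[of x] by (simp add: sums_iff indicator_le_1)
            finally have "(\<Sum>i<n. indicat_real (F i) x) * norm (f x) \<le> 1 * norm (f x)"
              by (intro mult_right_mono) auto
            then show "(\<Sum>i<n. norm (indicat_real (F i) x * f x)) \<le> norm (f x)"
              by (simp add: abs_mult sum_distrib_right)
          qed (use f in auto)
          finally show "(\<Sum>i<n. \<integral>x. norm (indicat_real (F i) x * f x) \<partial>?M) \<le> (\<integral>x. norm (f x) \<partial>?M)" .
        qed simp
      qed (rule int[OF F])
      moreover have "(\<Sum>i. indicator (F i) x * f x) = indicator (\<Union>i. F i) x * f x" for x
      proof -
        have "(\<lambda>i. indicat_real (F i) x) sums indicat_real (\<Union>i. F i) x"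
          by (rule indicator_sums) (use union.hyps in \<open>auto simp: disjoint_family_on_def\<close>)
        from sums_mult2[OF this, of "f x"] show ?thesis by (simp add: sums_iff)
      qed
      ultimately show ?case using union by simp
    qed
  qed
  show ?thesis
  proof (rule sigma_finite_measure.density_zero[OF _ f])
    interpret finite_measure ?M
      by (rule finite_measure_lebesgue_on[OF S])
    show "sigma_finite_measure ?M" by (rule sigma_finite_measure_axioms)
  next
    fix A assume "A \<in> sets ?M"
    then obtain B where B: "B \<in> sets borel" "AE x in ?M. indicator A x = (indicator B x :: real)"
      by (rule lebesgue_on_sets_borel[OF fmeasurableD[OF S]])
    from B(2) have "AE x in ?M. indicator A x *\<^sub>R f x = indicator B x * f x"
      by eventually_elim simp
    then have "(\<integral>x. indicator A x *\<^sub>R f x \<partial>?M) = (\<integral>x. indicator B x * f x \<partial>?M)"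
      by (rule integral_cong_AE[rotated 2])
         (use \<open>A \<in> sets ?M\<close> f int[OF B(1)] in \<open>auto intro!: borel_measurable_integrable\<close>)
    then show "set_lebesgue_integral ?M A f = 0"
      using borel0[OF B(1)] by (simp add: set_lebesgue_integral_def)
  qed
qed

text \<open>The bumps of the box are admissible test functions with values in [0, 1] that converge
  to its indicator, so dominated convergence with \<open>norm (g x)\<close> applies.\<close>

lemma integral_box_eq_0:
  fixes g :: "'a::euclidean_space \<Rightarrow> real"
  assumes S: "S \<in> lmeasurable" and g: "integrable (lebesgue_on S) g"
    and test: "\<And>\<phi>. test_function U \<phi> \<Longrightarrow> (\<integral>x. \<phi> x * g x \<partial>lebesgue_on S) = 0"
    and sub: "cbox l u \<subseteq> U"
  shows "(\<integral>x. indicator (box l u) x * g x \<partial>lebesgue_on S) = 0"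
proof -
  have [measurable]: "g \<in> borel_measurable (lebesgue_on S)" using g by simp
  have cont: "continuous_on UNIV (box_bump l u k)" for k
    by (rule C_infinity_continuous[OF C_infinity_box_bump])
  have [measurable]: "box_bump l u k \<in> borel_measurable (lebesgue_on S)" for k
    using borel_measurable_continuous_onI[OF cont]
    by (simp add: measurable_completion measurable_restrict_space1)
  have [measurable]: "indicat_real (box l u) \<in> borel_measurable (lebesgue_on S)"
    by (simp add: measurable_completion measurable_restrict_space1)
  have "(\<lambda>k. \<integral>x. box_bump l u k x * g x \<partial>lebesgue_on S)
      \<longlonglongrightarrow> (\<integral>x. indicator (box l u) x * g x \<partial>lebesgue_on S)"
  proof (rule integral_dominated_convergence)
    show "integrable (lebesgue_on S) (\<lambda>x. norm (g x))" using g by simp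
    show "AE x in lebesgue_on S. (\<lambda>k. box_bump l u k x * g x) \<longlonglongrightarrow> indicator (box l u) x * g x"
      by (intro AE_I2 tendsto_mult box_bump_tendsto tendsto_const)
    show "AE x in lebesgue_on S. norm (box_bump l u k x * g x) \<le> norm (g x)" for k
    proof (rule AE_I2)
      fix x
      have "\<bar>box_bump l u k x\<bar> * \<bar>g x\<bar> \<le> 1 * \<bar>g x\<bar>"
        using box_bump_bounds[of l u k x] by (intro mult_right_mono) auto
      then show "norm (box_bump l u k x * g x) \<le> norm (g x)" by (simp add: abs_mult)
    qed
  qed measurable
  moreover have "(\<integral>x. box_bump l u k x * g x \<partial>lebesgue_on S) = 0" for k
    by (rule test[OF test_function_box_bump[OF sub]])
  ultimately show ?thesis
    by (simp add: LIMSEQ_const_iff)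
qed

text \<open>\<open>S\<close> may exceed \<open>U\<close> by a null set, so that one statement serves
  both an open domain and the closed time interval with test functions on its interior. Only boxes
  inside \<open>U\<close> can be tested, which makes the argument local: \<open>g\<close> vanishes
  almost everywhere on each such box, and countably many of them cover \<open>U\<close>.\<close>

lemma fundamental_lemma_of_variations:
  fixes g :: "'a::euclidean_space \<Rightarrow> real"
  assumes "open U" and U: "negligible (S - U)"
    and S: "S \<in> lmeasurable" and g: "integrable (lebesgue_on S) g"
    and test: "\<And>\<phi>. test_function U \<phi> \<Longrightarrow> (\<integral>x. \<phi> x * g x \<partial>lebesgue_on S) = 0"
  shows "AE x in lebesgue_on S. g x = 0"
proof -
  note box0 = integral_box_eq_0[OF S g test]
  have AE_box: "AE x in lebesgue_on S. indicator (box l u) x * g x = 0" if sub: "cbox l u \<subseteq> U" for l u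
  proof (rule AE_eq_0_of_box_integrals[OF S])
    have "integrable (lebesgue_on S) (\<lambda>x. indicator (box l u \<inter> S) x *\<^sub>R g x)"
      using S by (intro integrable_mult_indicator[OF _ g]) (auto simp: sets_restrict_space fmeasurableD)
    then show "integrable (lebesgue_on S) (\<lambda>x. indicator (box l u) x * g x)"
      by (rule Bochner_Integration.integrable_cong[THEN iffD1, rotated 2]) (auto simp: indicator_def)
    show "(\<integral>x. indicator (box l u) x * g x \<partial>lebesgue_on S) = 0" by (rule box0[OF _ sub])
    fix l' u'
    \<comment> \<open>An intersection of boxes is a box, and its closed version stays inside
      \<open>cbox l u\<close>, hence inside \<open>U\<close>.\<close>
    obtain a b where ab: "box l' u' \<inter> box l u = box a b" "cbox l' u' \<inter> cbox l u = cbox a b"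
      using box_Int_box[of l' u' l u] Int_interval[of l' u' l u] by blast
    have "(\<integral>x. indicator (box a b) x * g x \<partial>lebesgue_on S) = 0"
      by (rule box0) (use ab sub in auto)
    then show "(\<integral>x. indicator (box l' u') x * (indicator (box l u) x * g x) \<partial>lebesgue_on S) = 0"
      unfolding ab(1)[symmetric] by (simp add: indicator_inter_arith mult.assoc)
  qed
  obtain D where D: "countable D" "D \<subseteq> Pow U" "\<And>X. X \<in> D \<Longrightarrow> \<exists>a b. X = cbox a b" "\<Union>D = U"
    using open_countable_Union_open_cbox[OF \<open>open U\<close>] by blast
  have "AE x in lebesgue_on S. x \<in> X \<longrightarrow> g x = 0" if X: "X \<in> D" for X
  proof -
    obtain l u where lu: "X = cbox l u" using D(3)[OF X] by blast
    \<comment> \<open>The cover consists of closed boxes while the integrals see open ones; the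
      faces in between are negligible.\<close>
    have "AE x in lebesgue_on S. x \<notin> cbox l u - box l u"
      by (rule AE_lebesgue_on_not_in[OF fmeasurableD[OF S] negligible_frontier_interval])
    moreover have "AE x in lebesgue_on S. indicator (box l u) x * g x = 0"
      by (rule AE_box) (use X D(2) lu in auto)
    ultimately show ?thesis by eventually_elim (auto simp: lu indicator_def)
  qed
  then have "AE x in lebesgue_on S. \<forall>X\<in>D. x \<in> X \<longrightarrow> g x = 0"
    by (subst AE_ball_countable[OF D(1)]) blast
  with AE_lebesgue_on_not_in[OF fmeasurableD[OF S] U] AE_space[of "lebesgue_on S"]
  show ?thesis by eventually_elim (use D(4) in auto)
qed

text \<open>The step is the normalised antiderivative of the bump
  \<open>flat t * flat (1 - t)\<close>. It is needed together with its derivative: differences of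
  rescaled steps are test functions close to indicators of intervals, and the derivatives of these
  are pairs of approximate identities.\<close>

lemma smooth_step:
  obtains \<sigma> \<beta> :: "real \<Rightarrow> real"
  where "C_infinity \<sigma>" "\<And>x. (\<sigma> has_real_derivative \<beta> x) (at x)"
    "\<And>x. 0 \<le> \<beta> x" "continuous_on UNIV \<beta>" "\<And>x. x \<notin> {0..1} \<Longrightarrow> \<beta> x = 0"
    "\<And>x. x \<le> 0 \<Longrightarrow> \<sigma> x = 0" "\<And>x. 1 \<le> x \<Longrightarrow> \<sigma> x = 1" "\<And>x. 0 \<le> \<sigma> x" "\<And>x. \<sigma> x \<le> 1"
proof -
  define b where "b t = flat t * flat (1 - t)" for t
  have "C_infinity (\<lambda>x::real. flat (1 * (x \<bullet> 1) + 0) * flat ((-1) * (x \<bullet> 1) + 1))"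
    by (intro C_infinity_mult C_infinity_flat)
  then have smooth: "C_infinity b" by (simp add: b_def[abs_def])
  have cont: "continuous_on A b" for A by (rule C_infinity_continuous[OF smooth])
  have nonneg: "0 \<le> b x" for x by (simp add: b_def flat_nonneg)
  have out: "b x = 0" if "x \<notin> {0..1}" for x using that by (auto simp: b_def flat_eq_0)
  define \<Sigma> where "\<Sigma> x = (LBINT t=0..x. b t)" for x :: real
  have d: "(\<Sigma> has_real_derivative b x) (at x)" for x
  proof -
    \<comment> \<open>This interval contains the base point 0 and has \<open>x\<close> in its
      interior, so the derivative within it is the full derivative.\<close>
    have "(\<Sigma> has_vector_derivative b x) (at x within {- \<bar>x\<bar> - 1..\<bar>x\<bar> + 1})"
      unfolding \<Sigma>_def zero_ereal_def by (rule interval_integral_FTC2) (auto intro: cont)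
    moreover have "at x within {- \<bar>x\<bar> - 1..\<bar>x\<bar> + 1} = at x"
      by (rule at_within_interior) (auto simp: interior_atLeastAtMost_real)
    ultimately show ?thesis by (simp add: has_real_derivative_iff_has_vector_derivative)
  qed
  have mono: "\<Sigma> x \<le> \<Sigma> y" if "x \<le> y" for x y
  proof (rule DERIV_nonneg_imp_nondecreasing[OF that, of \<Sigma>])
    fix t show "\<exists>z. (\<Sigma> has_real_derivative z) (at t) \<and> 0 \<le> z" using d nonneg by blast
  qed
  have const: "\<Sigma> x = \<Sigma> y" if xy: "x < y" "\<And>t. x < t \<Longrightarrow> t < y \<Longrightarrow> b t = 0" for x y
  proof -
    obtain z where "x < z" "z < y" "\<Sigma> y - \<Sigma> x = (y - x) * b z"
      using MVT2[OF xy(1) d] by blast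
    then show ?thesis using xy(2) by simp
  qed
  have z0: "\<Sigma> 0 = 0" by (simp add: \<Sigma>_def zero_ereal_def[symmetric])
  have le0: "\<Sigma> x = 0" if "x \<le> 0" for x
    using const[of x 0] out that z0 by (cases "x = 0") auto
  have ge1: "\<Sigma> x = \<Sigma> 1" if "1 \<le> x" for x
    using const[of 1 x] out that by (cases "x = 1") auto
  have pos: "\<Sigma> 1 > 0"
  proof -
    \<comment> \<open>On [1/4, 3/4] the bump is strictly positive; this is what makes the
      normalising constant nonzero.\<close>
    have "\<Sigma> (1/4) < \<Sigma> (3/4)"
    proof (rule DERIV_pos_imp_increasing[of _ _ \<Sigma>])
      fix x :: real assume "1 / 4 \<le> x" "x \<le> 3 / 4"
      then have "0 < b x" by (simp add: b_def flat_pos)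
      then show "\<exists>y. (\<Sigma> has_real_derivative y) (at x) \<and> 0 < y" using d by blast
    qed simp_all
    then show ?thesis using mono[of 0 "1/4"] mono[of "3/4" 1] z0 by simp
  qed
  define \<sigma> where "\<sigma> x = \<Sigma> x / \<Sigma> 1" for x
  have d\<sigma>: "(\<sigma> has_real_derivative b x / \<Sigma> 1) (at x)" for x
    unfolding \<sigma>_def by (intro DERIV_cdivide d)
  show ?thesis
  proof (rule that[of \<sigma> "\<lambda>x. b x / \<Sigma> 1"])
    have "C_infinity (\<lambda>x. inverse (\<Sigma> 1) *\<^sub>R b x)" by (rule C_infinity_scaleR[OF smooth])
    then have "C_infinity (\<lambda>x. b x / \<Sigma> 1)" by (simp add: divide_inverse mult.commute)
    then show "C_infinity \<sigma>" by (rule C_infinity_antiderivative[OF d\<sigma>])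
    show "continuous_on UNIV (\<lambda>x. b x / \<Sigma> 1)" using pos by (intro continuous_intros cont) auto
    fix x
    have "0 \<le> \<Sigma> x" using mono[of 0 x] le0[of x] z0 by (cases "x \<le> 0") auto
    then show "0 \<le> \<sigma> x" using pos by (simp add: \<sigma>_def)
    have "\<Sigma> x \<le> \<Sigma> 1"
      by (cases "x \<le> 1") (use mono[of x 1] eq_refl[OF ge1[of x]] in auto)
    then show "\<sigma> x \<le> 1" using pos by (simp add: \<sigma>_def)
    show "\<sigma> x = 1" if "1 \<le> x" using ge1[OF that] pos by (simp only: \<sigma>_def) simp
    show "\<sigma> x = 0" if "x \<le> 0" using le0[OF that] by (simp add: \<sigma>_def)
    show "b x / \<Sigma> 1 = 0" if "x \<notin> {0..1}" using out[OF that] by simp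
    show "0 \<le> b x / \<Sigma> 1" using nonneg pos by simp
  qed (rule d\<sigma>)
qed

section \<open>Square-integrable functions\<close>

lemma LsqD:
  assumes "f \<in> Lsq M"
  shows "f \<in> borel_measurable M" "integrable M (\<lambda>x. (norm (f x))\<^sup>2)"
  using assms by (auto simp: Lsq_def)

lemma Lsq_dominated:
  assumes "f \<in> borel_measurable M" "integrable M w"
    and "\<And>x. x \<in> space M \<Longrightarrow> (norm (f x))\<^sup>2 \<le> w x"
  shows "f \<in> Lsq M"
  unfolding Lsq_def mem_Collect_eq
proof
  show "integrable M (\<lambda>x. (norm (f x))\<^sup>2)"
  proof (rule Bochner_Integration.integrable_bound[OF assms(2)])
    show "(\<lambda>x. (norm (f x))\<^sup>2) \<in> borel_measurable M" using assms(1) by measurable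
    show "AE x in M. norm ((norm (f x))\<^sup>2) \<le> norm (w x)"
    proof (rule AE_I2)
      fix x assume "x \<in> space M"
      from assms(3)[OF this] show "norm ((norm (f x))\<^sup>2) \<le> norm (w x)"
        unfolding real_norm_def abs_power2 by linarith
    qed
  qed
qed (rule assms)

lemma Lsq_inner_integrable:
  assumes f: "f \<in> Lsq M" and g: "g \<in> Lsq M"
  shows "integrable M (\<lambda>x. f x \<bullet> g x)"
proof (rule Bochner_Integration.integrable_bound)
  show "integrable M (\<lambda>x. (norm (f x))\<^sup>2 + (norm (g x))\<^sup>2)"
    using LsqD[OF f] LsqD[OF g] by simp
  show "(\<lambda>x. f x \<bullet> g x) \<in> borel_measurable M"
    using LsqD[OF f] LsqD[OF g] by (intro borel_measurable_inner)
  show "AE x in M. norm (f x \<bullet> g x) \<le> norm ((norm (f x))\<^sup>2 + (norm (g x))\<^sup>2)"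
  proof (rule AE_I2)
    fix x
    have "\<bar>f x \<bullet> g x\<bar> \<le> norm (f x) * norm (g x)" by (rule Cauchy_Schwarz_ineq2)
    also have "\<dots> \<le> (norm (f x))\<^sup>2 + (norm (g x))\<^sup>2"
      using sum_squares_bound[of "norm (f x)" "norm (g x)"]
        mult_nonneg_nonneg[OF norm_ge_zero[of "f x"] norm_ge_zero[of "g x"]] by linarith
    finally show "norm (f x \<bullet> g x) \<le> norm ((norm (f x))\<^sup>2 + (norm (g x))\<^sup>2)" by simp
  qed
qed

lemma norm_add_sq_le: "(norm (a + b))\<^sup>2 \<le> 2 * (norm a)\<^sup>2 + 2 * (norm (b::'a::real_inner))\<^sup>2"
proof -
  have "(norm (a + b))\<^sup>2 + (norm (a - b))\<^sup>2 = 2 * (norm a)\<^sup>2 + 2 * (norm b)\<^sup>2"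
    by (simp add: power2_norm_eq_inner inner_add inner_diff inner_commute)
  then show ?thesis using zero_le_power2[of "norm (a - b)"] by linarith
qed

lemma Lsq_add: assumes f: "f \<in> Lsq M" and g: "g \<in> Lsq M" shows "(\<lambda>x. f x + g x) \<in> Lsq M"
  by (rule Lsq_dominated[where w = "\<lambda>x. 2 * (norm (f x))\<^sup>2 + 2 * (norm (g x))\<^sup>2"])
     (use LsqD[OF f] LsqD[OF g] in \<open>auto simp: norm_add_sq_le\<close>)

lemma Lsq_linear:
  fixes L :: "'a::euclidean_space \<Rightarrow> 'b::euclidean_space"
  assumes f: "f \<in> Lsq M" and L: "linear L" shows "(\<lambda>x. L (f x)) \<in> Lsq M"
proof -
  have bl: "bounded_linear L" using L by (simp add: linear_conv_bounded_linear)
  then obtain K where K: "\<And>x. norm (L x) \<le> norm x * K" using bounded_linear.bounded by blast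
  show ?thesis
  proof (rule Lsq_dominated)
    show "integrable M (\<lambda>x. K\<^sup>2 * (norm (f x))\<^sup>2)" using LsqD[OF f] by simp
    show "(\<lambda>x. L (f x)) \<in> borel_measurable M"
      using borel_measurable_continuous_onI[OF linear_continuous_on[OF bl]] LsqD(1)[OF f]
      by (rule measurable_compose_rev)
    fix x show "(norm (L (f x)))\<^sup>2 \<le> K\<^sup>2 * (norm (f x))\<^sup>2"
      using power_mono[OF K[of "f x"] norm_ge_zero, of 2] by (simp add: power_mult_distrib mult.commute)
  qed
qed

lemma Lsq_scaleR: "f \<in> Lsq M \<Longrightarrow> (\<lambda>x. c *\<^sub>R f x) \<in> Lsq M"
  by (rule Lsq_linear) (auto intro!: linearI simp: algebra_simps)

lemma Lsq_zero: "(\<lambda>x. 0) \<in> Lsq M"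
  by (simp add: Lsq_def)

lemma subspace_Lsq: "subspace (Lsq M)"
  by (auto simp: subspace_def plus_fun_def zero_fun_def scaleR_fun_def Lsq_add Lsq_scaleR Lsq_zero)

lemma Lsq_inner_commute: "Lsq_inner M f g = Lsq_inner M g f"
  by (simp add: Lsq_inner_def inner_commute)

lemma Lsq_inner_add:
  "f \<in> Lsq M \<Longrightarrow> g \<in> Lsq M \<Longrightarrow> h \<in> Lsq M \<Longrightarrow>
    Lsq_inner M (\<lambda>x. f x + g x) h = Lsq_inner M f h + Lsq_inner M g h"
  by (simp add: Lsq_inner_def inner_add_left Lsq_inner_integrable)

lemma Lsq_inner_scaleR: "Lsq_inner M (\<lambda>x. c *\<^sub>R f x) h = c * Lsq_inner M f h"
  by (simp add: Lsq_inner_def)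

text \<open>Weak gradients are chosen representatives, so identities between them hold only almost
  everywhere; this is how they are inserted into inner products.\<close>

lemma Lsq_inner_cong:
  assumes "f \<in> borel_measurable M" "f' \<in> borel_measurable M"
    "g \<in> borel_measurable M" "g' \<in> borel_measurable M"
    and "AE x in M. f x = f' x" "AE x in M. g x = g' x"
  shows "Lsq_inner M f g = Lsq_inner M f' g'"
  unfolding Lsq_inner_def using assms(1-4)
  by (intro integral_cong_AE) (use assms(5,6) in \<open>auto elim!: eventually_elim2\<close>)

lemma Lsq_inner_nonneg: "0 \<le> Lsq_inner M f f"
  by (simp add: Lsq_inner_def)

lemma (in finite_measure) integrable_Lsq:
  assumes "f \<in> Lsq M" shows "integrable M f"
proof (rule Bochner_Integration.integrable_bound)
  show "integrable M (\<lambda>x. 1 + (norm (f x))\<^sup>2)" using LsqD[OF assms] by simp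
  show "AE x in M. norm (f x) \<le> norm (1 + (norm (f x))\<^sup>2)"
  proof (rule AE_I2)
    fix x
    have "norm (f x) \<le> 1 + (norm (f x))\<^sup>2"
      using sum_squares_bound[of 1 "norm (f x)"] norm_ge_zero[of "f x"]
      unfolding power_one mult_1_right by linarith
    then show "norm (f x) \<le> norm (1 + (norm (f x))\<^sup>2)" by simp
  qed
qed (use LsqD[OF assms] in simp)

section \<open>Weak gradients\<close>

text \<open>By translation invariance the integral of every difference quotient of \<open>h\<close>
  is 0. The quotients converge to the directional derivative and, by the mean value theorem, are
  dominated by its bound on a ball, so the limit integral is 0 as well.\<close>

lemma integral_derivative_compact_support:
  fixes h :: "'a::euclidean_space \<Rightarrow> real"
  assumes D: "\<And>x. (h has_derivative h' x) (at x)" and cont: "continuous_on UNIV (\<lambda>x. h' x e)"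
    and K: "compact K" "\<And>x. x \<notin> K \<Longrightarrow> h x = 0"
  shows "(\<integral>x. h' x e \<partial>lborel) = 0"
proof -
  obtain r where r: "K \<subseteq> ball 0 r" "0 < r"
    using bounded_subset_ballD[OF compact_imp_bounded[OF K(1)], of 0] by blast
  have hcont: "continuous_on A h" for A
    using D by (intro differentiable_imp_continuous_on) (auto simp: differentiable_on_def differentiable_def intro: has_derivative_at_withinI)
  have "compact ((\<lambda>x. h' x e) ` cball 0 (r + norm e))"
    by (intro compact_continuous_image continuous_on_subset[OF cont]) auto
  then obtain M where M: "\<And>x. x \<in> cball 0 (r + norm e) \<Longrightarrow> \<bar>h' x e\<bar> \<le> M"
    using compact_imp_bounded[THEN bounded_iff[THEN iffD1]] by (metis imageI real_norm_def)
  have out: "h' x e = 0" if "x \<notin> ball 0 r" for x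
  proof -
    have "((\<lambda>_. 0) has_derivative h' x) (at x)"
      by (rule has_derivative_transform_within_open[OF D, of "- K"])
         (use that r K compact_imp_closed[OF K(1)] in \<open>auto simp: open_Compl\<close>)
    then have "h' x = (\<lambda>_. 0)" by (rule has_derivative_unique) simp
    then show ?thesis by simp
  qed
  have M0: "0 \<le> M" using M[of 0] r by force
  have Mall: "\<bar>h' x e\<bar> \<le> M" for x
  proof (cases "x \<in> ball 0 r")
    case True
    then have "x \<in> cball 0 (r + norm e)" by (simp add: add_increasing2 less_imp_le)
    then show ?thesis by (rule M)
  qed (simp add: out M0)
  define d where "d n x = real (Suc n) * (h (x + (1 / real (Suc n)) *\<^sub>R e) - h x)" for n x
  have ray: "((\<lambda>t. h (x + t *\<^sub>R e)) has_real_derivative h' (x + t *\<^sub>R e) e) (at t)" for x t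
  proof -
    have "((\<lambda>t. h (x + t *\<^sub>R e)) has_derivative (\<lambda>s. h' (x + t *\<^sub>R e) (s *\<^sub>R e))) (at t)"
      by (rule has_derivative_compose[OF _ D]) (auto intro!: derivative_eq_intros)
    then show ?thesis
      using linear_cmul[OF bounded_linear.linear[OF has_derivative_bounded_linear[OF D]]]
      by (simp add: has_field_derivative_def mult_commute_abs)
  qed
  have d_bound: "\<bar>d n x\<bar> \<le> M * indicator (cball 0 (r + norm e)) x" for n x
  proof (cases "x \<in> cball 0 (r + norm e)")
    case True
    obtain z where "h (x + (1 / real (Suc n)) *\<^sub>R e) - h (x + 0 *\<^sub>R e) = (1 / real (Suc n) - 0) * h' (x + z *\<^sub>R e) e"
      using MVT2[of 0 "1 / real (Suc n)" "\<lambda>t. h (x + t *\<^sub>R e)", OF _ ray] by auto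
    then have "d n x = h' (x + z *\<^sub>R e) e" unfolding d_def by simp
    then show ?thesis using Mall True by simp
  next
    case False
    \<comment> \<open>The shift has length at most \<open>norm e\<close>, so outside the ball of
      radius \<open>r + norm e\<close> both \<open>x\<close> and the shifted point miss
      \<open>K\<close> and the quotient is 0.\<close>
    have "norm (x + (1 / real (Suc n)) *\<^sub>R e) \<ge> norm x - norm ((1 / real (Suc n)) *\<^sub>R e)"
      by (rule norm_diff_ineq)
    moreover have "norm ((1 / real (Suc n)) *\<^sub>R e) \<le> norm e"
      by (simp add: divide_le_eq mult_le_cancel_left1 algebra_simps)
    ultimately have "x + (1 / real (Suc n)) *\<^sub>R e \<notin> ball 0 r" "x \<notin> ball 0 r"
      using False norm_ge_zero[of e] unfolding mem_ball mem_cball dist_0_norm by linarith+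
    then have "x + (1 / real (Suc n)) *\<^sub>R e \<notin> K" "x \<notin> K" using r by blast+
    then show ?thesis using M0 by (simp add: d_def K(2))
  qed
  have lim: "(\<lambda>n. d n x) \<longlonglongrightarrow> h' x e" for x
  proof -
    have "((\<lambda>t. (h (x + t *\<^sub>R e) - h (x + 0 *\<^sub>R e)) / (t - 0)) \<longlongrightarrow> h' x e) (at 0)"
      using ray[of x 0] by (simp add: has_field_derivative_iff)
    moreover have "filterlim (\<lambda>n. 1 / real (Suc n)) (at 0) sequentially"
      using LIMSEQ_Suc[OF lim_1_over_n] by (simp add: filterlim_at)
    ultimately have "(\<lambda>n. (h (x + (1 / real (Suc n)) *\<^sub>R e) - h (x + 0 *\<^sub>R e)) / (1 / real (Suc n) - 0)) \<longlonglongrightarrow> h' x e"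
      by (rule filterlim_compose)
    then show ?thesis by (simp add: d_def mult.commute)
  qed
  have hb[measurable]: "h \<in> borel_measurable borel"
    by (rule borel_measurable_continuous_onI[OF hcont])
  have [measurable]: "d n \<in> borel_measurable borel" for n
    unfolding d_def[abs_def] by measurable
  have hint: "integrable lborel h"
  proof -
    have "integrable lborel (\<lambda>x. indicator (cball 0 r) x *\<^sub>R h x)"
      by (rule borel_integrable_compact) (auto intro: hcont)
    moreover have "indicator (cball 0 r) x *\<^sub>R h x = h x" for x
    proof (cases "x \<in> K")
      case True
      then have "x \<in> cball 0 r" using r ball_subset_cball by blast
      then show ?thesis by simp
    qed (simp add: K(2))
    ultimately show ?thesis by (simp only:)
  qed
  have shift: "integrable lborel (\<lambda>x. h (x + c))" "(\<integral>x. h (x + c) \<partial>lborel) = (\<integral>x. h x \<partial>lborel)" for c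
  proof -
    have "integrable (distr lborel borel ((+) c)) h" using hint by (simp add: lborel_distr_plus)
    then show "integrable lborel (\<lambda>x. h (x + c))"
      by (subst (asm) integrable_distr_eq) (auto simp: add.commute)
    have "(\<integral>x. h x \<partial>lborel) = (\<integral>x. h x \<partial>(distr lborel borel ((+) c)))"
      by (simp add: lborel_distr_plus)
    also have "\<dots> = (\<integral>x. h (x + c) \<partial>lborel)"
      by (subst integral_distr) (auto simp: add.commute)
    finally show "(\<integral>x. h (x + c) \<partial>lborel) = (\<integral>x. h x \<partial>lborel)" by simp
  qed
  have "(\<integral>x. d n x \<partial>lborel) = 0" for n
    unfolding d_def using hint shift by simp
  moreover have "(\<lambda>n. \<integral>x. d n x \<partial>lborel) \<longlonglongrightarrow> (\<integral>x. h' x e \<partial>lborel)"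
  proof (rule integral_dominated_convergence)
    show "integrable lborel (\<lambda>x. M * indicator (cball 0 (r + norm e)) x)"
      by (intro integrable_mult_right integrable_real_indicator) (use emeasure_bounded_finite[OF bounded_cball, of 0 "r + norm e"] in \<open>auto simp: less_top\<close>)
    show "(\<lambda>x. h' x e) \<in> borel_measurable lborel"
      using borel_measurable_continuous_onI[OF cont] by simp
  qed (use d_bound lim in auto)
  ultimately show ?thesis by (simp add: LIMSEQ_const_iff)
qed

lemma integral_lebesgue_on_eq_lborel:
  fixes g :: "'a::euclidean_space \<Rightarrow> real"
  assumes "g \<in> borel_measurable borel" "S \<in> sets lebesgue" "\<And>x. x \<notin> S \<Longrightarrow> g x = 0"
  shows "integral\<^sup>L (lebesgue_on S) g = integral\<^sup>L lborel g"
proof -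
  have "indicator S x *\<^sub>R g x = g x" for x
    using assms(3) by (cases "x \<in> S") auto
  then have eq: "(\<lambda>x. indicator S x *\<^sub>R g x) = g" by blast
  have "integral\<^sup>L (lebesgue_on S) g = integral\<^sup>L lebesgue (\<lambda>x. indicator S x *\<^sub>R g x)"
    using assms(2) by (intro integral_restrict_space) simp
  also have "\<dots> = integral\<^sup>L lborel g"
    unfolding eq by (rule integral_completion) (use assms(1) in simp)
  finally show ?thesis .
qed

lemma continuous_imp_Lsq:
  fixes f :: "'a::euclidean_space \<Rightarrow> 'b::euclidean_space"
  assumes S: "bounded S" "S \<in> lmeasurable" and f: "continuous_on UNIV f"
  shows "f \<in> Lsq (lebesgue_on S)"
proof -
  interpret finite_measure "lebesgue_on S" by (rule finite_measure_lebesgue_on[OF S(2)])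
  have "bounded (f ` closure S)"
    using S(1) by (intro compact_imp_bounded compact_continuous_image continuous_on_subset[OF f]) auto
  then obtain K where K: "\<And>x. x \<in> closure S \<Longrightarrow> norm (f x) \<le> K"
    by (auto simp: bounded_iff)
  show ?thesis
  proof (rule Lsq_dominated[where w = "\<lambda>_. K\<^sup>2"])
    show "f \<in> borel_measurable (lebesgue_on S)"
      using borel_measurable_continuous_onI[OF f]
      by (simp add: measurable_completion measurable_restrict_space1)
    fix x assume "x \<in> space (lebesgue_on S)"
    then have "norm (f x) \<le> K" using K closure_subset[of S] by auto
    then show "(norm (f x))\<^sup>2 \<le> K\<^sup>2" by (rule power_mono) simp
  qed simp
qed

lemma Lsq_component: "f \<in> Lsq M \<Longrightarrow> (\<lambda>x. f x $ i) \<in> Lsq M"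
  by (rule Lsq_linear) (auto intro!: linearI)

lemma test_function_derivative_outside:
  assumes "test_function S \<phi>" "x \<notin> closure {x. \<phi> x \<noteq> 0}"
  shows "frechet_derivative \<phi> (at x) b = 0"
proof -
  have "((\<lambda>_. 0) has_derivative frechet_derivative \<phi> (at x)) (at x)"
  proof (rule has_derivative_transform_within_open)
    show "(\<phi> has_derivative frechet_derivative \<phi> (at x)) (at x)"
      using assms(1) by (simp add: test_function_def C_infinity_has_derivative)
    show "open (- closure {x. \<phi> x \<noteq> 0})" by (rule open_Compl[OF closed_closure])
    show "x \<in> - closure {x. \<phi> x \<noteq> 0}" using assms(2) by blast
    fix y assume "y \<in> - closure {x. \<phi> x \<noteq> 0}"
    then show "\<phi> y = 0" using closure_subset[of "{x. \<phi> x \<noteq> 0}"] by blast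
  qed
  then have "frechet_derivative \<phi> (at x) = (\<lambda>_. 0)" by (rule has_derivative_unique) simp
  then show ?thesis by simp
qed

text \<open>\<open>u\<close> need not have compact support, but \<open>u x $ i * \<phi> x\<close>
  does; the derivative of this product integrates to 0, and the product rule splits it. The lemma
  puts the smooth functions that occur in \<open>has_trace\<close> into \<open>H1\<close>.\<close>

lemma smooth_has_weak_gradient:
  fixes u :: "real^'d \<Rightarrow> real^('d::finite)"
  assumes "open S" and u: "C_infinity u"
  shows "has_weak_gradient S u (\<lambda>x. \<chi> i j. frechet_derivative u (at x) (axis j 1) $ i)"
  unfolding has_weak_gradient_def
proof (intro allI impI)
  fix \<phi> :: "real^'d \<Rightarrow> real" and i j :: 'd
  assume \<phi>: "test_function S \<phi>"
  let ?K = "closure {x. \<phi> x \<noteq> 0}" and ?e = "axis j 1 :: real^'d"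
  have K: "compact ?K" "?K \<subseteq> S" and \<phi>s: "C_infinity \<phi>"
    using \<phi> unfolding test_function_def by blast+
  have e: "?e \<in> Basis" by (simp add: axis_in_Basis_iff)
  have c: "continuous_on UNIV (\<lambda>x. u x $ i)" "continuous_on UNIV \<phi>"
    "continuous_on UNIV (\<lambda>x. frechet_derivative u (at x) ?e $ i)"
    "continuous_on UNIV (\<lambda>x. frechet_derivative \<phi> (at x) ?e)"
    by (rule continuous_on_component[OF C_infinity_continuous[OF u]] C_infinity_continuous[OF \<phi>s]
        continuous_on_component[OF C_infinity_continuous_derivative[OF u e]]
        C_infinity_continuous_derivative[OF \<phi>s e])+
  have out: "\<phi> x = 0" "frechet_derivative \<phi> (at x) ?e = 0" if "x \<notin> ?K" for x
  proof -
    show "\<phi> x = 0" using that closure_subset[of "{x. \<phi> x \<noteq> 0}"] by blast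
    show "frechet_derivative \<phi> (at x) ?e = 0" by (rule test_function_derivative_outside[OF \<phi> that])
  qed
  \<comment> \<open>The integrands vanish off the support of \<open>\<phi>\<close>, so integrals
    over \<open>S\<close> are integrals over the whole space, where translation invariance is
    available.\<close>
  have int: "integrable lborel g \<and> integral\<^sup>L (lebesgue_on S) g = integral\<^sup>L lborel g"
    if g: "continuous_on UNIV g" "\<And>x. x \<notin> ?K \<Longrightarrow> g x = 0" for g :: "real^'d \<Rightarrow> real"
  proof
    have "integrable lborel (\<lambda>x. indicator ?K x *\<^sub>R g x)"
      by (rule borel_integrable_compact[OF K(1) continuous_on_subset[OF g(1) subset_UNIV]])
    moreover have "indicator ?K x *\<^sub>R g x = g x" for x
      using g(2)[of x] by (cases "x \<in> ?K") (simp_all only: indicator_simps scaleR_one scaleR_zero_left simp_thms if_True)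
    ultimately show "integrable lborel g" by (simp only:)
    show "integral\<^sup>L (lebesgue_on S) g = integral\<^sup>L lborel g"
    proof (rule integral_lebesgue_on_eq_lborel[OF borel_measurable_continuous_onI[OF g(1)]])
      show "S \<in> sets lebesgue" using \<open>open S\<close> by simp
      show "g x = 0" if "x \<notin> S" for x using g(2) K(2) that by blast
    qed
  qed
  have i1: "integrable lborel (\<lambda>x. u x $ i * frechet_derivative \<phi> (at x) ?e)
      \<and> (\<integral>x. u x $ i * frechet_derivative \<phi> (at x) ?e \<partial>lebesgue_on S)
        = (\<integral>x. u x $ i * frechet_derivative \<phi> (at x) ?e \<partial>lborel)"
    by (rule int, rule continuous_on_mult[OF c(1) c(4)]) (rule mult_eq_0_iff[THEN iffD2, OF disjI2], rule out(2))
  have i2: "integrable lborel (\<lambda>x. frechet_derivative u (at x) ?e $ i * \<phi> x)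
      \<and> (\<integral>x. frechet_derivative u (at x) ?e $ i * \<phi> x \<partial>lebesgue_on S)
        = (\<integral>x. frechet_derivative u (at x) ?e $ i * \<phi> x \<partial>lborel)"
    by (rule int, rule continuous_on_mult[OF c(3) c(2)]) (rule mult_eq_0_iff[THEN iffD2, OF disjI2], rule out(1))
  have "(\<integral>x. (u x $ i * frechet_derivative \<phi> (at x) ?e + frechet_derivative u (at x) ?e $ i * \<phi> x) \<partial>lborel) = 0"
  proof (rule integral_derivative_compact_support[where h = "\<lambda>x. u x $ i * \<phi> x" and e = ?e
        and h' = "\<lambda>x d. u x $ i * frechet_derivative \<phi> (at x) d + frechet_derivative u (at x) d $ i * \<phi> x",
        OF _ _ K(1)])
    fix x
    have "((\<lambda>x. u x $ i) has_derivative (\<lambda>d. frechet_derivative u (at x) d $ i)) (at x)"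
      by (rule bounded_linear.has_derivative[OF bounded_linear_vec_nth C_infinity_has_derivative[OF u]])
    from has_derivative_mult[OF this C_infinity_has_derivative[OF \<phi>s]]
    show "((\<lambda>x. u x $ i * \<phi> x) has_derivative
        (\<lambda>d. u x $ i * frechet_derivative \<phi> (at x) d + frechet_derivative u (at x) d $ i * \<phi> x)) (at x)" .
    show "continuous_on UNIV (\<lambda>x. u x $ i * frechet_derivative \<phi> (at x) ?e + frechet_derivative u (at x) ?e $ i * \<phi> x)"
      by (rule continuous_on_add[OF continuous_on_mult[OF c(1) c(4)] continuous_on_mult[OF c(3) c(2)]])
    show "u x $ i * \<phi> x = 0" if "x \<notin> ?K" using out[OF that] by simp
  qed
  with Bochner_Integration.integral_add[OF i1[THEN conjunct1] i2[THEN conjunct1]]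
    i1[THEN conjunct2] i2[THEN conjunct2]
  have "(\<integral>x. u x $ i * frechet_derivative \<phi> (at x) ?e \<partial>lebesgue_on S)
       = - (\<integral>x. frechet_derivative u (at x) ?e $ i * \<phi> x \<partial>lebesgue_on S)"
    by linarith
  moreover have "(\<chi> i j. frechet_derivative u (at x) (axis j 1) $ i) $ i $ j = frechet_derivative u (at x) ?e $ i" for x
    by simp
  ultimately show "(\<integral>x. u x $ i * frechet_derivative \<phi> (at x) ?e \<partial>lebesgue_on S)
       = - (\<integral>x. (\<chi> i j. frechet_derivative u (at x) (axis j 1) $ i) $ i $ j * \<phi> x \<partial>lebesgue_on S)"
    by (simp only:)
qed

section \<open>The space \<open>H1\<close> over a bounded open set\<close>

context
  fixes \<Omega> :: "(real^('d::finite)) set"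
  assumes open_dom: "open \<Omega>" and bounded_dom: "bounded \<Omega>"
begin

private lemma dom_lmeasurable: "\<Omega> \<in> lmeasurable"
  by (rule lmeasurable_open[OF bounded_dom open_dom])

private lemma finite_measure_dom: "finite_measure (lebesgue_on \<Omega>)"
  by (rule finite_measure_lebesgue_on[OF dom_lmeasurable])

private lemma test_integrable:
  fixes u :: "real^'d \<Rightarrow> real^'d" and G :: "real^'d \<Rightarrow> real^'d^'d"
  assumes "test_function \<Omega> \<phi>"
  shows "u \<in> Lsq (lebesgue_on \<Omega>) \<Longrightarrow>
      integrable (lebesgue_on \<Omega>) (\<lambda>x. u x $ i * frechet_derivative \<phi> (at x) (axis j 1))"
    and "G \<in> Lsq (lebesgue_on \<Omega>) \<Longrightarrow> integrable (lebesgue_on \<Omega>) (\<lambda>x. G x $ i $ j * \<phi> x)"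
proof -
  have s: "C_infinity \<phi>" using assms by (simp only: test_function_def)
  have e: "(axis j 1 :: real^'d) \<in> Basis" by (simp add: axis_in_Basis_iff)
  have L: "(\<lambda>x. frechet_derivative \<phi> (at x) (axis j 1)) \<in> Lsq (lebesgue_on \<Omega>)" "\<phi> \<in> Lsq (lebesgue_on \<Omega>)"
    by (rule continuous_imp_Lsq[OF bounded_dom dom_lmeasurable] C_infinity_continuous_derivative[OF s e]
        C_infinity_continuous[OF s])+
  show "integrable (lebesgue_on \<Omega>) (\<lambda>x. u x $ i * frechet_derivative \<phi> (at x) (axis j 1))"
    if "u \<in> Lsq (lebesgue_on \<Omega>)"
    using Lsq_inner_integrable[OF Lsq_component[OF that] L(1), of i] by (simp only: inner_real_def)
  show "integrable (lebesgue_on \<Omega>) (\<lambda>x. G x $ i $ j * \<phi> x)" if "G \<in> Lsq (lebesgue_on \<Omega>)"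
    using Lsq_inner_integrable[OF Lsq_component[OF Lsq_component[OF that]] L(2), of i j]
    by (simp only: inner_real_def)
qed

lemma has_weak_gradient_add:
  assumes "u \<in> Lsq (lebesgue_on \<Omega>)" "u' \<in> Lsq (lebesgue_on \<Omega>)"
    and "G \<in> Lsq (lebesgue_on \<Omega>)" "G' \<in> Lsq (lebesgue_on \<Omega>)"
    and "has_weak_gradient \<Omega> u G" "has_weak_gradient \<Omega> u' G'"
  shows "has_weak_gradient \<Omega> (\<lambda>x. u x + u' x) (\<lambda>x. G x + G' x)"
  unfolding has_weak_gradient_def
proof (intro allI impI)
  fix \<phi> :: "real^'d \<Rightarrow> real" and i j :: 'd
  assume \<phi>: "test_function \<Omega> \<phi>"
  note int = test_integrable[OF \<phi>]
  have "(\<integral>x. u x $ i * frechet_derivative \<phi> (at x) (axis j 1) \<partial>lebesgue_on \<Omega>)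
       = - (\<integral>x. G x $ i $ j * \<phi> x \<partial>lebesgue_on \<Omega>)"
    "(\<integral>x. u' x $ i * frechet_derivative \<phi> (at x) (axis j 1) \<partial>lebesgue_on \<Omega>)
       = - (\<integral>x. G' x $ i $ j * \<phi> x \<partial>lebesgue_on \<Omega>)"
    using assms(5,6) \<phi> unfolding has_weak_gradient_def by blast+
  then show "(\<integral>x. (u x + u' x) $ i * frechet_derivative \<phi> (at x) (axis j 1) \<partial>lebesgue_on \<Omega>)
       = - (\<integral>x. (G x + G' x) $ i $ j * \<phi> x \<partial>lebesgue_on \<Omega>)"
    by (simp add: distrib_right Bochner_Integration.integral_add int(1)[OF assms(1)]
        int(1)[OF assms(2)] int(2)[OF assms(3)] int(2)[OF assms(4)])
qed

lemma has_weak_gradient_scaleR: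
  assumes "has_weak_gradient \<Omega> u G"
  shows "has_weak_gradient \<Omega> (\<lambda>x. c *\<^sub>R u x) (\<lambda>x. c *\<^sub>R G x)"
  using assms unfolding has_weak_gradient_def by (simp add: mult.assoc)

text \<open>Entrywise, the difference of two weak gradients integrates to 0 against every test
  function. This pins down the choice \<open>weak_gradient\<close> almost everywhere.\<close>

lemma weak_gradient_unique:
  assumes G: "G \<in> Lsq (lebesgue_on \<Omega>)" "has_weak_gradient \<Omega> u G"
    and G': "G' \<in> Lsq (lebesgue_on \<Omega>)" "has_weak_gradient \<Omega> u G'"
  shows "AE x in lebesgue_on \<Omega>. G x = G' x"
proof -
  interpret finite_measure "lebesgue_on \<Omega>" by (rule finite_measure_dom)
  have "AE x in lebesgue_on \<Omega>. G x $ i $ j - G' x $ i $ j = 0" for i j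
  proof (rule fundamental_lemma_of_variations[OF open_dom _ dom_lmeasurable])
    show "negligible (\<Omega> - \<Omega>)" by simp
    show "integrable (lebesgue_on \<Omega>) (\<lambda>x. G x $ i $ j - G' x $ i $ j)"
      by (intro Bochner_Integration.integrable_diff integrable_Lsq Lsq_component G(1) G'(1))
    fix \<phi> :: "real^'d \<Rightarrow> real" assume \<phi>: "test_function \<Omega> \<phi>"
    have "(\<integral>x. G x $ i $ j * \<phi> x \<partial>lebesgue_on \<Omega>) = (\<integral>x. G' x $ i $ j * \<phi> x \<partial>lebesgue_on \<Omega>)"
      using G(2)[unfolded has_weak_gradient_def, rule_format, OF \<phi>, of i j]
        G'(2)[unfolded has_weak_gradient_def, rule_format, OF \<phi>, of i j] by linarith
    then show "(\<integral>x. \<phi> x * (G x $ i $ j - G' x $ i $ j) \<partial>lebesgue_on \<Omega>) = 0"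
      using test_integrable(2)[OF \<phi> G(1), of i j] test_integrable(2)[OF \<phi> G'(1), of i j]
      by (simp add: right_diff_distrib mult.commute[of "\<phi> _"])
  qed
  then have "AE x in lebesgue_on \<Omega>. \<forall>i\<in>UNIV. \<forall>j\<in>UNIV. G x $ i $ j - G' x $ i $ j = 0"
    by (intro AE_finite_allI) auto
  then show ?thesis
    by (rule eventually_mono) (auto simp: vec_eq_iff)
qed

lemma H1_weak_gradient:
  assumes "u \<in> H1 \<Omega>"
  shows "u \<in> Lsq (lebesgue_on \<Omega>)" "weak_gradient \<Omega> u \<in> Lsq (lebesgue_on \<Omega>)"
    "has_weak_gradient \<Omega> u (weak_gradient \<Omega> u)"
proof -
  from assms have "\<exists>G. G \<in> Lsq (lebesgue_on \<Omega>) \<and> has_weak_gradient \<Omega> u G"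
    by (auto simp: H1_def)
  from someI_ex[OF this] show "weak_gradient \<Omega> u \<in> Lsq (lebesgue_on \<Omega>)"
    "has_weak_gradient \<Omega> u (weak_gradient \<Omega> u)" by (auto simp: weak_gradient_def)
qed (use assms in \<open>simp add: H1_def\<close>)

lemma weak_gradient_eqI:
  assumes "u \<in> Lsq (lebesgue_on \<Omega>)" "G \<in> Lsq (lebesgue_on \<Omega>)" "has_weak_gradient \<Omega> u G"
  shows "u \<in> H1 \<Omega>" "AE x in lebesgue_on \<Omega>. weak_gradient \<Omega> u x = G x"
proof -
  show u: "u \<in> H1 \<Omega>" using assms by (auto simp: H1_def)
  show "AE x in lebesgue_on \<Omega>. weak_gradient \<Omega> u x = G x"
    by (rule weak_gradient_unique[OF H1_weak_gradient(2,3)[OF u] assms(2,3)])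
qed

text \<open>The sum of the chosen gradients is one weak gradient of the sum; by uniqueness the
  chosen one agrees with it almost everywhere.\<close>

lemma H1_add:
  assumes u: "u \<in> H1 \<Omega>" and v: "v \<in> H1 \<Omega>"
  shows "(\<lambda>x. u x + v x) \<in> H1 \<Omega>"
    "AE x in lebesgue_on \<Omega>. weak_gradient \<Omega> (\<lambda>x. u x + v x) x = weak_gradient \<Omega> u x + weak_gradient \<Omega> v x"
proof -
  note U = H1_weak_gradient[OF u] and V = H1_weak_gradient[OF v]
  note eqI = weak_gradient_eqI[OF Lsq_add[OF U(1) V(1)] Lsq_add[OF U(2) V(2)]
      has_weak_gradient_add[OF U(1) V(1) U(2) V(2) U(3) V(3)]]
  show "(\<lambda>x. u x + v x) \<in> H1 \<Omega>" by (rule eqI(1))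
  show "AE x in lebesgue_on \<Omega>. weak_gradient \<Omega> (\<lambda>x. u x + v x) x = weak_gradient \<Omega> u x + weak_gradient \<Omega> v x"
    by (rule eqI(2))
qed

lemma H1_scaleR:
  assumes u: "u \<in> H1 \<Omega>"
  shows "(\<lambda>x. c *\<^sub>R u x) \<in> H1 \<Omega>"
    "AE x in lebesgue_on \<Omega>. weak_gradient \<Omega> (\<lambda>x. c *\<^sub>R u x) x = c *\<^sub>R weak_gradient \<Omega> u x"
proof -
  note U = H1_weak_gradient[OF u]
  note eqI = weak_gradient_eqI[OF Lsq_scaleR[OF U(1)] Lsq_scaleR[OF U(2)] has_weak_gradient_scaleR[OF U(3)]]
  show "(\<lambda>x. c *\<^sub>R u x) \<in> H1 \<Omega>" by (rule eqI(1))
  show "AE x in lebesgue_on \<Omega>. weak_gradient \<Omega> (\<lambda>x. c *\<^sub>R u x) x = c *\<^sub>R weak_gradient \<Omega> u x"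
    by (rule eqI(2))
qed

lemma H1_smooth:
  fixes u :: "real^'d \<Rightarrow> real^'d"
  assumes u: "C_infinity u" shows "u \<in> H1 \<Omega>"
proof (rule weak_gradient_eqI(1))
  show "u \<in> Lsq (lebesgue_on \<Omega>)"
    by (rule continuous_imp_Lsq[OF bounded_dom dom_lmeasurable C_infinity_continuous[OF u]])
  show "has_weak_gradient \<Omega> u (\<lambda>x. \<chi> i j. frechet_derivative u (at x) (axis j 1) $ i)"
    by (rule smooth_has_weak_gradient[OF open_dom u])
  have e: "(axis j 1 :: real^'d) \<in> Basis" for j by (simp add: axis_in_Basis_iff)
  show "(\<lambda>x. \<chi> i j. frechet_derivative u (at x) (axis j 1) $ i) \<in> Lsq (lebesgue_on \<Omega>)"
    by (intro continuous_imp_Lsq[OF bounded_dom dom_lmeasurable] continuous_on_vec_lambda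
        continuous_on_component C_infinity_continuous_derivative[OF u e])
qed

lemma H1_norm_sq:
  "(H1_norm \<Omega> u)\<^sup>2 = Lsq_inner (lebesgue_on \<Omega>) u u
     + Lsq_inner (lebesgue_on \<Omega>) (weak_gradient \<Omega> u) (weak_gradient \<Omega> u)"
  unfolding H1_norm_def by (rule real_sqrt_pow2) (intro add_nonneg_nonneg Lsq_inner_nonneg)

lemma Lsq_inner_self_add:
  assumes f: "f \<in> Lsq M" and g: "g \<in> Lsq M"
  shows "Lsq_inner M (\<lambda>x. f x + g x) (\<lambda>x. f x + g x) \<le> 2 * Lsq_inner M f f + 2 * Lsq_inner M g g"
proof -
  have "Lsq_inner M (\<lambda>x. f x + g x) (\<lambda>x. f x + g x) \<le> (\<integral>x. 2 * (f x \<bullet> f x) + 2 * (g x \<bullet> g x) \<partial>M)"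
    unfolding Lsq_inner_def
  proof (rule integral_mono)
    show "(f x + g x) \<bullet> (f x + g x) \<le> 2 * (f x \<bullet> f x) + 2 * (g x \<bullet> g x)" for x
      using norm_add_sq_le[of "f x" "g x"] by (simp only: power2_norm_eq_inner)
  qed (intro Bochner_Integration.integrable_add integrable_mult_right Lsq_inner_integrable Lsq_add f g)+
  also have "\<dots> = 2 * Lsq_inner M f f + 2 * Lsq_inner M g g"
    using Lsq_inner_integrable[OF f f] Lsq_inner_integrable[OF g g] by (simp add: Lsq_inner_def)
  finally show ?thesis .
qed

text \<open>The factor 2 comes from the parallelogram bound |a + b|^2 \<le> 2 |a|^2 + 2 |b|^2. For
  null sequences this is as good as the triangle inequality, and it stays at the level of
  integrals.\<close>

lemma H1_norm_add_sq:
  assumes u: "u \<in> H1 \<Omega>" and v: "v \<in> H1 \<Omega>"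
  shows "(H1_norm \<Omega> (\<lambda>x. u x + v x))\<^sup>2 \<le> 2 * (H1_norm \<Omega> u)\<^sup>2 + 2 * (H1_norm \<Omega> v)\<^sup>2"
proof -
  let ?M = "lebesgue_on \<Omega>" and ?g = "weak_gradient \<Omega>"
  note m = LsqD(1)[OF H1_weak_gradient(2)]
  have "Lsq_inner ?M (?g (\<lambda>x. u x + v x)) (?g (\<lambda>x. u x + v x))
      = Lsq_inner ?M (\<lambda>x. ?g u x + ?g v x) (\<lambda>x. ?g u x + ?g v x)"
    by (intro Lsq_inner_cong H1_add u v m borel_measurable_add)
  then show ?thesis
    using Lsq_inner_self_add[OF H1_weak_gradient(1)[OF u] H1_weak_gradient(1)[OF v]]
      Lsq_inner_self_add[OF H1_weak_gradient(2)[OF u] H1_weak_gradient(2)[OF v]]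
    unfolding H1_norm_sq distrib_left by linarith
qed

lemma H1_norm_scaleR_sq:
  assumes u: "u \<in> H1 \<Omega>"
  shows "(H1_norm \<Omega> (\<lambda>x. c *\<^sub>R u x))\<^sup>2 = c\<^sup>2 * (H1_norm \<Omega> u)\<^sup>2"
proof -
  let ?M = "lebesgue_on \<Omega>" and ?g = "weak_gradient \<Omega>"
  note m = LsqD(1)[OF H1_weak_gradient(2)]
  have "Lsq_inner ?M (?g (\<lambda>x. c *\<^sub>R u x)) (?g (\<lambda>x. c *\<^sub>R u x))
      = Lsq_inner ?M (\<lambda>x. c *\<^sub>R ?g u x) (\<lambda>x. c *\<^sub>R ?g u x)"
    by (intro Lsq_inner_cong H1_scaleR u m borel_measurable_scaleR borel_measurable_const)
  then show ?thesis
    unfolding H1_norm_sq by (simp add: Lsq_inner_def power2_eq_square algebra_simps)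
qed

end

section \<open>Traces and the space \<open>H1_D\<close>\<close>

lemma null_sequence_sq:
  fixes a :: "nat \<Rightarrow> real"
  shows "(\<lambda>k. (a k)\<^sup>2) \<longlonglongrightarrow> 0 \<longleftrightarrow> a \<longlonglongrightarrow> 0"
  using tendsto_power[of a 0 sequentially 2] tendsto_real_sqrt[of "\<lambda>k. (a k)\<^sup>2" 0 sequentially]
  by (auto simp: tendsto_rabs_zero_iff)

text \<open>\<open>hausdorff_measure\<close> is built by \<open>measure_of\<close> on the Borel
  sets, so these are its measurable sets and continuous functions stay measurable on the
  boundary.\<close>

lemma surface_measurable_continuous:
  fixes f :: "real^'d::finite \<Rightarrow> 'b::euclidean_space"
  assumes "continuous_on UNIV f"
  shows "f \<in> borel_measurable (surface_measure \<Omega>)"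
proof -
  have "sets (hausdorff_measure (CARD('d) - 1) :: (real^'d) measure) = sets borel"
    unfolding hausdorff_measure_def using sets.sigma_sets_eq[of "borel :: (real^'d) measure"]
    by (simp add: sets_measure_of_conv)
  then have "f \<in> borel_measurable (hausdorff_measure (CARD('d) - 1))"
    using borel_measurable_continuous_onI[OF assms] measurable_cong_sets by blast
  then show ?thesis unfolding surface_measure_def by (rule measurable_restrict_space1)
qed

text \<open>The sum of the two approximating sequences approximates the sum in \<open>H1\<close>
  and, on the boundary, the sum of the traces; each squared error is at most twice the sum of the
  two given ones.\<close>

lemma has_trace_add:
  fixes \<Omega> :: "(real^'d::finite) set"
  assumes \<Omega>: "open \<Omega>" "bounded \<Omega>" and u: "has_trace \<Omega> u g" and v: "has_trace \<Omega> v h"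
  shows "has_trace \<Omega> (\<lambda>x. u x + v x) (\<lambda>x. g x + h x)"
proof -
  let ?S = "surface_measure \<Omega>"
  from u v have H: "u \<in> H1 \<Omega>" "v \<in> H1 \<Omega>" "g \<in> Lsq ?S" "h \<in> Lsq ?S"
    unfolding has_trace_def by blast+
  from u obtain \<phi> where \<phi>: "\<And>k. C_infinity (\<phi> k)" "(\<lambda>k::nat. H1_norm \<Omega> (\<phi> k - u)) \<longlonglongrightarrow> 0"
    "(\<lambda>k. \<integral>\<^sup>+x. ennreal ((norm (\<phi> k x - g x))\<^sup>2) \<partial>?S) \<longlonglongrightarrow> 0"
    unfolding has_trace_def by blast
  from v obtain \<psi> where \<psi>: "\<And>k. C_infinity (\<psi> k)" "(\<lambda>k::nat. H1_norm \<Omega> (\<psi> k - v)) \<longlonglongrightarrow> 0"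
    "(\<lambda>k. \<integral>\<^sup>+x. ennreal ((norm (\<psi> k x - h x))\<^sup>2) \<partial>?S) \<longlonglongrightarrow> 0"
    unfolding has_trace_def by blast
  have diffH1: "w - u \<in> H1 \<Omega>" if "w \<in> H1 \<Omega>" "u \<in> H1 \<Omega>" for w u :: "real^'d \<Rightarrow> real^'d"
    using H1_add(1)[OF \<Omega> that(1) H1_scaleR(1)[OF \<Omega> that(2), of "-1"]] by (simp add: fun_diff_def)
  let ?\<chi> = "\<lambda>k x. \<phi> k x + \<psi> k x"
  have eq: "?\<chi> k - (\<lambda>x. u x + v x) = (\<lambda>x. (\<phi> k - u) x + (\<psi> k - v) x)" for k
    by (simp add: fun_diff_def algebra_simps)
  have "(\<lambda>k. (H1_norm \<Omega> (?\<chi> k - (\<lambda>x. u x + v x)))\<^sup>2) \<longlonglongrightarrow> 0"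
  proof (rule tendsto_sandwich[OF _ _ tendsto_const])
    show "\<forall>\<^sub>F k in sequentially. (H1_norm \<Omega> (?\<chi> k - (\<lambda>x. u x + v x)))\<^sup>2
        \<le> 2 * (H1_norm \<Omega> (\<phi> k - u))\<^sup>2 + 2 * (H1_norm \<Omega> (\<psi> k - v))\<^sup>2"
      unfolding eq
      by (intro always_eventually allI H1_norm_add_sq[OF \<Omega>] diffH1 H H1_smooth[OF \<Omega>] \<phi> \<psi>)
    have "(\<lambda>k. 2 * (H1_norm \<Omega> (\<phi> k - u))\<^sup>2 + 2 * (H1_norm \<Omega> (\<psi> k - v))\<^sup>2) \<longlonglongrightarrow> 2 * 0 + 2 * 0"
      by (intro tendsto_add tendsto_mult tendsto_const null_sequence_sq[THEN iffD2] \<phi> \<psi>)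
    then show "(\<lambda>k. 2 * (H1_norm \<Omega> (\<phi> k - u))\<^sup>2 + 2 * (H1_norm \<Omega> (\<psi> k - v))\<^sup>2) \<longlonglongrightarrow> 0" by simp
  qed simp
  then have n1: "(\<lambda>k. H1_norm \<Omega> (?\<chi> k - (\<lambda>x. u x + v x))) \<longlonglongrightarrow> 0"
    unfolding null_sequence_sq .
  have [measurable]: "\<phi> k \<in> borel_measurable ?S" "\<psi> k \<in> borel_measurable ?S" for k
    by (intro surface_measurable_continuous C_infinity_continuous \<phi> \<psi>)+
  note [measurable] = LsqD(1)[OF H(3)] LsqD(1)[OF H(4)]
  have n2: "(\<lambda>k. \<integral>\<^sup>+x. ennreal ((norm (?\<chi> k x - (g x + h x)))\<^sup>2) \<partial>?S) \<longlonglongrightarrow> 0"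
  proof (rule tendsto_sandwich[OF _ _ tendsto_const])
    show "\<forall>\<^sub>F k in sequentially. (\<integral>\<^sup>+x. ennreal ((norm (?\<chi> k x - (g x + h x)))\<^sup>2) \<partial>?S)
      \<le> 2 * (\<integral>\<^sup>+x. ennreal ((norm (\<phi> k x - g x))\<^sup>2) \<partial>?S) + 2 * (\<integral>\<^sup>+x. ennreal ((norm (\<psi> k x - h x))\<^sup>2) \<partial>?S)"
    proof (intro always_eventually allI)
      fix k
      have "(\<integral>\<^sup>+x. ennreal ((norm (?\<chi> k x - (g x + h x)))\<^sup>2) \<partial>?S)
        \<le> (\<integral>\<^sup>+x. 2 * ennreal ((norm (\<phi> k x - g x))\<^sup>2) + 2 * ennreal ((norm (\<psi> k x - h x))\<^sup>2) \<partial>?S)"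
      proof (rule nn_integral_mono)
        fix x
        have "(norm (?\<chi> k x - (g x + h x)))\<^sup>2 \<le> 2 * (norm (\<phi> k x - g x))\<^sup>2 + 2 * (norm (\<psi> k x - h x))\<^sup>2"
          using norm_add_sq_le[of "\<phi> k x - g x" "\<psi> k x - h x"] by (simp add: algebra_simps)
        then have "ennreal ((norm (?\<chi> k x - (g x + h x)))\<^sup>2)
            \<le> ennreal (2 * (norm (\<phi> k x - g x))\<^sup>2 + 2 * (norm (\<psi> k x - h x))\<^sup>2)"
          by (rule ennreal_leI)
        also have "\<dots> = 2 * ennreal ((norm (\<phi> k x - g x))\<^sup>2) + 2 * ennreal ((norm (\<psi> k x - h x))\<^sup>2)"
          by (simp add: ennreal_plus ennreal_mult)
        finally show "ennreal ((norm (?\<chi> k x - (g x + h x)))\<^sup>2)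
            \<le> 2 * ennreal ((norm (\<phi> k x - g x))\<^sup>2) + 2 * ennreal ((norm (\<psi> k x - h x))\<^sup>2)" .
      qed
      then show "(\<integral>\<^sup>+x. ennreal ((norm (?\<chi> k x - (g x + h x)))\<^sup>2) \<partial>?S)
      \<le> 2 * (\<integral>\<^sup>+x. ennreal ((norm (\<phi> k x - g x))\<^sup>2) \<partial>?S) + 2 * (\<integral>\<^sup>+x. ennreal ((norm (\<psi> k x - h x))\<^sup>2) \<partial>?S)"
        by (simp add: nn_integral_add nn_integral_cmult)
    qed
    have "(\<lambda>k. 2 * (\<integral>\<^sup>+x. ennreal ((norm (\<phi> k x - g x))\<^sup>2) \<partial>?S) + 2 * (\<integral>\<^sup>+x. ennreal ((norm (\<psi> k x - h x))\<^sup>2) \<partial>?S))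
        \<longlonglongrightarrow> 2 * 0 + 2 * 0"
      by (intro tendsto_add ennreal_tendsto_cmult \<phi> \<psi>) simp_all
    then show "(\<lambda>k. 2 * (\<integral>\<^sup>+x. ennreal ((norm (\<phi> k x - g x))\<^sup>2) \<partial>?S) + 2 * (\<integral>\<^sup>+x. ennreal ((norm (\<psi> k x - h x))\<^sup>2) \<partial>?S))
        \<longlonglongrightarrow> 0" by simp
  qed simp
  show ?thesis
    unfolding has_trace_def
    by (intro conjI exI[of _ ?\<chi>] allI H1_add(1)[OF \<Omega>] Lsq_add H C_infinity_add \<phi>(1) \<psi>(1) n1 n2)
qed

lemma has_trace_scaleR:
  fixes \<Omega> :: "(real^'d::finite) set"
  assumes \<Omega>: "open \<Omega>" "bounded \<Omega>" and u: "has_trace \<Omega> u g"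
  shows "has_trace \<Omega> (\<lambda>x. c *\<^sub>R u x) (\<lambda>x. c *\<^sub>R g x)"
proof -
  let ?S = "surface_measure \<Omega>"
  from u have H: "u \<in> H1 \<Omega>" "g \<in> Lsq ?S" unfolding has_trace_def by blast+
  from u obtain \<phi> where \<phi>: "\<And>k. C_infinity (\<phi> k)" "(\<lambda>k::nat. H1_norm \<Omega> (\<phi> k - u)) \<longlonglongrightarrow> 0"
    "(\<lambda>k. \<integral>\<^sup>+x. ennreal ((norm (\<phi> k x - g x))\<^sup>2) \<partial>?S) \<longlonglongrightarrow> 0"
    unfolding has_trace_def by blast
  have "\<phi> k - u \<in> H1 \<Omega>" for k
    using H1_add(1)[OF \<Omega> H1_smooth[OF \<Omega> \<phi>(1)[of k]] H1_scaleR(1)[OF \<Omega> H(1), of "-1"]]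
    by (simp add: fun_diff_def)
  from H1_norm_scaleR_sq[OF \<Omega> this]
  have sq: "(H1_norm \<Omega> ((\<lambda>x. c *\<^sub>R \<phi> k x) - (\<lambda>x. c *\<^sub>R u x)))\<^sup>2 = c\<^sup>2 * (H1_norm \<Omega> (\<phi> k - u))\<^sup>2" for k
    by (simp add: fun_diff_def algebra_simps)
  have "(\<lambda>k. c\<^sup>2 * (H1_norm \<Omega> (\<phi> k - u))\<^sup>2) \<longlonglongrightarrow> c\<^sup>2 * 0"
    by (intro tendsto_mult tendsto_const null_sequence_sq[THEN iffD2] \<phi>)
  then have n1: "(\<lambda>k. H1_norm \<Omega> ((\<lambda>x. c *\<^sub>R \<phi> k x) - (\<lambda>x. c *\<^sub>R u x))) \<longlonglongrightarrow> 0"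
    by (subst null_sequence_sq[symmetric]) (simp add: sq)
  have [measurable]: "\<phi> k \<in> borel_measurable ?S" for k
    by (intro surface_measurable_continuous C_infinity_continuous \<phi>)
  note [measurable] = LsqD(1)[OF H(2)]
  have "(\<integral>\<^sup>+x. ennreal ((norm (c *\<^sub>R \<phi> k x - c *\<^sub>R g x))\<^sup>2) \<partial>?S)
     = ennreal (c\<^sup>2) * (\<integral>\<^sup>+x. ennreal ((norm (\<phi> k x - g x))\<^sup>2) \<partial>?S)" for k
    by (subst nn_integral_cmult[symmetric])
       (simp_all add: scaleR_diff_right[symmetric] power_mult_distrib ennreal_mult[symmetric])
  moreover have "(\<lambda>k. ennreal (c\<^sup>2) * (\<integral>\<^sup>+x. ennreal ((norm (\<phi> k x - g x))\<^sup>2) \<partial>?S)) \<longlonglongrightarrow> ennreal (c\<^sup>2) * 0"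
    by (intro ennreal_tendsto_cmult \<phi>) simp
  ultimately have n2: "(\<lambda>k. \<integral>\<^sup>+x. ennreal ((norm (c *\<^sub>R \<phi> k x - c *\<^sub>R g x))\<^sup>2) \<partial>?S) \<longlonglongrightarrow> 0" by simp
  show ?thesis
    unfolding has_trace_def
    by (intro conjI exI[of _ "\<lambda>k x. c *\<^sub>R \<phi> k x"] allI H1_scaleR(1)[OF \<Omega>] Lsq_scaleR H C_infinity_scaleR \<phi>(1) n1 n2)
qed

lemma H1_D_subset_H1: "u \<in> H1_D \<Omega> \<Gamma> \<Longrightarrow> u \<in> H1 \<Omega>"
  unfolding H1_D_def has_trace_def by blast

lemma subspace_H1_D:
  fixes \<Omega> :: "(real^'d::finite) set"
  assumes \<Omega>: "open \<Omega>" "bounded \<Omega>"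
  shows "subspace (H1_D \<Omega> \<Gamma>)"
  unfolding subspace_def
proof (intro conjI ballI allI)
  fix u v assume "u \<in> H1_D \<Omega> \<Gamma>" "v \<in> H1_D \<Omega> \<Gamma>"
  then obtain g h where t: "has_trace \<Omega> u g" "has_trace \<Omega> v h"
    and z: "AE x in surface_measure \<Omega>. x \<in> \<Gamma> \<longrightarrow> g x = 0" "AE x in surface_measure \<Omega>. x \<in> \<Gamma> \<longrightarrow> h x = 0"
    unfolding H1_D_def by blast
  from z have "AE x in surface_measure \<Omega>. x \<in> \<Gamma> \<longrightarrow> g x + h x = 0" by eventually_elim simp
  then show "u + v \<in> H1_D \<Omega> \<Gamma>"
    unfolding H1_D_def plus_fun_def using has_trace_add[OF \<Omega> t] by blast
next
  fix c u assume "u \<in> H1_D \<Omega> \<Gamma>"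
  then obtain g where t: "has_trace \<Omega> u g" and z: "AE x in surface_measure \<Omega>. x \<in> \<Gamma> \<longrightarrow> g x = 0"
    unfolding H1_D_def by blast
  from z have "AE x in surface_measure \<Omega>. x \<in> \<Gamma> \<longrightarrow> c *\<^sub>R g x = 0" by eventually_elim simp
  then show "c *\<^sub>R u \<in> H1_D \<Omega> \<Gamma>"
    unfolding H1_D_def scaleR_fun_def using has_trace_scaleR[OF \<Omega> t] by blast
next
  have s: "C_infinity (\<lambda>x::real^'d. 0::real^'d)" by (simp add: C_infinity_def C_k_const)
  \<comment> \<open>The chosen weak gradient of the zero function need not be literally 0. Its norm
    vanishes by homogeneity with the factor 0.\<close>
  have "(H1_norm \<Omega> (\<lambda>x. 0 *\<^sub>R (0::real^'d)))\<^sup>2 = 0\<^sup>2 * (H1_norm \<Omega> (\<lambda>x. 0))\<^sup>2"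
    by (rule H1_norm_scaleR_sq[OF \<Omega> H1_smooth[OF \<Omega> s]])
  then have "H1_norm \<Omega> 0 = 0" unfolding zero_fun_def by simp
  then have "has_trace \<Omega> (\<lambda>x. 0) (\<lambda>x. 0)"
    unfolding has_trace_def using s H1_smooth[OF \<Omega> s] Lsq_zero
    by (intro conjI exI[of _ "\<lambda>k x. 0"]) auto
  then show "0 \<in> H1_D \<Omega> \<Gamma>" unfolding H1_D_def zero_fun_def by fastforce
qed

lemma subspace_H_space:
  "open \<Omega> \<Longrightarrow> bounded \<Omega> \<Longrightarrow> subspace (H_space \<Omega> \<Gamma>)"
  unfolding H_space_def by (intro subspace_Times subspace_H1_D subspace_Lsq)

section \<open>Real functions of time\<close>

text \<open>The kernel is the derivative of \<open>\<sigma> (m * (r - p))\<close>, which climbs from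
  0 to 1 on [p, p + 1/m]. The assumptions place this window inside [0, T], so no mass is lost at the
  ends.\<close>

lemma scaled_kernel_integral:
  fixes \<sigma> \<beta> :: "real \<Rightarrow> real"
  assumes d: "\<And>x. (\<sigma> has_real_derivative \<beta> x) (at x)" and cont: "continuous_on UNIV \<beta>"
    and zero: "\<And>x. x \<le> 0 \<Longrightarrow> \<sigma> x = 0" and one: "\<And>x. 1 \<le> x \<Longrightarrow> \<sigma> x = 1"
    and "0 < m" "0 \<le> p" "p + 1 / m \<le> T"
  shows "(\<integral>r. m * \<beta> (m * (r - p)) \<partial>lebesgue_on {0..T}) = 1"
proof -
  have T: "0 \<le> T" using assms(5-7) by (meson add_nonneg_nonneg divide_nonneg_nonneg less_imp_le order_trans zero_le_one)
  have c: "continuous_on {0..T} (\<lambda>r. m * \<beta> (m * (r - p)))"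
    by (intro continuous_intros continuous_on_compose2[OF cont]) auto
  have "((\<lambda>r. m * \<beta> (m * (r - p))) has_integral \<sigma> (m * (T - p)) - \<sigma> (m * (0 - p))) {0..T}"
  proof (rule fundamental_theorem_of_calculus[OF T])
    fix r :: real
    have "((\<lambda>r. \<sigma> (m * (r - p))) has_real_derivative \<beta> (m * (r - p)) * m) (at r)"
      by (rule DERIV_chain2[OF d]) (auto intro!: derivative_eq_intros)
    then show "((\<lambda>r. \<sigma> (m * (r - p))) has_vector_derivative m * \<beta> (m * (r - p))) (at r within {0..T})"
      by (simp add: has_real_derivative_iff_has_vector_derivative mult.commute has_vector_derivative_at_within)
  qed
  moreover have "\<sigma> (m * (T - p)) = 1"
    by (rule one) (use assms(5,7) in \<open>simp add: field_simps\<close>)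
  moreover have "\<sigma> (m * (0 - p)) = 0"
    by (rule zero) (use assms(5,6) in \<open>simp add: mult_nonneg_nonpos\<close>)
  ultimately have "((\<lambda>r. m * \<beta> (m * (r - p))) has_integral 1) {0..T}" by (simp only: diff_zero)
  then have "integral {0..T} (\<lambda>r. m * \<beta> (m * (r - p))) = 1" by (rule integral_unique)
  moreover have "{0..T} \<in> sets lebesgue" by simp
  ultimately show ?thesis
    using lebesgue_integral_eq_integral[OF continuous_imp_integrable_real[OF c]] by (simp only:)
qed

text \<open>A one-sided approximate identity, living on [p k, p k + 1/m k]. The base point moves
  with \<open>k\<close> because the windows have to stay inside [0, T] even when the limit
  \<open>p0\<close> is an endpoint.\<close>

lemma scaled_kernel_tendsto:
  fixes \<sigma> \<beta> g :: "real \<Rightarrow> real"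
  assumes d: "\<And>x. (\<sigma> has_real_derivative \<beta> x) (at x)" and cont: "continuous_on UNIV \<beta>"
    and zero: "\<And>x. x \<le> 0 \<Longrightarrow> \<sigma> x = 0" and one: "\<And>x. 1 \<le> x \<Longrightarrow> \<sigma> x = 1"
    and nonneg: "\<And>x. 0 \<le> \<beta> x" and out: "\<And>x. x \<notin> {0..1} \<Longrightarrow> \<beta> x = 0"
    and m: "\<And>k::nat. 0 < m k" "(\<lambda>k. 1 / m k) \<longlonglongrightarrow> 0"
    and p: "\<And>k. 0 \<le> p k" "\<And>k. p k + 1 / m k \<le> T" "p \<longlonglongrightarrow> p0" and p0: "p0 \<in> {0..T}"
    and g: "continuous_on {0..T} g"
  shows "(\<lambda>k. \<integral>r. m k * \<beta> (m k * (r - p k)) * g r \<partial>lebesgue_on {0..T}) \<longlonglongrightarrow> g p0"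
proof (rule LIMSEQ_I)
  fix e :: real assume e: "0 < e"
  from g p0 e obtain \<delta> where \<delta>: "0 < \<delta>" "\<And>r. r \<in> {0..T} \<Longrightarrow> dist r p0 < \<delta> \<Longrightarrow> dist (g r) (g p0) < e / 2"
    unfolding continuous_on_iff by (meson half_gt_zero)
  have "\<forall>\<^sub>F k in sequentially. dist (p k) p0 < \<delta> / 2" "\<forall>\<^sub>F k in sequentially. dist (1 / m k) 0 < \<delta> / 2"
    by (rule tendstoD[OF p(3)] tendstoD[OF m(2)], use \<delta> in simp)+
  then have "\<forall>\<^sub>F k in sequentially. dist (p k) p0 < \<delta> / 2 \<and> 1 / m k < \<delta> / 2"
  proof eventually_elim
    case (elim k)
    then show ?case using abs_ge_self[of "1 / m k - 0"] unfolding dist_real_def by linarith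
  qed
  then obtain N where N: "\<And>k. N \<le> k \<Longrightarrow> dist (p k) p0 < \<delta> / 2 \<and> 1 / m k < \<delta> / 2"
    unfolding eventually_sequentially by blast
  have "norm ((\<integral>r. m k * \<beta> (m k * (r - p k)) * g r \<partial>lebesgue_on {0..T}) - g p0) < e" if k: "N \<le> k" for k
  proof -
    let ?M = "lebesgue_on {0..T}"
    define K where "K r = m k * \<beta> (m k * (r - p k))" for r
    have c: "continuous_on {0..T} K"
      unfolding K_def by (intro continuous_intros continuous_on_compose2[OF cont]) auto
    have K1: "(\<integral>r. K r \<partial>?M) = 1"
      unfolding K_def by (rule scaled_kernel_integral[OF d cont zero one m(1) p(1,2)])
    have i1: "integrable ?M K" "integrable ?M (\<lambda>r. K r * g r)" "integrable ?M (\<lambda>r. K r * (g r - g p0))"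
      "integrable ?M (\<lambda>r. K r * (e / 2))"
      by (rule continuous_imp_integrable_real, intro c g continuous_on_mult continuous_on_diff continuous_on_const)+
    have "(\<integral>r. K r * (g r - g p0) \<partial>?M) = (\<integral>r. K r * g r - K r * g p0 \<partial>?M)"
      by (simp only: right_diff_distrib)
    also have "\<dots> = (\<integral>r. K r * g r \<partial>?M) - (\<integral>r. K r * g p0 \<partial>?M)"
      using i1(1,2) by (intro Bochner_Integration.integral_diff) auto
    also have "(\<integral>r. K r * g p0 \<partial>?M) = g p0" using K1 by simp
    finally have eq: "(\<integral>r. K r * g r \<partial>?M) - g p0 = (\<integral>r. K r * (g r - g p0) \<partial>?M)" by simp
    have "norm (\<integral>r. K r * (g r - g p0) \<partial>?M) \<le> (\<integral>r. norm (K r * (g r - g p0)) \<partial>?M)"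
      by (rule integral_norm_bound)
    also have "\<dots> \<le> (\<integral>r. K r * (e / 2) \<partial>?M)"
    proof (rule integral_mono[OF integrable_norm[OF i1(3)] i1(4)])
      fix r assume "r \<in> space ?M"
      then have r: "r \<in> {0..T}" by simp
      have K0: "0 \<le> K r" using m(1)[of k] nonneg by (simp add: K_def)
      show "norm (K r * (g r - g p0)) \<le> K r * (e / 2)"
      proof (cases "K r = 0")
        case False
        then have "m k * (r - p k) \<in> {0..1}" using out unfolding K_def by fastforce
        then have "0 \<le> r - p k" "r - p k \<le> 1 / m k"
          using m(1)[of k] by (auto simp: zero_le_mult_iff field_simps)
        then have "dist r p0 < \<delta>" using N[OF k] unfolding dist_real_def by linarith
        then have "\<bar>g r - g p0\<bar> \<le> e / 2" using \<delta>(2)[OF r] by (simp add: dist_real_def)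
        from mult_left_mono[OF this K0] have "K r * \<bar>g r - g p0\<bar> \<le> K r * (e / 2)" .
        moreover have "norm (K r * (g r - g p0)) = K r * \<bar>g r - g p0\<bar>" using K0 by (simp add: abs_mult)
        ultimately show ?thesis by (simp only:)
      qed simp
    qed
    also have "\<dots> = e / 2" using K1 by simp
    finally have "norm ((\<integral>r. K r * g r \<partial>?M) - g p0) \<le> e / 2" unfolding eq .
    then show ?thesis unfolding K_def using e by linarith
  qed
  then show "\<exists>N. \<forall>k\<ge>N. norm ((\<integral>r. m k * \<beta> (m k * (r - p k)) * g r \<partial>lebesgue_on {0..T}) - g p0) < e"
    by blast
qed

section \<open>The fundamental theorem of calculus for weak derivatives\<close>

lemma integrable_lebesgue_on_Ioc:
  fixes h :: "real \<Rightarrow> real"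
  assumes "integrable (lebesgue_on {0..T}) h" "0 \<le> s" "t \<le> T"
  shows "integrable (lebesgue_on {0..T}) (\<lambda>r. indicator {s<..t} r * h r)"
proof -
  have "{s<..t} \<subseteq> {0..T}" using assms(2,3) by auto
  then have "{s<..t} \<in> sets (lebesgue_on {0..T})" by (simp add: sets_restrict_space_iff)
  from integrable_mult_indicator[OF this assms(1)] show ?thesis by simp
qed

text \<open>The weak formulation is tested with smooth plateaus approximating the indicator of the
  interval. Against \<open>h\<close> they converge to the integral, while their derivatives are two
  approximate identities that pick out \<open>g\<close> at \<open>s\<close> and at
  \<open>t\<close>.\<close>

lemma weak_derivative_FTC:
  fixes g h :: "real \<Rightarrow> real"
  assumes g: "continuous_on {0..T} g" and h: "integrable (lebesgue_on {0..T}) h"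
    and weak: "\<And>\<phi>. test_function {0<..<T} \<phi> \<Longrightarrow>
      (\<integral>r. deriv \<phi> r * g r \<partial>lebesgue_on {0..T}) = - (\<integral>r. \<phi> r * h r \<partial>lebesgue_on {0..T})"
    and st: "0 \<le> s" "s \<le> t" "t \<le> T"
  shows "g t - g s = (\<integral>r. indicator {s<..t} r * h r \<partial>lebesgue_on {0..T})"
proof (cases "s = t")
  case False
  then have st': "s < t" using st by simp
  let ?M = "lebesgue_on {0..T}"
  obtain \<sigma> \<beta> :: "real \<Rightarrow> real"
  where \<sigma>: "C_infinity \<sigma>" and d: "\<And>x. (\<sigma> has_real_derivative \<beta> x) (at x)"
    and nonneg: "\<And>x. 0 \<le> \<beta> x" and cont: "continuous_on UNIV \<beta>"
    and out: "\<And>x. x \<notin> {0..1} \<Longrightarrow> \<beta> x = 0"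
    and zero: "\<And>x. x \<le> 0 \<Longrightarrow> \<sigma> x = 0" and one: "\<And>x. 1 \<le> x \<Longrightarrow> \<sigma> x = 1"
    and bounds: "\<And>x. 0 \<le> \<sigma> x" "\<And>x. \<sigma> x \<le> 1"
  proof (rule smooth_step)
    fix \<sigma> \<beta> :: "real \<Rightarrow> real"
    assume a: "C_infinity \<sigma>" "\<And>x. (\<sigma> has_real_derivative \<beta> x) (at x)" "\<And>x. 0 \<le> \<beta> x"
      "continuous_on UNIV \<beta>" "\<And>x. x \<notin> {0..1} \<Longrightarrow> \<beta> x = 0" "\<And>x. x \<le> 0 \<Longrightarrow> \<sigma> x = 0"
      "\<And>x. 1 \<le> x \<Longrightarrow> \<sigma> x = 1" "\<And>x. 0 \<le> \<sigma> x" "\<And>x. \<sigma> x \<le> 1"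
    show thesis by (rule that[OF a])
  qed
  \<comment> \<open>The factor 4 separates the transition windows: since 4/m \<le> t - s, the rise
    on [s + 1/m, s + 2/m] is over when the fall on [t - 2/m, t - 1/m] starts.\<close>
  define m where "m k = real (Suc k) * (4 / (t - s))" for k :: nat
  have m0: "0 < m k" for k using st' by (simp add: m_def)
  have m4: "4 \<le> m k * (t - s)" for k using st' by (simp add: m_def)
  have inv: "1 / m k = (t - s) / 4 * inverse (real (Suc k))" for k
    using st' by (simp add: m_def field_simps)
  have lim: "(\<lambda>k. 1 / m k) \<longlonglongrightarrow> 0"
    unfolding inv using tendsto_mult[OF tendsto_const LIMSEQ_inverse_real_of_nat, of "(t - s) / 4"] by simp
  have m_le: "4 * (1 / m k) \<le> t - s" for k
    using m4[of k] m0[of k] by (simp add: field_simps)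
  have minf: "filterlim (\<lambda>k. m k * a) at_top sequentially" if "0 < a" for a
  proof -
    have "filterlim (\<lambda>k. (4 / (t - s) * a) * real (Suc k)) at_top sequentially"
      by (rule filterlim_tendsto_pos_mult_at_top[OF tendsto_const _
            filterlim_compose[OF filterlim_real_sequentially filterlim_Suc]])
         (use st' that in simp)
    then show ?thesis by (simp add: m_def mult_ac)
  qed
  \<comment> \<open>Both windows keep the distance 1/m from \<open>s\<close> and \<open>t\<close>,
    so the support is compact in the open interval even for s = 0 and t = T.\<close>
  define \<phi> where "\<phi> k r = \<sigma> (m k * (r - (s + 1 / m k))) - \<sigma> (m k * (r - (t - 2 * (1 / m k))))" for k r
  have smooth_shift: "C_infinity (\<lambda>r. \<sigma> (m k * (r - a)))" for k a
  proof -
    have "C_k j (\<lambda>r. \<sigma> (m k *\<^sub>R r + (- m k * a)))" for j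
      by (rule C_k_affine) (use \<sigma> in \<open>simp add: C_infinity_def\<close>)
    then show ?thesis by (simp add: C_infinity_def algebra_simps)
  qed
  have smooth: "C_infinity (\<phi> k)" for k
    using C_infinity_add[OF smooth_shift C_infinity_scaleR[OF smooth_shift], of k "s + 1 / m k" "-1" k "t - 2 * (1 / m k)"]
    by (simp add: \<phi>_def[abs_def])
  have dshift: "((\<lambda>r. \<sigma> (m k * (r - a))) has_real_derivative m k * \<beta> (m k * (r - a))) (at r)" for k a r
    by (rule DERIV_chain2[OF d, THEN DERIV_cong]) (auto intro!: derivative_eq_intros)
  have derivphi: "deriv (\<phi> k) r = m k * \<beta> (m k * (r - (s + 1 / m k))) - m k * \<beta> (m k * (r - (t - 2 * (1 / m k))))" for k r
    unfolding \<phi>_def[abs_def] by (rule DERIV_imp_deriv) (rule DERIV_diff[OF dshift dshift])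
  have left: "\<phi> k r = 0" if "r \<le> s + 1 / m k" for k r
  proof -
    have "r - (s + 1 / m k) \<le> 0" "r - (t - 2 * (1 / m k)) \<le> 0"
      using that m_le[of k] divide_pos_pos[OF zero_less_one m0[of k]] by linarith+
    from this[THEN mult_nonneg_nonpos[OF less_imp_le[OF m0[of k]]], THEN zero]
    show ?thesis unfolding \<phi>_def by linarith
  qed
  have right: "\<phi> k r = 0" if "t - 1 / m k \<le> r" for k r
  proof -
    have a: "1 \<le> m k * (r - p)" if "1 / m k \<le> r - p" for p
      using that m0[of k] by (simp add: field_simps)
    have "1 / m k \<le> r - (s + 1 / m k)" "1 / m k \<le> r - (t - 2 * (1 / m k))"
      using that m_le[of k] divide_pos_pos[OF zero_less_one m0[of k]] by linarith+
    from this[THEN a, THEN one] show ?thesis unfolding \<phi>_def by linarith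
  qed
  have test: "test_function {0<..<T} (\<phi> k)" for k
  proof -
    have i0: "0 < 1 / m k" using m0 by simp
    have "{r. \<phi> k r \<noteq> 0} \<subseteq> {s + 1 / m k..t - 1 / m k}"
    proof
      fix r assume "r \<in> {r. \<phi> k r \<noteq> 0}"
      then have "\<not> r \<le> s + 1 / m k" "\<not> t - 1 / m k \<le> r" using left right by blast+
      then show "r \<in> {s + 1 / m k..t - 1 / m k}" unfolding atLeastAtMost_iff by linarith
    qed
    then have sub: "closure {r. \<phi> k r \<noteq> 0} \<subseteq> {s + 1 / m k..t - 1 / m k}"
      by (rule closure_minimal) simp
    have "compact (closure {r. \<phi> k r \<noteq> 0})"
      unfolding compact_eq_bounded_closed
      using bounded_subset[OF bounded_closed_interval sub] closed_closure by blast
    moreover have "{s + 1 / m k..t - 1 / m k} \<subseteq> {0<..<T}"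
    proof
      fix r assume "r \<in> {s + 1 / m k..t - 1 / m k}"
      then show "r \<in> {0<..<T}"
        using st i0 unfolding atLeastAtMost_iff greaterThanLessThan_iff by linarith
    qed
    ultimately show ?thesis
      unfolding test_function_def using smooth sub by blast
  qed
  have bd: "\<bar>\<phi> k r\<bar> \<le> 1" for k r
    using bounds[of "m k * (r - (s + 1 / m k))"] bounds[of "m k * (r - (t - 2 * (1 / m k)))"]
    unfolding \<phi>_def by linarith
  have lim\<phi>: "(\<lambda>k. \<phi> k r) \<longlonglongrightarrow> indicator {s<..<t} r" for r
  proof (cases "r \<in> {s<..<t}")
    case False
    then have "r \<le> s \<or> t \<le> r" unfolding greaterThanLessThan_iff by linarith
    then have "r \<le> s + 1 / m k \<or> t - 1 / m k \<le> r" for k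
      using divide_pos_pos[OF zero_less_one m0[of k]] by linarith
    then have "\<phi> k r = 0" for k using left right by blast
    moreover have "indicat_real {s<..<t} r = 0" by (rule indicator_simps(2)) (rule False)
    ultimately show ?thesis by (simp only: tendsto_const)
  next
    case True
    have "\<forall>\<^sub>F k in sequentially. 2 \<le> m k * (r - s)" "\<forall>\<^sub>F k in sequentially. 2 \<le> m k * (t - r)"
      using minf[of "r - s", unfolded filterlim_at_top] minf[of "t - r", unfolded filterlim_at_top] True
      by simp_all
    then have "\<forall>\<^sub>F k in sequentially. \<phi> k r = 1"
    proof eventually_elim
      case (elim k)
      have "m k * (r - (s + 1 / m k)) = m k * (r - s) - 1" "m k * (r - (t - 2 * (1 / m k))) = 2 - m k * (t - r)"
        using m0[of k] by (simp_all add: field_simps)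
      with elim one[of "m k * (r - s) - 1"] zero[of "2 - m k * (t - r)"]
      show ?case unfolding \<phi>_def by simp
    qed
    then show ?thesis using True by (simp add: tendsto_eventually)
  qed
  have "(\<lambda>k. \<integral>r. \<phi> k r * h r \<partial>?M) \<longlonglongrightarrow> (\<integral>r. indicator {s<..<t} r * h r \<partial>?M)"
  proof (rule integral_dominated_convergence)
    show "integrable ?M (\<lambda>r. norm (h r))" using h by simp
    have hm: "h \<in> borel_measurable ?M" using h by simp
    have "\<phi> k \<in> borel_measurable ?M" for k
      using borel_measurable_continuous_onI[OF C_infinity_continuous[OF smooth[of k]]]
      by (simp add: measurable_completion measurable_restrict_space1)
    then show "(\<lambda>r. \<phi> k r * h r) \<in> borel_measurable ?M" for k using hm by (intro borel_measurable_times)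
    have "indicat_real {s<..<t} \<in> borel_measurable ?M"
      by (intro borel_measurable_indicator measurable_restrict_space1) (simp add: measurable_completion measurable_restrict_space1)
    then show "(\<lambda>r. indicator {s<..<t} r * h r) \<in> borel_measurable ?M" using hm by (intro borel_measurable_times)
    show "AE r in ?M. (\<lambda>k. \<phi> k r * h r) \<longlonglongrightarrow> indicator {s<..<t} r * h r"
      by (intro AE_I2 tendsto_mult lim\<phi> tendsto_const)
    show "AE r in ?M. norm (\<phi> k r * h r) \<le> norm (h r)" for k
      using bd[of k] by (intro AE_I2) (simp add: abs_mult mult_left_le_one_le)
  qed
  \<comment> \<open>The endpoint is a null set. The statement uses half-open intervals because these
    concatenate without overlap.\<close>
  moreover have "(\<integral>r. indicator {s<..<t} r * h r \<partial>?M) = (\<integral>r. indicator {s<..t} r * h r \<partial>?M)"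
  proof (rule integral_cong_AE)
    have "AE r in ?M. r \<notin> {t}" by (rule AE_lebesgue_on_not_in) auto
    then show "AE r in ?M. indicator {s<..<t} r * h r = indicator {s<..t} r * h r"
      by (rule eventually_mono) (auto simp: indicator_def)
    show "(\<lambda>r. indicator {s<..t} r * h r) \<in> borel_measurable ?M"
      using integrable_lebesgue_on_Ioc[OF h st(1,3)] by simp
    have "{s<..<t} \<subseteq> {0..T}" using st by auto
    then have "{s<..<t} \<in> sets ?M" by (simp add: sets_restrict_space_iff)
    then show "(\<lambda>r. indicator {s<..<t} r * h r) \<in> borel_measurable ?M"
      using h by (intro borel_measurable_times borel_measurable_indicator) simp_all
  qed
  ultimately have L1: "(\<lambda>k. \<integral>r. \<phi> k r * h r \<partial>?M) \<longlonglongrightarrow> (\<integral>r. indicator {s<..t} r * h r \<partial>?M)" by simp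
  have i0: "0 < 1 / m k" for k using m0 by simp
  have p1: "(\<lambda>k. s + 1 / m k) \<longlonglongrightarrow> s" using tendsto_add[OF tendsto_const lim, of s] by simp
  have p2: "(\<lambda>k. t - 2 * (1 / m k)) \<longlonglongrightarrow> t"
    using tendsto_diff[OF tendsto_const tendsto_mult[OF tendsto_const lim], of t 2] by simp
  have q1: "s + 1 / m k + 1 / m k \<le> T" "0 \<le> s + 1 / m k"
      "t - 2 * (1 / m k) + 1 / m k \<le> T" "0 \<le> t - 2 * (1 / m k)" for k
    using m_le[of k] i0[of k] st by linarith+
  let ?k1 = "\<lambda>k r. m k * \<beta> (m k * (r - (s + 1 / m k))) * g r"
    and ?k2 = "\<lambda>k r. m k * \<beta> (m k * (r - (t - 2 * (1 / m k)))) * g r"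
  have K1: "(\<lambda>k. \<integral>r. ?k1 k r \<partial>?M) \<longlonglongrightarrow> g s"
    by (rule scaled_kernel_tendsto[OF d cont zero one nonneg out m0 lim _ _ p1 _ g]) (use q1 st in auto)
  have K2: "(\<lambda>k. \<integral>r. ?k2 k r \<partial>?M) \<longlonglongrightarrow> g t"
    by (rule scaled_kernel_tendsto[OF d cont zero one nonneg out m0 lim _ _ p2 _ g]) (use q1 st in auto)
  have split: "(\<integral>r. deriv (\<phi> k) r * g r \<partial>?M) = (\<integral>r. ?k1 k r \<partial>?M) - (\<integral>r. ?k2 k r \<partial>?M)" for k
  proof -
    have c: "continuous_on {0..T} (?k1 k)" "continuous_on {0..T} (?k2 k)"
      by (intro continuous_intros g continuous_on_compose2[OF cont]; simp)+
    show ?thesis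
      unfolding derivphi left_diff_distrib
      by (rule Bochner_Integration.integral_diff[OF c[THEN continuous_imp_integrable_real]])
  qed
  \<comment> \<open>The weak formulation carries a minus sign, so the falling edge near
    \<open>t\<close> contributes positively and the rising edge near \<open>s\<close>
    negatively.\<close>
  have "(\<integral>r. \<phi> k r * h r \<partial>?M) = (\<integral>r. ?k2 k r \<partial>?M) - (\<integral>r. ?k1 k r \<partial>?M)" for k
    using split[of k] weak[OF test[of k]] by linarith
  with tendsto_diff[OF K2 K1] have "(\<lambda>k. \<integral>r. \<phi> k r * h r \<partial>?M) \<longlonglongrightarrow> g t - g s" by (simp only:)
  from LIMSEQ_unique[OF this L1] show ?thesis .
qed simp

text \<open>Cut the range of \<open>W\<close>, of length d, into N + 1 equal pieces: each
  contributes at most C (d/(N + 1))^2, and the sum C d^2/(N + 1) tends to 0. The cut is made by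
  values of \<open>W\<close>, with points supplied by the intermediate value theorem, since
  \<open>W\<close> need not grow at a controlled rate in time.\<close>

lemma constant_of_quadratic_modulus:
  fixes D W :: "real \<Rightarrow> real"
  assumes ab: "a \<le> b" and W: "continuous_on {a..b} W" "W a \<le> W b"
    and D: "\<And>s t. s \<in> {a..b} \<Longrightarrow> t \<in> {a..b} \<Longrightarrow> \<bar>D t - D s\<bar> \<le> C * (W t - W s)\<^sup>2"
  shows "D b = D a"
proof -
  let ?d = "W b - W a"
  have bound: "\<bar>D b - D a\<bar> \<le> (C * ?d\<^sup>2) * inverse (real (Suc N))" for N
  proof -
    let ?n = "real (Suc N)"
    have "\<exists>x\<in>{a..b}. W x = W a + real i / ?n * ?d" if "i \<le> Suc N" for i
    proof -
      have "0 \<le> real i / ?n * ?d" "real i / ?n * ?d \<le> 1 * ?d"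
        using that W(2) by (intro mult_right_mono mult_nonneg_nonneg; simp)+
      then show ?thesis
        using IVT'[of W a "W a + real i / ?n * ?d" b] ab W(1) by auto
    qed
    then obtain x where x: "\<And>i. i \<le> Suc N \<Longrightarrow> x i \<in> {a..b} \<and> W (x i) = W a + real i / ?n * ?d"
      by metis
    \<comment> \<open>\<open>W\<close> may be constant on subintervals, so the outermost partition
      points need not be \<open>a\<close> and \<open>b\<close> but only share their \<open>W\<close>
      values; the modulus shows that \<open>D\<close> does not see the difference.\<close>
    have same: "D t = D s" if "s \<in> {a..b}" "t \<in> {a..b}" "W s = W t" for s t
      using D[OF that(1,2)] that(3) by simp
    have ends: "D (x 0) = D a" "D (x (Suc N)) = D b"
      using x[of 0] x[of "Suc N"] ab by (auto intro!: same)
    have "\<bar>D b - D a\<bar> = \<bar>\<Sum>i<Suc N. D (x (Suc i)) - D (x i)\<bar>"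
      using sum_lessThan_telescope[of "\<lambda>i. D (x i)" "Suc N"] by (simp only: ends)
    also have "\<dots> \<le> (\<Sum>i<Suc N. \<bar>D (x (Suc i)) - D (x i)\<bar>)" by (rule sum_abs)
    also have "\<dots> \<le> (\<Sum>i<Suc N. C * (?d / ?n)\<^sup>2)"
    proof (rule sum_mono)
      fix i assume i: "i \<in> {..<Suc N}"
      have "W (x (Suc i)) - W (x i) = ?d / ?n"
        using x[of i] x[of "Suc i"] i by (simp add: field_simps)
      then show "\<bar>D (x (Suc i)) - D (x i)\<bar> \<le> C * (?d / ?n)\<^sup>2"
        using D[of "x i" "x (Suc i)"] x[of i] x[of "Suc i"] i by simp
    qed
    also have "\<dots> = (C * ?d\<^sup>2) * inverse ?n"
      by (simp add: power2_eq_square divide_inverse)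
    finally show ?thesis .
  qed
  have "(\<lambda>N. (C * ?d\<^sup>2) * inverse (real (Suc N))) \<longlonglongrightarrow> (C * ?d\<^sup>2) * 0"
    by (intro tendsto_mult tendsto_const LIMSEQ_inverse_real_of_nat)
  then have "\<bar>D b - D a\<bar> \<le> 0"
    using LIMSEQ_le_const[of "\<lambda>N. (C * ?d\<^sup>2) * inverse (real (Suc N))" 0 "\<bar>D b - D a\<bar>"] bound by auto
  then show ?thesis by simp
qed

section \<open>Semi-inner product spaces\<close>

text \<open>The laws are demanded only on \<open>V\<close>: outside the carrier an expression such
  as \<open>H_inner\<close> depends on arbitrary choices of gradients and need not be bilinear.
  Definiteness is absent because functions that agree almost everywhere are distinct
  elements.\<close>

locale semi_inner_space =
  fixes V :: "'h::real_vector set" and ip :: "'h \<Rightarrow> 'h \<Rightarrow> real"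
  assumes subspace_V: "subspace V"
    and ip_commute: "x \<in> V \<Longrightarrow> y \<in> V \<Longrightarrow> ip x y = ip y x"
    and ip_add_left: "x \<in> V \<Longrightarrow> y \<in> V \<Longrightarrow> z \<in> V \<Longrightarrow> ip (x + y) z = ip x z + ip y z"
    and ip_scaleR_left: "x \<in> V \<Longrightarrow> z \<in> V \<Longrightarrow> ip (c *\<^sub>R x) z = c * ip x z"
    and ip_nonneg: "x \<in> V \<Longrightarrow> 0 \<le> ip x x"
begin

abbreviation sn :: "'h \<Rightarrow> real" where "sn \<equiv> seminorm ip"

lemma V_zero: "0 \<in> V" and V_add: "x \<in> V \<Longrightarrow> y \<in> V \<Longrightarrow> x + y \<in> V"
  and V_scaleR: "x \<in> V \<Longrightarrow> c *\<^sub>R x \<in> V" and V_diff: "x \<in> V \<Longrightarrow> y \<in> V \<Longrightarrow> x - y \<in> V"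
  and V_minus: "x \<in> V \<Longrightarrow> - x \<in> V"
  using subspace_V by (simp_all add: subspace_0 subspace_add subspace_scale subspace_diff subspace_neg)

lemma ip_add_right: "x \<in> V \<Longrightarrow> y \<in> V \<Longrightarrow> z \<in> V \<Longrightarrow> ip z (x + y) = ip z x + ip z y"
  using ip_add_left[of x y z] by (simp only: ip_commute[of z] V_add)

lemma ip_scaleR_right: "x \<in> V \<Longrightarrow> z \<in> V \<Longrightarrow> ip z (c *\<^sub>R x) = c * ip z x"
  using ip_scaleR_left[of x z c] by (simp only: ip_commute[of z] V_scaleR)

lemma ip_minus_left: "x \<in> V \<Longrightarrow> z \<in> V \<Longrightarrow> ip (- x) z = - ip x z"
  using ip_scaleR_left[of x z "-1"] by simp

lemma ip_minus_right: "x \<in> V \<Longrightarrow> z \<in> V \<Longrightarrow> ip z (- x) = - ip z x"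
  using ip_scaleR_right[of x z "-1"] by simp

lemma ip_diff_left: "x \<in> V \<Longrightarrow> y \<in> V \<Longrightarrow> z \<in> V \<Longrightarrow> ip (x - y) z = ip x z - ip y z"
  using ip_add_left[of x "- y" z] by (simp add: V_minus ip_minus_left)

lemma ip_diff_right: "x \<in> V \<Longrightarrow> y \<in> V \<Longrightarrow> z \<in> V \<Longrightarrow> ip z (x - y) = ip z x - ip z y"
  using ip_add_right[of x "- y" z] by (simp add: V_minus ip_minus_right)

lemma ip_zero_left: "z \<in> V \<Longrightarrow> ip 0 z = 0"
  using ip_scaleR_left[of 0 z 0] V_zero by simp

lemma ip_sum_left:
  "finite I \<Longrightarrow> (\<And>i. i \<in> I \<Longrightarrow> x i \<in> V) \<Longrightarrow> z \<in> V \<Longrightarrow> ip (\<Sum>i\<in>I. x i) z = (\<Sum>i\<in>I. ip (x i) z)"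
  by (induction I rule: finite_induct) (simp_all add: ip_zero_left ip_add_left subspace_sum[OF subspace_V])

lemma sn_sq: "x \<in> V \<Longrightarrow> (sn x)\<^sup>2 = ip x x"
  by (simp add: seminorm_def ip_nonneg)

lemma sn_nonneg: "x \<in> V \<Longrightarrow> 0 \<le> sn x"
  by (simp add: seminorm_def ip_nonneg)

lemma sn_scaleR: "x \<in> V \<Longrightarrow> sn (c *\<^sub>R x) = \<bar>c\<bar> * sn x"
  by (simp add: seminorm_def ip_scaleR_left ip_scaleR_right V_scaleR real_sqrt_mult
      mult.assoc[symmetric] power2_eq_square[symmetric])

lemma sn_minus: "x \<in> V \<Longrightarrow> sn (- x) = sn x"
  using sn_scaleR[of x "-1"] by simp

lemma sn_minus_commute: "x \<in> V \<Longrightarrow> y \<in> V \<Longrightarrow> sn (x - y) = sn (y - x)"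
  using sn_minus[of "y - x"] by (simp add: V_diff)

text \<open>The form may be degenerate, so a null vector \<open>y\<close> gets its own case: there a
  nonzero \<open>ip x y\<close> would let the polynomial in \<open>t\<close>, which is then affine,
  become negative.\<close>

lemma Cauchy_Schwarz:
  assumes x: "x \<in> V" and y: "y \<in> V" shows "\<bar>ip x y\<bar> \<le> sn x * sn y"
proof -
  have quad: "0 \<le> ip x x + 2 * t * ip x y + t * t * ip y y" for t
  proof -
    have ty: "t *\<^sub>R y \<in> V" using y by (rule V_scaleR)
    have "ip (x + t *\<^sub>R y) (x + t *\<^sub>R y) = ip x x + 2 * t * ip x y + t * t * ip y y"
      using ip_commute[OF x y] by (simp add: ip_add_left[OF x ty V_add[OF x ty]]
          ip_add_right[OF x ty x] ip_add_right[OF x ty ty] ip_scaleR_left[OF y x]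
          ip_scaleR_left[OF y ty] ip_scaleR_right[OF y x] ip_scaleR_right[OF y y])
    then show ?thesis using ip_nonneg[OF V_add[OF x ty]] by linarith
  qed
  have "(ip x y)\<^sup>2 \<le> ip x x * ip y y"
  proof (cases "ip y y = 0")
    case True
    have "ip x y = 0"
    proof (rule ccontr)
      assume ne: "ip x y \<noteq> 0"
      \<comment> \<open>This \<open>t\<close> is chosen so that the polynomial takes the value
        -1.\<close>
      have "2 * (- (ip x x + 1) / (2 * ip x y)) * ip x y = - (ip x x + 1)"
        using ne by (simp add: field_simps)
      with quad[of "- (ip x x + 1) / (2 * ip x y)"] True show False by simp
    qed
    then show ?thesis using True by simp
  next
    case False
    then have pos: "0 < ip y y" using ip_nonneg[OF y] by linarith
    \<comment> \<open>Here \<open>t\<close> is the minimiser of the quadratic polynomial.\<close>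
    have "2 * (- ip x y / ip y y) * ip x y + (- ip x y / ip y y) * (- ip x y / ip y y) * ip y y
        = - ((ip x y)\<^sup>2 / ip y y)"
      using pos by (simp add: field_simps power2_eq_square)
    with quad[of "- ip x y / ip y y"] have "(ip x y)\<^sup>2 / ip y y \<le> ip x x" by linarith
    then show ?thesis using pos by (simp add: field_simps)
  qed
  also have "ip x x * ip y y = (sn x * sn y)\<^sup>2"
    by (simp add: power_mult_distrib sn_sq x y)
  finally show ?thesis
    by (rule abs_le_square_iff[THEN iffD2, THEN order_trans])
       (simp add: sn_nonneg x y)
qed

lemma sn_triangle:
  assumes x: "x \<in> V" and y: "y \<in> V" shows "sn (x + y) \<le> sn x + sn y"
proof (rule power2_le_imp_le)
  have "(sn (x + y))\<^sup>2 = ip x x + 2 * ip x y + ip y y"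
    using ip_commute[OF x y]
    by (simp add: sn_sq[OF V_add[OF x y]] ip_add_left[OF x y V_add[OF x y]]
        ip_add_right[OF x y x] ip_add_right[OF x y y])
  also have "\<dots> \<le> (sn x)\<^sup>2 + 2 * (sn x * sn y) + (sn y)\<^sup>2"
    using Cauchy_Schwarz[OF x y] unfolding sn_sq[OF x] sn_sq[OF y] by linarith
  also have "\<dots> = (sn x + sn y)\<^sup>2" by (simp add: power2_sum)
  finally show "(sn (x + y))\<^sup>2 \<le> (sn x + sn y)\<^sup>2" .
  show "0 \<le> sn x + sn y" using sn_nonneg x y by (simp add: add_nonneg_nonneg)
qed

lemma sn_triangle_diff:
  assumes "x \<in> V" "y \<in> V" shows "sn (x - y) \<le> sn x + sn y"
  using sn_triangle[OF assms(1) V_minus[OF assms(2)]] by (simp add: sn_minus assms)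

lemma sn_triangle_via:
  assumes "x \<in> V" "y \<in> V" "z \<in> V" shows "sn (x - z) \<le> sn (x - y) + sn (y - z)"
  using sn_triangle[OF V_diff[OF assms(1,2)] V_diff[OF assms(2,3)]] by simp

lemma sn_add_sq:
  assumes x: "x \<in> V" and y: "y \<in> V" shows "(sn (x - y))\<^sup>2 \<le> 2 * (sn x)\<^sup>2 + 2 * (sn y)\<^sup>2"
proof -
  have "(sn (x - y))\<^sup>2 + (sn (x + y))\<^sup>2 = 2 * (sn x)\<^sup>2 + 2 * (sn y)\<^sup>2"
    using ip_commute[OF x y]
    by (simp add: sn_sq V_add V_diff x y ip_add_left ip_add_right ip_diff_left ip_diff_right)
  then show ?thesis using zero_le_power2[of "sn (x + y)"] by linarith
qed

lemma ip_bound_sq: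
  assumes x: "x \<in> V" and y: "y \<in> V" shows "\<bar>ip x y\<bar> \<le> (sn x)\<^sup>2 + (sn y)\<^sup>2"
proof -
  have "sn x * sn y \<le> (sn x)\<^sup>2 + (sn y)\<^sup>2"
    using sum_squares_bound[of "sn x" "sn y"] mult_nonneg_nonneg[OF sn_nonneg[OF x] sn_nonneg[OF y]]
    by linarith
  then show ?thesis using Cauchy_Schwarz[OF x y] by linarith
qed

text \<open>By Cauchy-Schwarz the form cannot distinguish vectors at seminorm distance 0, which is
  what makes it a form on classes.\<close>

lemma ip_null_left:
  assumes "x \<in> V" "y \<in> V" "z \<in> V" "sn (x - y) = 0" shows "ip x z = ip y z"
  using Cauchy_Schwarz[OF V_diff[OF assms(1,2)] assms(3)] assms by (simp add: ip_diff_left)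

lemma ip_null_right:
  assumes "x \<in> V" "y \<in> V" "z \<in> V" "sn (x - y) = 0" shows "ip z x = ip z y"
  using ip_null_left[OF assms] assms(1-3) by (simp add: ip_commute)

lemma ip_tendsto:
  assumes X: "\<And>k. X k \<in> V" and Y: "\<And>k. Y k \<in> V" and xy: "x \<in> V" "y \<in> V"
    and lim: "((\<lambda>k. sn (X k - x)) \<longlongrightarrow> 0) F" "((\<lambda>k. sn (Y k - y)) \<longlongrightarrow> 0) F"
  shows "((\<lambda>k. ip (X k) (Y k)) \<longlongrightarrow> ip x y) F"
proof -
  have bound: "norm (ip (X k) (Y k) - ip x y) \<le> sn (X k - x) * (sn (Y k - y) + sn y) + sn x * sn (Y k - y)" for k
  proof -
    have D: "X k - x \<in> V" "Y k - y \<in> V" using X Y xy by (auto intro: V_diff)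
    have "ip (X k) (Y k) - ip x y = ip (X k - x) (Y k) + ip x (Y k - y)"
      by (simp add: ip_diff_left ip_diff_right X Y xy)
    moreover have "\<bar>ip (X k - x) (Y k)\<bar> \<le> sn (X k - x) * sn (Y k)" by (rule Cauchy_Schwarz[OF D(1) Y])
    moreover have "sn (X k - x) * sn (Y k) \<le> sn (X k - x) * (sn (Y k - y) + sn y)"
      using sn_triangle[OF D(2) xy(2)] by (intro mult_left_mono sn_nonneg D) simp
    moreover have "\<bar>ip x (Y k - y)\<bar> \<le> sn x * sn (Y k - y)" by (rule Cauchy_Schwarz[OF xy(1) D(2)])
    ultimately show ?thesis unfolding real_norm_def by linarith
  qed
  have "((\<lambda>k. sn (X k - x) * (sn (Y k - y) + sn y) + sn x * sn (Y k - y)) \<longlongrightarrow> 0 * (0 + sn y) + sn x * 0) F"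
    by (intro tendsto_add tendsto_mult tendsto_const lim)
  then have lim0: "((\<lambda>k. sn (X k - x) * (sn (Y k - y) + sn y) + sn x * sn (Y k - y)) \<longlongrightarrow> 0) F" by simp
  have "((\<lambda>k. ip (X k) (Y k) - ip x y) \<longlongrightarrow> 0) F"
    by (rule Lim_null_comparison[OF always_eventually lim0]) (use bound in blast)
  then show ?thesis by (rule LIM_zero_cancel)
qed

end

lemma semi_inner_space_Lsq: "semi_inner_space (Lsq M) (Lsq_inner M)"
  by unfold_locales
     (rule Lsq_inner_commute | simp add: subspace_Lsq plus_fun_def scaleR_fun_def Lsq_inner_add
       Lsq_inner_scaleR Lsq_inner_nonneg)+

section \<open>Vector-valued functions of time\<close>

text \<open>Lebesgue measure is complete, so a change on a null set preserves measurability.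
  Pairings of strongly measurable functions are reached only as almost everywhere limits, hence
  through this lemma.\<close>

lemma borel_measurable_lebesgue_on_AE:
  fixes f g :: "'a::euclidean_space \<Rightarrow> real"
  assumes S: "S \<in> sets lebesgue" and f: "f \<in> borel_measurable (lebesgue_on S)"
    and ae: "AE x in lebesgue_on S. f x = g x"
  shows "g \<in> borel_measurable (lebesgue_on S)"
proof -
  have S': "S \<inter> space lebesgue \<in> sets lebesgue" using S by simp
  have "AE x in lebesgue. x \<in> S \<longrightarrow> f x = g x"
    using ae S by (simp add: AE_restrict_space_iff)
  then have "AE x in lebesgue. indicator S x *\<^sub>R f x = indicator S x *\<^sub>R g x"
    by (rule eventually_mono) (auto simp: indicator_def)
  moreover have "(\<lambda>x. indicator S x *\<^sub>R f x) \<in> borel_measurable lebesgue"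
    using f borel_measurable_restrict_space_iff[OF S', of f] by blast
  ultimately have "(\<lambda>x. indicator S x *\<^sub>R g x) \<in> borel_measurable lebesgue"
    by (rule borel_measurable_AE[rotated])
  then show ?thesis using borel_measurable_restrict_space_iff[OF S', of g] by blast
qed

lemma borel_measurable_lebesgue_on_AE_LIMSEQ:
  fixes f :: "nat \<Rightarrow> 'a::euclidean_space \<Rightarrow> real"
  assumes S: "S \<in> sets lebesgue" and f: "\<And>k. f k \<in> borel_measurable (lebesgue_on S)"
    and ae: "AE x in lebesgue_on S. (\<lambda>k. f k x) \<longlonglongrightarrow> g x"
  shows "g \<in> borel_measurable (lebesgue_on S)"
proof (rule borel_measurable_lebesgue_on_AE[OF S borel_measurable_lim_metric[of f, OF f]])
  show "AE x in lebesgue_on S. lim (\<lambda>k. f k x) = g x"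
    using ae by (rule eventually_mono) (rule limI)
qed

context semi_inner_space
begin

lemma simple_intoD:
  assumes "simple_into V M s"
  shows "simple_function M s" "t \<in> space M \<Longrightarrow> s t \<in> V"
  using assms unfolding simple_into_def by blast+

lemma simple_into_diff:
  assumes s: "simple_into V M s" and r: "simple_into V M r"
  shows "simple_into V M (\<lambda>t. s t - r t)"
  unfolding simple_into_def
proof
  show "simple_function M (\<lambda>t. s t - r t)"
    by (rule simple_function_compose2[OF simple_intoD(1)[OF s] simple_intoD(1)[OF r]])
  show "(\<lambda>t. s t - r t) ` space M \<subseteq> V"
    using simple_intoD(2)[OF s] simple_intoD(2)[OF r] V_diff by blast
qed

lemma simple_into_const: "x \<in> V \<Longrightarrow> simple_into V M (\<lambda>_. x)"
  unfolding simple_into_def by auto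

lemma strongly_measurableE:
  assumes "strongly_measurable V ip M w"
  obtains s where "\<And>k::nat. simple_into V M (s k)"
    "AE t in M. (\<lambda>k. sn (s k t - w t)) \<longlonglongrightarrow> 0"
  using assms unfolding strongly_measurable_def by blast

lemma strongly_measurable_AE: "strongly_measurable V ip M w \<Longrightarrow> AE t in M. w t \<in> V"
  unfolding strongly_measurable_def by blast

lemma strongly_measurable_simple:
  assumes s: "simple_into V M s" shows "strongly_measurable V ip M s"
proof -
  have "sn (s t - s t) = 0" for t using sn_scaleR[of 0 0] V_zero by simp
  then have "AE t in M. (\<lambda>k::nat. sn (s t - s t)) \<longlonglongrightarrow> 0" by simp
  moreover have "AE t in M. s t \<in> V" using simple_intoD(2)[OF s] by (rule AE_I2)
  ultimately show ?thesis
    unfolding strongly_measurable_def using s by (intro conjI exI[of _ "\<lambda>_. s"] allI)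
qed

lemma strongly_measurable_diff:
  assumes w: "strongly_measurable V ip M w" and z: "strongly_measurable V ip M z"
  shows "strongly_measurable V ip M (\<lambda>t. w t - z t)"
proof -
  obtain s where s: "\<And>k::nat. simple_into V M (s k)" "AE t in M. (\<lambda>k. sn (s k t - w t)) \<longlonglongrightarrow> 0"
    using strongly_measurableE[OF w] by blast
  obtain r where r: "\<And>k::nat. simple_into V M (r k)" "AE t in M. (\<lambda>k. sn (r k t - z t)) \<longlonglongrightarrow> 0"
    using strongly_measurableE[OF z] by blast
  have wz: "AE t in M. w t \<in> V \<and> z t \<in> V"
    using strongly_measurable_AE[OF w] strongly_measurable_AE[OF z] by eventually_elim blast
  have "AE t in M. (\<lambda>k. sn ((s k t - r k t) - (w t - z t))) \<longlonglongrightarrow> 0"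
    using s(2) r(2) wz AE_space
  proof eventually_elim
    case (elim t)
    have V: "s k t - w t \<in> V" "r k t - z t \<in> V" for k
      using elim simple_intoD(2)[OF s(1)] simple_intoD(2)[OF r(1)] V_diff by blast+
    have eq: "(s k t - r k t) - (w t - z t) = (s k t - w t) - (r k t - z t)" for k by simp
    have sum: "(\<lambda>k. sn (s k t - w t) + sn (r k t - z t)) \<longlonglongrightarrow> 0"
      using tendsto_add[OF elim(1,2)] by simp
    show ?case
      unfolding eq
      by (rule tendsto_sandwich[OF always_eventually always_eventually tendsto_const sum])
         (use V sn_triangle_diff sn_nonneg V_diff in blast)+
  qed
  moreover have "AE t in M. w t - z t \<in> V" using wz by eventually_elim (blast intro: V_diff)
  ultimately show ?thesis
    unfolding strongly_measurable_def using simple_into_diff[OF s(1) r(1)]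
    by (intro conjI exI[of _ "\<lambda>k t. s k t - r k t"]) blast+
qed

text \<open>Pairings of simple functions are real simple functions, and they converge almost
  everywhere to the pairing of the limits. Measurability of seminorms in time is a
  consequence.\<close>

lemma strongly_measurable_ip:
  assumes S: "S \<in> sets lebesgue" and w: "strongly_measurable V ip (lebesgue_on S) w"
    and z: "strongly_measurable V ip (lebesgue_on S) z"
  shows "(\<lambda>t. ip (w t) (z t)) \<in> borel_measurable (lebesgue_on S)"
proof -
  let ?M = "lebesgue_on S"
  obtain s where s: "\<And>k::nat. simple_into V ?M (s k)" "AE t in ?M. (\<lambda>k. sn (s k t - w t)) \<longlonglongrightarrow> 0"
    using strongly_measurableE[OF w] by blast
  obtain r where r: "\<And>k::nat. simple_into V ?M (r k)" "AE t in ?M. (\<lambda>k. sn (r k t - z t)) \<longlonglongrightarrow> 0"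
    using strongly_measurableE[OF z] by blast
  show ?thesis
  proof (rule borel_measurable_lebesgue_on_AE_LIMSEQ[OF S])
    show "(\<lambda>t. ip (s k t) (r k t)) \<in> borel_measurable ?M" for k
      by (rule borel_measurable_simple_function[OF simple_function_compose2[OF
            simple_intoD(1)[OF s(1)] simple_intoD(1)[OF r(1)]]])
    show "AE t in ?M. (\<lambda>k. ip (s k t) (r k t)) \<longlonglongrightarrow> ip (w t) (z t)"
      using s(2) r(2) strongly_measurable_AE[OF w] strongly_measurable_AE[OF z] AE_space
    proof eventually_elim
      case (elim t)
      show ?case
        by (rule ip_tendsto[OF simple_intoD(2)[OF s(1) elim(5)] simple_intoD(2)[OF r(1) elim(5)]
            elim(3,4,1,2)])
    qed
  qed
qed

lemma strongly_measurable_sn: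
  assumes "S \<in> sets lebesgue" "strongly_measurable V ip (lebesgue_on S) w"
  shows "(\<lambda>t. sn (w t)) \<in> borel_measurable (lebesgue_on S)"
  unfolding seminorm_def using strongly_measurable_ip[OF assms(1,2,2)] by measurable

lemma strongly_measurable_ip_const:
  assumes "S \<in> sets lebesgue" "strongly_measurable V ip (lebesgue_on S) w" "x \<in> V"
  shows "(\<lambda>t. ip (w t) x) \<in> borel_measurable (lebesgue_on S)"
  by (rule strongly_measurable_ip[OF assms(1,2) strongly_measurable_simple[OF simple_into_const[OF assms(3)]]])

section \<open>Bochner integrals and their scalar components\<close>

lemma simple_bochner_integrable_into:
  assumes "finite_measure M" "simple_into V M s"
  shows "Bochner_Integration.simple_bochner_integrable M s"
  by (rule simple_bochner_integrable.intros[OF simple_intoD(1)[OF assms(2)]])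
     (simp add: finite_measure.emeasure_finite[OF assms(1)])

text \<open>Pairing with \<open>x\<close> is linear only on \<open>V\<close>, so it is exchanged
  with the integral value by value, in the finite sum over the values of \<open>s\<close>.\<close>

lemma simple_bochner_integral_ip:
  assumes M: "finite_measure M" and s: "simple_into V M s" and x: "x \<in> V"
  shows "Bochner_Integration.simple_bochner_integrable M (\<lambda>t. ip (s t) x)"
    and "Bochner_Integration.simple_bochner_integral M (\<lambda>t. ip (s t) x) = ip (Bochner_Integration.simple_bochner_integral M s) x"
proof -
  have sf: "simple_function M s" by (rule simple_intoD(1)[OF s])
  show i: "Bochner_Integration.simple_bochner_integrable M (\<lambda>t. ip (s t) x)"
    by (rule simple_bochner_integrable.intros[OF simple_function_compose1[OF sf]])
       (simp add: finite_measure.emeasure_finite[OF M])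
  have "Bochner_Integration.simple_bochner_integral M (\<lambda>t. ip (s t) x)
      = (\<Sum>y\<in>s ` space M. measure M {t \<in> space M. s t = y} *\<^sub>R ip y x)"
  proof (rule simple_bochner_integral_partition[OF i sf])
    show "ip (s t) x = ip (s t') x" if "s t = s t'" for t t' using that by (rule arg_cong)
  qed (rule refl)
  also have "\<dots> = (\<Sum>y\<in>s ` space M. ip (measure M {t \<in> space M. s t = y} *\<^sub>R y) x)"
  proof (rule sum.cong[OF refl])
    fix y assume "y \<in> s ` space M"
    then have "y \<in> V" using simple_intoD(2)[OF s] by blast
    from ip_scaleR_left[OF this x]
    show "measure M {t \<in> space M. s t = y} *\<^sub>R ip y x = ip (measure M {t \<in> space M. s t = y} *\<^sub>R y) x"
      unfolding real_scaleR_def by (rule sym)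
  qed
  also have "\<dots> = ip (Bochner_Integration.simple_bochner_integral M s) x"
    unfolding simple_bochner_integral_def
  proof (rule ip_sum_left[symmetric, OF _ _ x])
    show "finite (s ` space M)" using sf by (simp only: simple_function_def)
    fix y assume "y \<in> s ` space M"
    then have "y \<in> V" using simple_intoD(2)[OF s] by blast
    then show "measure M {t \<in> space M. s t = y} *\<^sub>R y \<in> V" by (rule V_scaleR)
  qed
  finally show "Bochner_Integration.simple_bochner_integral M (\<lambda>t. ip (s t) x) = ip (Bochner_Integration.simple_bochner_integral M s) x" .
qed

lemma simple_bochner_integral_in:
  assumes s: "simple_into V M s" shows "Bochner_Integration.simple_bochner_integral M s \<in> V"
  unfolding simple_bochner_integral_def
proof (rule subspace_sum[OF subspace_V])
  fix y assume "y \<in> s ` space M"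
  then have "y \<in> V" using simple_intoD(2)[OF s] by blast
  then show "measure M {t \<in> space M. s t = y} *\<^sub>R y \<in> V" by (rule V_scaleR)
qed

text \<open>The bridge from vector-valued to real integrals. Cauchy-Schwarz bounds the scalar
  approximation error by \<open>sn x\<close> times the seminorm error, so the same simple functions
  serve as witnesses for both integrals.\<close>

lemma has_bochner_integral_in_ip:
  assumes S: "S \<in> lmeasurable" and w: "has_bochner_integral_in V ip (lebesgue_on S) w I" and x: "x \<in> V"
  shows "has_bochner_integral (lebesgue_on S) (\<lambda>t. ip (w t) x) (ip I x)"
proof -
  let ?M = "lebesgue_on S"
  have S': "S \<in> sets lebesgue" using S by (rule fmeasurableD)
  have fin: "finite_measure ?M" by (rule finite_measure_lebesgue_on[OF S])
  from w obtain s where I: "I \<in> V" and wm: "strongly_measurable V ip ?M w"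
    and s: "\<And>k::nat. simple_into V ?M (s k)"
    and L: "(\<lambda>k. \<integral>\<^sup>+t. ennreal (sn (s k t - w t)) \<partial>?M) \<longlonglongrightarrow> 0"
    and J: "(\<lambda>k. sn (Bochner_Integration.simple_bochner_integral ?M (s k) - I)) \<longlonglongrightarrow> 0"
    unfolding has_bochner_integral_in_def by blast
  show ?thesis
  proof (rule has_bochner_integral.intros)
    show "(\<lambda>t. ip (w t) x) \<in> borel_measurable ?M"
      by (rule strongly_measurable_ip_const[OF S' wm x])
    show "Bochner_Integration.simple_bochner_integrable ?M (\<lambda>t. ip (s k t) x)" for k
      by (rule simple_bochner_integral_ip(1)[OF fin s x])
    have "(\<integral>\<^sup>+t. norm (ip (w t) x - ip (s k t) x) \<partial>?M) \<le> ennreal (sn x) * (\<integral>\<^sup>+t. ennreal (sn (s k t - w t)) \<partial>?M)" for k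
    proof -
      have m: "(\<lambda>t. ennreal (sn (s k t - w t))) \<in> borel_measurable ?M"
        using strongly_measurable_sn[OF S' strongly_measurable_diff[OF strongly_measurable_simple[OF s] wm]]
        by measurable
      have "(\<integral>\<^sup>+t. norm (ip (w t) x - ip (s k t) x) \<partial>?M) \<le> (\<integral>\<^sup>+t. ennreal (sn x) * ennreal (sn (s k t - w t)) \<partial>?M)"
      proof (rule nn_integral_mono_AE)
        show "AE t in ?M. ennreal (norm (ip (w t) x - ip (s k t) x)) \<le> ennreal (sn x) * ennreal (sn (s k t - w t))"
          using strongly_measurable_AE[OF wm] AE_space
        proof eventually_elim
          case (elim t)
          have sk: "s k t \<in> V" by (rule simple_intoD(2)[OF s elim(2)])
          have "\<bar>ip (s k t - w t) x\<bar> \<le> sn (s k t - w t) * sn x"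
            by (rule Cauchy_Schwarz[OF V_diff[OF sk elim(1)] x])
          then have "norm (ip (w t) x - ip (s k t) x) \<le> sn x * sn (s k t - w t)"
            by (simp add: ip_diff_left sk elim x mult.commute abs_minus_commute)
          then have "ennreal (norm (ip (w t) x - ip (s k t) x)) \<le> ennreal (sn x * sn (s k t - w t))"
            by (rule ennreal_leI)
          then show ?case by (simp add: ennreal_mult sn_nonneg x V_diff sk elim)
        qed
      qed
      also have "\<dots> = ennreal (sn x) * (\<integral>\<^sup>+t. ennreal (sn (s k t - w t)) \<partial>?M)"
        by (rule nn_integral_cmult[OF m])
      finally show ?thesis .
    qed
    moreover have "(\<lambda>k. ennreal (sn x) * (\<integral>\<^sup>+t. ennreal (sn (s k t - w t)) \<partial>?M)) \<longlonglongrightarrow> 0"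
      using ennreal_tendsto_cmult[OF _ L, of "ennreal (sn x)"] by simp
    ultimately show "(\<lambda>k. \<integral>\<^sup>+t. norm (ip (w t) x - ip (s k t) x) \<partial>?M) \<longlonglongrightarrow> 0"
      by (rule_tac tendsto_sandwich[OF always_eventually[OF allI] always_eventually[OF allI] tendsto_const])
         (assumption | rule zero_le)+
    have "(\<lambda>k. ip (Bochner_Integration.simple_bochner_integral ?M (s k)) x) \<longlonglongrightarrow> ip I x"
      by (rule ip_tendsto[OF simple_bochner_integral_in[OF s] x I x J])
         (use sn_scaleR[of 0 0] V_zero in simp)
    then show "(\<lambda>k. Bochner_Integration.simple_bochner_integral ?M (\<lambda>t. ip (s k t) x)) \<longlonglongrightarrow> ip I x"
      by (simp only: simple_bochner_integral_ip(2)[OF fin s x])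
  qed
qed

lemma has_bochner_integral_in_diff:
  assumes S: "S \<in> lmeasurable" and w: "has_bochner_integral_in V ip (lebesgue_on S) w I"
    and z: "has_bochner_integral_in V ip (lebesgue_on S) z J"
  shows "has_bochner_integral_in V ip (lebesgue_on S) (\<lambda>t. w t - z t) (I - J)"
proof -
  let ?M = "lebesgue_on S"
  have S': "S \<in> sets lebesgue" using S by (rule fmeasurableD)
  have fin: "finite_measure ?M" by (rule finite_measure_lebesgue_on[OF S])
  from w obtain s where I: "I \<in> V" and wm: "strongly_measurable V ip ?M w"
    and s: "\<And>k::nat. simple_into V ?M (s k)"
    and Ls: "(\<lambda>k. \<integral>\<^sup>+t. ennreal (sn (s k t - w t)) \<partial>?M) \<longlonglongrightarrow> 0"
    and Is: "(\<lambda>k. sn (Bochner_Integration.simple_bochner_integral ?M (s k) - I)) \<longlonglongrightarrow> 0"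
    unfolding has_bochner_integral_in_def by blast
  from z obtain r where J: "J \<in> V" and zm: "strongly_measurable V ip ?M z"
    and r: "\<And>k::nat. simple_into V ?M (r k)"
    and Lr: "(\<lambda>k. \<integral>\<^sup>+t. ennreal (sn (r k t - z t)) \<partial>?M) \<longlonglongrightarrow> 0"
    and Ir: "(\<lambda>k. sn (Bochner_Integration.simple_bochner_integral ?M (r k) - J)) \<longlonglongrightarrow> 0"
    unfolding has_bochner_integral_in_def by blast
  have meas: "(\<lambda>t. ennreal (sn (s k t - w t))) \<in> borel_measurable ?M"
    "(\<lambda>t. ennreal (sn (r k t - z t))) \<in> borel_measurable ?M" for k
    using strongly_measurable_sn[OF S' strongly_measurable_diff[OF strongly_measurable_simple[OF s] wm]]
      strongly_measurable_sn[OF S' strongly_measurable_diff[OF strongly_measurable_simple[OF r] zm]]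
    by measurable
  have "(\<integral>\<^sup>+t. ennreal (sn ((s k t - r k t) - (w t - z t))) \<partial>?M)
      \<le> (\<integral>\<^sup>+t. ennreal (sn (s k t - w t)) \<partial>?M) + (\<integral>\<^sup>+t. ennreal (sn (r k t - z t)) \<partial>?M)" for k
  proof -
    have "(\<integral>\<^sup>+t. ennreal (sn ((s k t - r k t) - (w t - z t))) \<partial>?M)
        \<le> (\<integral>\<^sup>+t. ennreal (sn (s k t - w t)) + ennreal (sn (r k t - z t)) \<partial>?M)"
    proof (rule nn_integral_mono_AE)
      show "AE t in ?M. ennreal (sn ((s k t - r k t) - (w t - z t))) \<le> ennreal (sn (s k t - w t)) + ennreal (sn (r k t - z t))"
        using strongly_measurable_AE[OF wm] strongly_measurable_AE[OF zm] AE_space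
      proof eventually_elim
        case (elim t)
        have a: "s k t - w t \<in> V" by (rule V_diff[OF simple_intoD(2)[OF s elim(3)] elim(1)])
        have b: "r k t - z t \<in> V" by (rule V_diff[OF simple_intoD(2)[OF r elim(3)] elim(2)])
        have eq: "(s k t - r k t) - (w t - z t) = (s k t - w t) - (r k t - z t)" by simp
        have "ennreal (sn ((s k t - w t) - (r k t - z t))) \<le> ennreal (sn (s k t - w t) + sn (r k t - z t))"
          by (rule ennreal_leI[OF sn_triangle_diff[OF a b]])
        then show ?case unfolding eq ennreal_plus[OF sn_nonneg[OF a] sn_nonneg[OF b]] .
      qed
    qed
    then show ?thesis unfolding nn_integral_add[OF meas] .
  qed
  then have L: "(\<lambda>k. \<integral>\<^sup>+t. ennreal (sn ((s k t - r k t) - (w t - z t))) \<partial>?M) \<longlonglongrightarrow> 0"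
    using tendsto_add[OF Ls Lr, unfolded add_0]
    by (rule_tac tendsto_sandwich[OF always_eventually[OF allI] always_eventually[OF allI] tendsto_const])
       (assumption | rule zero_le)+
  have sb: "Bochner_Integration.simple_bochner_integral ?M (\<lambda>t. s k t - r k t) = Bochner_Integration.simple_bochner_integral ?M (s k) - Bochner_Integration.simple_bochner_integral ?M (r k)" for k
    by (rule simple_bochner_integral_diff[OF simple_bochner_integrable_into[OF fin s] simple_bochner_integrable_into[OF fin r]])
  have K: "(\<lambda>k. sn (Bochner_Integration.simple_bochner_integral ?M (\<lambda>t. s k t - r k t) - (I - J))) \<longlonglongrightarrow> 0"
  proof (rule tendsto_sandwich[OF always_eventually always_eventually tendsto_const])
    show "(\<lambda>k. sn (Bochner_Integration.simple_bochner_integral ?M (s k) - I) + sn (Bochner_Integration.simple_bochner_integral ?M (r k) - J)) \<longlonglongrightarrow> 0"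
      using tendsto_add[OF Is Ir] by simp
    have V: "Bochner_Integration.simple_bochner_integral ?M (s k) - I \<in> V" "Bochner_Integration.simple_bochner_integral ?M (r k) - J \<in> V" for k
      using simple_bochner_integral_in[OF s] simple_bochner_integral_in[OF r] I J V_diff by blast+
    have eq: "Bochner_Integration.simple_bochner_integral ?M (\<lambda>t. s k t - r k t) - (I - J)
        = (Bochner_Integration.simple_bochner_integral ?M (s k) - I) - (Bochner_Integration.simple_bochner_integral ?M (r k) - J)" for k
      by (simp add: sb)
    show "\<forall>k. sn (Bochner_Integration.simple_bochner_integral ?M (\<lambda>t. s k t - r k t) - (I - J))
        \<le> sn (Bochner_Integration.simple_bochner_integral ?M (s k) - I) + sn (Bochner_Integration.simple_bochner_integral ?M (r k) - J)"
      unfolding eq using sn_triangle_diff V by blast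
    show "\<forall>k. 0 \<le> sn (Bochner_Integration.simple_bochner_integral ?M (\<lambda>t. s k t - r k t) - (I - J))"
      unfolding eq using sn_nonneg V V_diff by blast
  qed
  show ?thesis
    unfolding has_bochner_integral_in_def
    using V_diff[OF I J] strongly_measurable_diff[OF wm zm] simple_into_diff[OF s r] L K
    by (intro conjI exI[of _ "\<lambda>k t. s k t - r k t"] allI)
qed

section \<open>Square-integrable functions of time\<close>

lemma L2_timeD:
  assumes "w \<in> L2_time V ip T"
  shows "strongly_measurable V ip (lebesgue_on {0..T}) w"
    and "integrable (lebesgue_on {0..T}) (\<lambda>t. (sn (w t))\<^sup>2)"
proof -
  show m: "strongly_measurable V ip (lebesgue_on {0..T}) w" using assms by (simp add: L2_time_def)
  have "(\<lambda>t. (sn (w t))\<^sup>2) \<in> borel_measurable (lebesgue_on {0..T})"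
    using strongly_measurable_sn[OF _ m] by simp
  then show "integrable (lebesgue_on {0..T}) (\<lambda>t. (sn (w t))\<^sup>2)"
    using assms by (intro integrableI_nonneg) (simp_all add: L2_time_def)
qed

lemma L2_timeI:
  assumes "strongly_measurable V ip (lebesgue_on {0..T}) w"
    and "integrable (lebesgue_on {0..T}) (\<lambda>t. (sn (w t))\<^sup>2)"
  shows "w \<in> L2_time V ip T"
  using assms by (simp add: L2_time_def nn_integral_eq_integral)

lemma L2_time_dominated:
  assumes m: "strongly_measurable V ip (lebesgue_on {0..T}) w" and b: "integrable (lebesgue_on {0..T}) b"
    and "AE t in lebesgue_on {0..T}. (sn (w t))\<^sup>2 \<le> b t"
  shows "w \<in> L2_time V ip T"
proof (rule L2_timeI[OF m])
  show "integrable (lebesgue_on {0..T}) (\<lambda>t. (sn (w t))\<^sup>2)"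
  proof (rule Bochner_Integration.integrable_bound[OF b])
    show "(\<lambda>t. (sn (w t))\<^sup>2) \<in> borel_measurable (lebesgue_on {0..T})"
      using strongly_measurable_sn[OF _ m] by simp
    show "AE t in lebesgue_on {0..T}. norm ((sn (w t))\<^sup>2) \<le> norm (b t)"
      using assms(3)
    proof eventually_elim
      case (elim t)
      then show ?case using abs_ge_self[of "b t"] unfolding real_norm_def abs_power2 by linarith
    qed
  qed
qed

lemma L2_time_AE: "w \<in> L2_time V ip T \<Longrightarrow> AE t in lebesgue_on {0..T}. w t \<in> V"
  by (rule strongly_measurable_AE[OF L2_timeD(1)])

lemma L2_time_diff:
  assumes w: "w \<in> L2_time V ip T" and z: "z \<in> L2_time V ip T"
  shows "(\<lambda>t. w t - z t) \<in> L2_time V ip T"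
proof (rule L2_time_dominated)
  show "strongly_measurable V ip (lebesgue_on {0..T}) (\<lambda>t. w t - z t)"
    by (rule strongly_measurable_diff[OF L2_timeD(1)[OF w] L2_timeD(1)[OF z]])
  show "integrable (lebesgue_on {0..T}) (\<lambda>t. 2 * (sn (w t))\<^sup>2 + 2 * (sn (z t))\<^sup>2)"
    using L2_timeD(2)[OF w] L2_timeD(2)[OF z] by simp
  show "AE t in lebesgue_on {0..T}. (sn (w t - z t))\<^sup>2 \<le> 2 * (sn (w t))\<^sup>2 + 2 * (sn (z t))\<^sup>2"
    using L2_time_AE[OF w] L2_time_AE[OF z] by eventually_elim (rule sn_add_sq)
qed

lemma L2_time_const: "x \<in> V \<Longrightarrow> (\<lambda>_. x) \<in> L2_time V ip T"
proof (rule L2_timeI)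
  interpret finite_measure "lebesgue_on {0..T}" by (rule finite_measure_lebesgue_on) simp
  show "integrable (lebesgue_on {0..T}) (\<lambda>t. (sn x)\<^sup>2)" by simp
qed (rule strongly_measurable_simple[OF simple_into_const])

lemma L2_time_ip_integrable:
  assumes w: "w \<in> L2_time V ip T" and z: "z \<in> L2_time V ip T"
  shows "integrable (lebesgue_on {0..T}) (\<lambda>t. ip (w t) (z t))"
proof (rule Bochner_Integration.integrable_bound)
  show "integrable (lebesgue_on {0..T}) (\<lambda>t. (sn (w t))\<^sup>2 + (sn (z t))\<^sup>2)"
    using L2_timeD(2)[OF w] L2_timeD(2)[OF z] by simp
  show "(\<lambda>t. ip (w t) (z t)) \<in> borel_measurable (lebesgue_on {0..T})"
    by (rule strongly_measurable_ip[OF _ L2_timeD(1)[OF w] L2_timeD(1)[OF z]]) simp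
  show "AE t in lebesgue_on {0..T}. norm (ip (w t) (z t)) \<le> norm ((sn (w t))\<^sup>2 + (sn (z t))\<^sup>2)"
    using L2_time_AE[OF w] L2_time_AE[OF z]
  proof eventually_elim
    case (elim t)
    from ip_bound_sq[OF this] show ?case by simp
  qed
qed

lemma L2_time_sn_integrable:
  assumes w: "w \<in> L2_time V ip T"
  shows "integrable (lebesgue_on {0..T}) (\<lambda>t. sn (w t))"
proof (rule Bochner_Integration.integrable_bound)
  interpret finite_measure "lebesgue_on {0..T}" by (rule finite_measure_lebesgue_on) simp
  show "integrable (lebesgue_on {0..T}) (\<lambda>t. 1 + (sn (w t))\<^sup>2)" using L2_timeD(2)[OF w] by simp
  show "(\<lambda>t. sn (w t)) \<in> borel_measurable (lebesgue_on {0..T})"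
    by (rule strongly_measurable_sn[OF _ L2_timeD(1)[OF w]]) simp
  show "AE t in lebesgue_on {0..T}. norm (sn (w t)) \<le> norm (1 + (sn (w t))\<^sup>2)"
  proof (rule AE_I2)
    fix t
    have "\<bar>sn (w t)\<bar> \<le> 1 + \<bar>sn (w t)\<bar>\<^sup>2"
      using sum_squares_bound[of 1 "\<bar>sn (w t)\<bar>"] abs_ge_zero[of "sn (w t)"]
      unfolding power_one mult_1_right by linarith
    then show "norm (sn (w t)) \<le> norm (1 + (sn (w t))\<^sup>2)" by simp
  qed
qed

end

lemma strongly_measurable_Lipschitz:
  assumes "semi_inner_space V ip" "semi_inner_space V' ip'"
    and w: "strongly_measurable V ip M w" and L: "\<And>x. x \<in> V \<Longrightarrow> L x \<in> V'"
    and K: "\<And>x y. x \<in> V \<Longrightarrow> y \<in> V \<Longrightarrow> seminorm ip' (L x - L y) \<le> K * seminorm ip (x - y)"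
  shows "strongly_measurable V' ip' M (\<lambda>t. L (w t))"
proof -
  interpret A: semi_inner_space V ip by fact
  interpret B: semi_inner_space V' ip' by fact
  obtain s where s: "\<And>k::nat. simple_into V M (s k)" "AE t in M. (\<lambda>k. A.sn (s k t - w t)) \<longlonglongrightarrow> 0"
    using A.strongly_measurableE[OF w] by blast
  have "simple_into V' M (\<lambda>t. L (s k t))" for k
    using A.simple_intoD[OF s(1)[of k]] L unfolding simple_into_def
    by (auto intro: simple_function_compose1)
  moreover have "AE t in M. (\<lambda>k. B.sn (L (s k t) - L (w t))) \<longlonglongrightarrow> 0"
    using s(2) A.strongly_measurable_AE[OF w] AE_space
  proof eventually_elim
    case (elim t)
    have V: "s k t \<in> V" for k by (rule A.simple_intoD(2)[OF s(1) elim(3)])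
    have lim: "(\<lambda>k. K * A.sn (s k t - w t)) \<longlonglongrightarrow> 0"
      using tendsto_mult[OF tendsto_const elim(1), of K] by simp
    show ?case
      by (rule tendsto_sandwich[OF always_eventually always_eventually tendsto_const lim])
         (intro allI B.sn_nonneg B.V_diff L V elim(2) K)+
  qed
  moreover have "AE t in M. L (w t) \<in> V'"
    using A.strongly_measurable_AE[OF w] by eventually_elim (rule L)
  ultimately show ?thesis
    unfolding strongly_measurable_def by (intro conjI exI[of _ "\<lambda>k t. L (s k t)"]) blast+
qed

text \<open>Meant for the two maps that act at each time, \<open>R_map\<close> and the inverse of
  \<open>Q_map\<close>. With \<open>L 0 = 0\<close> the Lipschitz bound becomes the growth bound
  that square-integrability needs.\<close>

lemma L2_time_Lipschitz:
  assumes A: "semi_inner_space V ip" and B: "semi_inner_space V' ip'"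
    and w: "w \<in> L2_time V ip T" and L: "\<And>x. x \<in> V \<Longrightarrow> L x \<in> V'"
    and K: "\<And>x y. x \<in> V \<Longrightarrow> y \<in> V \<Longrightarrow> seminorm ip' (L x - L y) \<le> K * seminorm ip (x - y)"
    and L0: "L 0 = 0"
  shows "(\<lambda>t. L (w t)) \<in> L2_time V' ip' T"
proof (rule semi_inner_space.L2_time_dominated[OF B])
  interpret A: semi_inner_space V ip by fact
  interpret B: semi_inner_space V' ip' by fact
  show "strongly_measurable V' ip' (lebesgue_on {0..T}) (\<lambda>t. L (w t))"
    by (rule strongly_measurable_Lipschitz[OF A B A.L2_timeD(1)[OF w] L K])
  show "integrable (lebesgue_on {0..T}) (\<lambda>t. K\<^sup>2 * (A.sn (w t))\<^sup>2)"
    using A.L2_timeD(2)[OF w] by simp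
  show "AE t in lebesgue_on {0..T}. (B.sn (L (w t)))\<^sup>2 \<le> K\<^sup>2 * (A.sn (w t))\<^sup>2"
    using A.L2_time_AE[OF w]
  proof eventually_elim
    case (elim t)
    have "B.sn (L (w t)) \<le> K * A.sn (w t)"
      using K[OF elim A.V_zero] by (simp add: L0)
    from power_mono[OF this B.sn_nonneg[OF L[OF elim]], of 2]
    show ?case by (simp add: power_mult_distrib)
  qed
qed

section \<open>Weak time derivatives\<close>

lemma C_infinity_deriv:
  fixes \<phi> :: "real \<Rightarrow> real"
  assumes "C_infinity \<phi>" shows "deriv \<phi> t = frechet_derivative \<phi> (at t) 1"
proof -
  note d = C_infinity_has_derivative[OF assms, of t]
  have "frechet_derivative \<phi> (at t) = (*) (frechet_derivative \<phi> (at t) 1)"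
  proof
    fix h show "frechet_derivative \<phi> (at t) h = frechet_derivative \<phi> (at t) 1 * h"
      using linear_cmul[OF bounded_linear.linear[OF has_derivative_bounded_linear[OF d]], of h 1]
      by (simp add: mult.commute)
  qed
  with d have "(\<phi> has_derivative (*) (frechet_derivative \<phi> (at t) 1)) (at t)" by metis
  then show ?thesis by (intro DERIV_imp_deriv) (simp only: has_field_derivative_def)
qed

lemma integrable_continuous_mult:
  fixes f h :: "real \<Rightarrow> real"
  assumes f: "continuous_on UNIV f" and h: "integrable (lebesgue_on {a..b}) h"
  shows "integrable (lebesgue_on {a..b}) (\<lambda>t. f t * h t)"
proof -
  let ?M = "lebesgue_on {a..b}"
  have "compact (f ` {a..b})" by (intro compact_continuous_image continuous_on_subset[OF f]) auto
  then obtain K where K: "\<And>t. t \<in> {a..b} \<Longrightarrow> \<bar>f t\<bar> \<le> K"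
    using compact_imp_bounded[THEN bounded_iff[THEN iffD1]] by (metis imageI real_norm_def)
  show ?thesis
  proof (rule Bochner_Integration.integrable_bound)
    show "integrable ?M (\<lambda>t. K * h t)" using h by simp
    have "f \<in> borel_measurable ?M" by (rule LsqD(1)[OF continuous_imp_Lsq[OF _ _ f]]) simp_all
    then show "(\<lambda>t. f t * h t) \<in> borel_measurable ?M" using h by (intro borel_measurable_times) simp_all
    show "AE t in ?M. norm (f t * h t) \<le> norm (K * h t)"
    proof (rule AE_I2)
      fix t assume "t \<in> space ?M"
      then have "\<bar>f t\<bar> \<le> \<bar>K\<bar>" using K[of t] abs_ge_self[of K] by simp
      from mult_right_mono[OF this abs_ge_zero[of "h t"]]
      show "norm (f t * h t) \<le> norm (K * h t)" by (simp add: abs_mult)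
    qed
  qed
qed

lemma Ioc_integral_diff:
  fixes f :: "real \<Rightarrow> real"
  assumes f: "integrable (lebesgue_on {0..T}) f" and st: "0 \<le> s" "s \<le> t" "t \<le> T"
  shows "(\<integral>r. indicator {0<..t} r * f r \<partial>lebesgue_on {0..T}) - (\<integral>r. indicator {0<..s} r * f r \<partial>lebesgue_on {0..T})
    = (\<integral>r. indicator {s<..t} r * f r \<partial>lebesgue_on {0..T})"
proof -
  have "indicator {0<..t} r * f r - indicator {0<..s} r * f r = indicator {s<..t} r * f r" for r
    using st by (auto simp: indicator_def)
  then show ?thesis
    using st integrable_lebesgue_on_Ioc[OF f]
    by (subst Bochner_Integration.integral_diff[symmetric]) simp_all
qed

text \<open>Dominated convergence along sequences of endpoints: the indicators are eventually
  constant at every point except the limit endpoint itself, a null set.\<close>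

lemma continuous_on_Ioc_integral:
  fixes f :: "real \<Rightarrow> real"
  assumes f: "integrable (lebesgue_on {0..T}) f"
  shows "continuous_on {0..T} (\<lambda>t. \<integral>r. indicator {0<..t} r * f r \<partial>lebesgue_on {0..T})"
proof (rule continuous_on_sequentiallyI)
  let ?M = "lebesgue_on {0..T}"
  fix u :: "nat \<Rightarrow> real" and a assume u: "\<forall>n. u n \<in> {0..T}" "u \<longlonglongrightarrow> a" and a: "a \<in> {0..T}"
  show "(\<lambda>n. \<integral>r. indicator {0<..u n} r * f r \<partial>?M) \<longlonglongrightarrow> (\<integral>r. indicator {0<..a} r * f r \<partial>?M)"
  proof (rule integral_dominated_convergence)
    show "integrable ?M (\<lambda>r. norm (f r))" using f by simp
    show "(\<lambda>r. indicator {0<..u n} r * f r) \<in> borel_measurable ?M" for n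
      by (rule borel_measurable_integrable[OF integrable_lebesgue_on_Ioc[OF f]]) (use u in auto)
    show "(\<lambda>r. indicator {0<..a} r * f r) \<in> borel_measurable ?M"
      by (rule borel_measurable_integrable[OF integrable_lebesgue_on_Ioc[OF f]]) (use a in auto)
    show "AE r in ?M. norm (indicator {0<..u n} r * f r) \<le> norm (f r)" for n
      by (rule AE_I2) (simp add: indicator_def)
    have "AE r in ?M. r \<notin> {a}" by (rule AE_lebesgue_on_not_in) auto
    then show "AE r in ?M. (\<lambda>n. indicator {0<..u n} r * f r) \<longlonglongrightarrow> indicator {0<..a} r * f r"
    proof eventually_elim
      case (elim r)
      have "\<forall>\<^sub>F n in sequentially. (r \<le> u n \<longleftrightarrow> r \<le> a)"
      proof (cases "r < a")
        case True
        from order_tendstoD(1)[OF u(2) this] show ?thesis by (rule eventually_mono) (use True in auto)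
      next
        case False
        then have "a < r" using elim by auto
        from order_tendstoD(2)[OF u(2) this] show ?thesis by (rule eventually_mono) (use \<open>a < r\<close> in auto)
      qed
      then have "\<forall>\<^sub>F n in sequentially. indicator {0<..u n} r * f r = indicator {0<..a} r * f r"
        by (rule eventually_mono) (simp add: indicator_def)
      then show ?case by (rule tendsto_eventually)
    qed
  qed
qed

context semi_inner_space
begin

text \<open>Both vector integrals of the weak formulation are paired with \<open>x\<close>; their
  values \<open>I\<close> and \<open>- I\<close> then yield the scalar weak formulation for
  \<open>ip (w t) x\<close>.\<close>

lemma weak_time_derivative_ip:
  assumes w: "strongly_measurable V ip (lebesgue_on {0..T}) w"
    and w': "strongly_measurable V ip (lebesgue_on {0..T}) w'"
    and weak: "has_weak_time_derivative V ip T w w'" and \<phi>: "test_function {0<..<T} \<phi>" and x: "x \<in> V"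
  shows "(\<integral>t. deriv \<phi> t * ip (w t) x \<partial>lebesgue_on {0..T}) = - (\<integral>t. \<phi> t * ip (w' t) x \<partial>lebesgue_on {0..T})"
proof -
  let ?M = "lebesgue_on {0..T}"
  have lm: "{0..T} \<in> lmeasurable" by simp
  have C: "(\<integral>t. c t * ip (z t) x \<partial>?M) = ip J x"
    if c: "c \<in> borel_measurable ?M" and z: "strongly_measurable V ip ?M z"
      and J: "has_bochner_integral_in V ip ?M (\<lambda>t. c t *\<^sub>R z t) J" for c z J
  proof -
    have h: "has_bochner_integral ?M (\<lambda>t. ip (c t *\<^sub>R z t) x) (ip J x)"
      by (rule has_bochner_integral_in_ip[OF lm J x])
    have "(\<integral>t. c t * ip (z t) x \<partial>?M) = (\<integral>t. ip (c t *\<^sub>R z t) x \<partial>?M)"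
    proof (rule integral_cong_AE)
      have "(\<lambda>t. ip (z t) x) \<in> borel_measurable ?M" by (rule strongly_measurable_ip_const[OF _ z x]) simp
      then show "(\<lambda>t. c t * ip (z t) x) \<in> borel_measurable ?M" using c by (intro borel_measurable_times)
      show "(\<lambda>t. ip (c t *\<^sub>R z t) x) \<in> borel_measurable ?M" using h by (rule has_bochner_integral_iff[THEN iffD1, THEN conjunct1, THEN borel_measurable_integrable])
      show "AE t in ?M. c t * ip (z t) x = ip (c t *\<^sub>R z t) x"
        using strongly_measurable_AE[OF z] by eventually_elim (simp add: ip_scaleR_left x)
    qed
    then show ?thesis using has_bochner_integral_integral_eq[OF h] by simp
  qed
  have s: "C_infinity \<phi>" using \<phi> by (simp only: test_function_def)
  have "deriv \<phi> = (\<lambda>t. frechet_derivative \<phi> (at t) 1)" by (rule ext) (rule C_infinity_deriv[OF s])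
  then have cd: "continuous_on UNIV (deriv \<phi>)"
    using C_infinity_continuous_derivative[OF s, of 1] by simp
  have m: "deriv \<phi> \<in> borel_measurable ?M" "\<phi> \<in> borel_measurable ?M"
    by (rule LsqD(1)[OF continuous_imp_Lsq[OF _ lm cd]] LsqD(1)[OF continuous_imp_Lsq[OF _ lm C_infinity_continuous[OF s]]], simp)+
  from weak \<phi> obtain I where I: "has_bochner_integral_in V ip ?M (\<lambda>t. deriv \<phi> t *\<^sub>R w t) I"
    "has_bochner_integral_in V ip ?M (\<lambda>t. \<phi> t *\<^sub>R w' t) (- I)"
    unfolding has_weak_time_derivative_def by blast
  have "I \<in> V" using I(1) unfolding has_bochner_integral_in_def by blast
  then show ?thesis
    unfolding C[OF m(1) w I(1)] C[OF m(2) w' I(2)] by (simp add: ip_minus_left x)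
qed

lemma weak_time_derivative_diff:
  assumes "has_weak_time_derivative V ip T w w'" "has_weak_time_derivative V ip T z z'"
  shows "has_weak_time_derivative V ip T (\<lambda>t. w t - z t) (\<lambda>t. w' t - z' t)"
  unfolding has_weak_time_derivative_def
proof (intro allI impI)
  fix \<phi> assume \<phi>: "test_function {0<..<T} \<phi>"
  have lm: "{0..T} \<in> lmeasurable" by simp
  obtain I where I: "has_bochner_integral_in V ip (lebesgue_on {0..T}) (\<lambda>t. deriv \<phi> t *\<^sub>R w t) I"
    "has_bochner_integral_in V ip (lebesgue_on {0..T}) (\<lambda>t. \<phi> t *\<^sub>R w' t) (- I)"
    using assms(1) \<phi> unfolding has_weak_time_derivative_def by blast
  obtain J where J: "has_bochner_integral_in V ip (lebesgue_on {0..T}) (\<lambda>t. deriv \<phi> t *\<^sub>R z t) J"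
    "has_bochner_integral_in V ip (lebesgue_on {0..T}) (\<lambda>t. \<phi> t *\<^sub>R z' t) (- J)"
    using assms(2) \<phi> unfolding has_weak_time_derivative_def by blast
  have "- I - - J = - (I - J)" by simp
  then show "\<exists>K. has_bochner_integral_in V ip (lebesgue_on {0..T}) (\<lambda>t. deriv \<phi> t *\<^sub>R (w t - z t)) K
      \<and> has_bochner_integral_in V ip (lebesgue_on {0..T}) (\<lambda>t. \<phi> t *\<^sub>R (w' t - z' t)) (- K)"
    using has_bochner_integral_in_diff[OF lm I(1) J(1)] has_bochner_integral_in_diff[OF lm I(2) J(2)]
    unfolding scaleR_diff_right by (intro exI[of _ "I - J"]) simp
qed

text \<open>The exceptional null set depends on \<open>x\<close>, so only countably many
  \<open>x\<close> can be treated at once. The values of the approximating simple functions form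
  such a countable set, and at almost every time they approach \<open>z t\<close>, which gives
  \<open>ip (z t) (z t) = 0\<close>.\<close>

lemma AE_null_of_ip:
  assumes z: "strongly_measurable V ip M z"
    and null: "\<And>x. x \<in> V \<Longrightarrow> AE t in M. ip (z t) x = 0"
  shows "AE t in M. sn (z t) = 0"
proof -
  obtain s where s: "\<And>k::nat. simple_into V M (s k)" "AE t in M. (\<lambda>k. sn (s k t - z t)) \<longlonglongrightarrow> 0"
    using strongly_measurableE[OF z] by blast
  let ?X = "\<Union>k. s k ` space M"
  have "countable ?X"
    using simple_intoD(1)[OF s(1)] by (intro countable_UN) (auto simp: simple_function_def countable_finite)
  moreover have "?X \<subseteq> V" using simple_intoD(2)[OF s(1)] by blast
  then have "AE t in M. ip (z t) x = 0" if "x \<in> ?X" for x using null that by blast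
  ultimately have "AE t in M. \<forall>x\<in>?X. ip (z t) x = 0" by (subst AE_ball_countable) blast+
  with s(2) strongly_measurable_AE[OF z] AE_space show ?thesis
  proof eventually_elim
    case (elim t)
    have V: "s k t \<in> V" for k by (rule simple_intoD(2)[OF s(1) elim(3)])
    have "sn (z t - z t) = 0" using sn_scaleR[of 0 0] V_zero by simp
    then have "(\<lambda>k. ip (z t) (s k t)) \<longlonglongrightarrow> ip (z t) (z t)"
      by (intro ip_tendsto V elim) simp_all
    moreover have "ip (z t) (s k t) = 0" for k using elim(3,4) by blast
    ultimately have "ip (z t) (z t) = 0" by (simp add: LIMSEQ_const_iff)
    then show ?case by (simp add: seminorm_def)
  qed
qed

text \<open>For each fixed \<open>x\<close> the scalar component of the difference is annihilated by
  all test functions on the open interval; passing through countably many \<open>x\<close> removes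
  the dependence of the null set on \<open>x\<close>.\<close>

lemma weak_time_derivative_unique:
  assumes w: "w \<in> L2_time V ip T"
    and w': "w' \<in> L2_time V ip T" "has_weak_time_derivative V ip T w w'"
    and w'': "w'' \<in> L2_time V ip T" "has_weak_time_derivative V ip T w w''"
  shows "AE t in lebesgue_on {0..T}. sn (w' t - w'' t) = 0"
proof (rule AE_null_of_ip)
  let ?M = "lebesgue_on {0..T}"
  note d = L2_time_diff[OF w'(1) w''(1)]
  show "strongly_measurable V ip ?M (\<lambda>t. w' t - w'' t)" by (rule L2_timeD(1)[OF d])
  fix x assume x: "x \<in> V"
  note int = L2_time_ip_integrable[OF d L2_time_const[OF x]]
  show "AE t in ?M. ip (w' t - w'' t) x = 0"
  proof (rule fundamental_lemma_of_variations[of "{0<..<T}", OF _ _ _ int])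
    have "{0..T} - {0<..<T} \<subseteq> {0, T}" by auto
    then show "negligible ({0..T} - {0<..<T})" by (rule negligible_subset[rotated]) simp
    fix \<phi> assume \<phi>: "test_function {0<..<T} \<phi>"
    have "C_infinity \<phi>" using \<phi> by (simp only: test_function_def)
    note cont = C_infinity_continuous[OF this]
    note X = L2_time_const[OF x, of T]
    have eq: "(\<integral>t. \<phi> t * ip (w' t) x \<partial>?M) = (\<integral>t. \<phi> t * ip (w'' t) x \<partial>?M)"
      using weak_time_derivative_ip[OF L2_timeD(1)[OF w] L2_timeD(1)[OF w'(1)] w'(2) \<phi> x]
        weak_time_derivative_ip[OF L2_timeD(1)[OF w] L2_timeD(1)[OF w''(1)] w''(2) \<phi> x] by linarith
    have i: "integrable ?M (\<lambda>t. \<phi> t * ip (w' t) x)" "integrable ?M (\<lambda>t. \<phi> t * ip (w'' t) x)"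
      by (rule integrable_continuous_mult[OF cont] L2_time_ip_integrable[OF w'(1) X] L2_time_ip_integrable[OF w''(1) X])+
    have "(\<integral>t. \<phi> t * ip (w' t - w'' t) x \<partial>?M) = (\<integral>t. \<phi> t * ip (w' t) x - \<phi> t * ip (w'' t) x \<partial>?M)"
    proof (rule integral_cong_AE)
      show "AE t in ?M. \<phi> t * ip (w' t - w'' t) x = \<phi> t * ip (w' t) x - \<phi> t * ip (w'' t) x"
        using L2_time_AE[OF w'(1)] L2_time_AE[OF w''(1)]
        by eventually_elim (simp add: ip_diff_left x right_diff_distrib)
      show "(\<lambda>t. \<phi> t * ip (w' t - w'' t) x) \<in> borel_measurable ?M"
        by (rule borel_measurable_integrable[OF integrable_continuous_mult[OF cont int]])
      show "(\<lambda>t. \<phi> t * ip (w' t) x - \<phi> t * ip (w'' t) x) \<in> borel_measurable ?M"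
        using i by (intro borel_measurable_diff borel_measurable_integrable)
    qed
    also have "\<dots> = 0" using i eq by simp
    finally show "(\<integral>t. \<phi> t * ip (w' t - w'' t) x \<partial>?M) = 0" .
  qed simp_all
qed

lemma time_derivative_props:
  assumes "w \<in> H1_time V ip T"
  shows "w \<in> L2_time V ip T" "time_derivative V ip T w \<in> L2_time V ip T"
    "has_weak_time_derivative V ip T w (time_derivative V ip T w)"
proof -
  from assms have "\<exists>w'. w' \<in> L2_time V ip T \<and> has_weak_time_derivative V ip T w w'"
    unfolding H1_time_def by blast
  from someI_ex[OF this] show "time_derivative V ip T w \<in> L2_time V ip T"
    "has_weak_time_derivative V ip T w (time_derivative V ip T w)"
    unfolding time_derivative_def by blast+
  show "w \<in> L2_time V ip T" using assms unfolding H1_time_def by blast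
qed

text \<open>\<open>time_derivative\<close> is a choice, so it commutes with differences only up to
  null vectors and almost everywhere. The norm of the difference of two solutions is evaluated
  through this.\<close>

lemma time_derivative_diff:
  assumes w: "w \<in> H1_time V ip T" and z: "z \<in> H1_time V ip T"
  shows "(\<lambda>t. w t - z t) \<in> H1_time V ip T"
    and "AE t in lebesgue_on {0..T}. sn (time_derivative V ip T (\<lambda>t. w t - z t) t
        - (time_derivative V ip T w t - time_derivative V ip T z t)) = 0"
proof -
  note W = time_derivative_props[OF w] and Z = time_derivative_props[OF z]
  note D = L2_time_diff[OF W(1) Z(1)] L2_time_diff[OF W(2) Z(2)] weak_time_derivative_diff[OF W(3) Z(3)]
  show H: "(\<lambda>t. w t - z t) \<in> H1_time V ip T" unfolding H1_time_def using D by blast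
  show "AE t in lebesgue_on {0..T}. sn (time_derivative V ip T (\<lambda>t. w t - z t) t
        - (time_derivative V ip T w t - time_derivative V ip T z t)) = 0"
    by (rule weak_time_derivative_unique[OF D(1) time_derivative_props(2,3)[OF H] D(2,3)])
qed

end

section \<open>Continuous representatives and the energy identity\<close>

context semi_inner_space
begin

lemma continuous_on_ip:
  assumes cV: "\<And>t. t \<in> {0..T} \<Longrightarrow> c t \<in> V"
    and cc: "\<And>t. t \<in> {0..T} \<Longrightarrow> ((\<lambda>s. sn (c s - c t)) \<longlongrightarrow> 0) (at t within {0..T})"
    and x: "x \<in> V"
  shows "continuous_on {0..T} (\<lambda>t. ip (c t) x)"
  unfolding continuous_on_def
proof
  fix t assume t: "t \<in> {0..T}"
  have lim: "((\<lambda>s. sn (c s - c t) * sn x) \<longlongrightarrow> 0) (at t within {0..T})"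
    using tendsto_mult[OF cc[OF t] tendsto_const, of "sn x"] by simp
  have "((\<lambda>s. ip (c s) x - ip (c t) x) \<longlongrightarrow> 0) (at t within {0..T})"
  proof (rule Lim_null_comparison[OF _ lim])
    show "\<forall>\<^sub>F s in at t within {0..T}. norm (ip (c s) x - ip (c t) x) \<le> sn (c s - c t) * sn x"
      unfolding eventually_at_topological
    proof (intro exI[of _ UNIV] conjI ballI impI)
      fix s assume "s \<in> {0..T}"
      then have "\<bar>ip (c s - c t) x\<bar> \<le> sn (c s - c t) * sn x"
        by (intro Cauchy_Schwarz V_diff cV t x)
      then show "norm (ip (c s) x - ip (c t) x) \<le> sn (c s - c t) * sn x"
        by (simp only: ip_diff_left[OF cV[OF \<open>s \<in> {0..T}\<close>] cV[OF t] x] real_norm_def)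
    qed simp_all
  qed
  then show "((\<lambda>s. ip (c s) x) \<longlongrightarrow> ip (c t) x) (at t within {0..T})" by (rule LIM_zero_cancel)
qed

end

text \<open>\<open>c\<close> is the continuous representative of \<open>w\<close>, for which values
  at single times make sense, while \<open>w\<close> and \<open>w'\<close> matter only almost
  everywhere. It is used with the difference of two solutions in the role of
  \<open>w\<close>.\<close>

locale time_representative = semi_inner_space V ip
  for V :: "'h::real_vector set" and ip +
  fixes T :: real and w w' c :: "real \<Rightarrow> 'h"
  assumes w: "w \<in> L2_time V ip T" and w': "w' \<in> L2_time V ip T"
    and weak: "has_weak_time_derivative V ip T w w'"
    and cV: "t \<in> {0..T} \<Longrightarrow> c t \<in> V"
    and cc: "t \<in> {0..T} \<Longrightarrow> ((\<lambda>s. sn (c s - c t)) \<longlongrightarrow> 0) (at t within {0..T})"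
    and cw: "AE t in lebesgue_on {0..T}. sn (c t - w t) = 0"
begin

text \<open>The fundamental theorem of calculus for the continuous scalar function
  \<open>ip (c t) x\<close>. Its weak derivative is \<open>ip (w' t) x\<close>, because
  \<open>c\<close> and \<open>w\<close> differ by null vectors almost everywhere.\<close>

lemma increment_ip:
  assumes x: "x \<in> V" and st: "0 \<le> s" "s \<le> t" "t \<le> T"
  shows "ip (c t - c s) x = (\<integral>r. indicator {s<..t} r * ip (w' r) x \<partial>lebesgue_on {0..T})"
proof -
  let ?M = "lebesgue_on {0..T}"
  have V: "c s \<in> V" "c t \<in> V" using st by (auto intro: cV)
  note X = L2_time_const[OF x, of T]
  have g: "continuous_on {0..T} (\<lambda>t. ip (c t) x)" by (rule continuous_on_ip[OF cV cc x])
  have "ip (c t) x - ip (c s) x = (\<integral>r. indicator {s<..t} r * ip (w' r) x \<partial>?M)"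
  proof (rule weak_derivative_FTC[OF g L2_time_ip_integrable[OF w' X] _ st])
    fix \<phi> assume \<phi>: "test_function {0<..<T} \<phi>"
    have s: "C_infinity \<phi>" using \<phi> by (simp only: test_function_def)
    have "deriv \<phi> = (\<lambda>t. frechet_derivative \<phi> (at t) 1)" by (rule ext) (rule C_infinity_deriv[OF s])
    then have cd: "continuous_on UNIV (deriv \<phi>)"
      using C_infinity_continuous_derivative[OF s, of 1] by simp
    have "(\<integral>r. deriv \<phi> r * ip (c r) x \<partial>?M) = (\<integral>r. deriv \<phi> r * ip (w r) x \<partial>?M)"
    proof (rule integral_cong_AE)
      show "(\<lambda>r. deriv \<phi> r * ip (c r) x) \<in> borel_measurable ?M"
        by (rule borel_measurable_integrable[OF integrable_continuous_mult[OF cd continuous_imp_integrable_real[OF g]]])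
      show "(\<lambda>r. deriv \<phi> r * ip (w r) x) \<in> borel_measurable ?M"
        by (rule borel_measurable_integrable[OF integrable_continuous_mult[OF cd L2_time_ip_integrable[OF w X]]])
      show "AE r in ?M. deriv \<phi> r * ip (c r) x = deriv \<phi> r * ip (w r) x"
        using L2_time_AE[OF w] cw AE_space
      proof eventually_elim
        case (elim r)
        have "c r \<in> V" by (rule cV) (use elim(3) in simp)
        from ip_null_left[OF this elim(1) x elim(2)] show ?case by (simp only:)
      qed
    qed
    then show "(\<integral>r. deriv \<phi> r * ip (c r) x \<partial>?M) = - (\<integral>r. \<phi> r * ip (w' r) x \<partial>?M)"
      using weak_time_derivative_ip[OF L2_timeD(1)[OF w] L2_timeD(1)[OF w'] weak \<phi> x] by (simp only:)
  qed
  then show ?thesis by (simp only: ip_diff_left V x)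
qed

text \<open>Test the increment with itself, apply Cauchy-Schwarz under the integral, and divide by
  the seminorm of the increment.\<close>

lemma increment_sn:
  assumes st: "0 \<le> s" "s \<le> t" "t \<le> T"
  shows "sn (c t - c s) \<le> (\<integral>r. indicator {s<..t} r * sn (w' r) \<partial>lebesgue_on {0..T})"
proof -
  let ?M = "lebesgue_on {0..T}" and ?x = "c t - c s"
  have x: "?x \<in> V" using st by (intro V_diff cV) auto
  note i = integrable_lebesgue_on_Ioc[OF _ st(1,3)]
  have "(sn ?x)\<^sup>2 = (\<integral>r. indicator {s<..t} r * ip (w' r) ?x \<partial>?M)"
    unfolding sn_sq[OF x] by (rule increment_ip[OF x st])
  also have "\<dots> \<le> (\<integral>r. indicator {s<..t} r * sn (w' r) * sn ?x \<partial>?M)"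
  proof (rule integral_mono_AE)
    show "integrable ?M (\<lambda>r. indicator {s<..t} r * ip (w' r) ?x)"
      by (rule i[OF L2_time_ip_integrable[OF w' L2_time_const[OF x]]])
    show "integrable ?M (\<lambda>r. indicator {s<..t} r * sn (w' r) * sn ?x)"
      by (rule integrable_mult_left) (rule i[OF L2_time_sn_integrable[OF w']])
    show "AE r in ?M. indicator {s<..t} r * ip (w' r) ?x \<le> indicator {s<..t} r * sn (w' r) * sn ?x"
      using L2_time_AE[OF w']
    proof eventually_elim
      case (elim r)
      have "ip (w' r) ?x \<le> sn (w' r) * sn ?x"
        using Cauchy_Schwarz[OF elim x] by linarith
      then show ?case unfolding mult.assoc by (rule mult_left_mono) simp
    qed
  qed
  also have "\<dots> = (\<integral>r. indicator {s<..t} r * sn (w' r) \<partial>?M) * sn ?x" by simp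
  finally have sq: "sn ?x * sn ?x \<le> (\<integral>r. indicator {s<..t} r * sn (w' r) \<partial>?M) * sn ?x"
    by (simp only: power2_eq_square)
  show ?thesis
  proof (cases "sn ?x = 0")
    case True
    have "0 \<le> (\<integral>r. indicator {s<..t} r * sn (w' r) \<partial>?M)"
    proof (rule integral_nonneg_AE)
      show "AE r in ?M. 0 \<le> indicator {s<..t} r * sn (w' r)"
        using L2_time_AE[OF w'] by eventually_elim (simp add: sn_nonneg)
    qed
    then show ?thesis using True by simp
  next
    case False
    then have "0 < sn ?x" using sn_nonneg[OF x] by linarith
    with sq show ?thesis by (rule mult_right_le_imp_le)
  qed
qed

text \<open>\<open>W\<close> is the variation of the path and \<open>D\<close> is the energy minus
  the claimed integral. Every increment of \<open>D\<close> is bounded by a multiple of the squared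
  increment of \<open>W\<close>, so \<open>D\<close> is constant; this replaces the product
  rule.\<close>

theorem energy_identity:
  assumes PV: "\<And>x. x \<in> V \<Longrightarrow> P x \<in> V" and P: "linear P"
    and Psym: "\<And>x y. x \<in> V \<Longrightarrow> y \<in> V \<Longrightarrow> ip (P x) y = ip x (P y)"
    and K: "\<And>x. x \<in> V \<Longrightarrow> sn (P x) \<le> K * sn x" "0 \<le> K"
    and \<tau>: "\<tau> \<in> {0..T}"
  shows "ip (P (c \<tau>)) (c \<tau>) - ip (P (c 0)) (c 0)
    = 2 * (\<integral>r. indicator {0<..\<tau>} r * ip (w' r) (P (w r)) \<partial>lebesgue_on {0..T})"
proof -
  let ?M = "lebesgue_on {0..T}"
  define W where "W t = (\<integral>r. indicator {0<..t} r * sn (w' r) \<partial>?M)" for t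
  define D where "D t = ip (P (c t)) (c t) - 2 * (\<integral>r. indicator {0<..t} r * ip (w' r) (P (w r)) \<partial>?M)" for t
  have Pw: "(\<lambda>r. P (w r)) \<in> L2_time V ip T"
  proof (rule L2_time_Lipschitz[where L = P and K = K, OF semi_inner_space_axioms semi_inner_space_axioms w PV _ linear_0[OF P]])
    fix x y assume "x \<in> V" "y \<in> V"
    then show "sn (P x - P y) \<le> K * sn (x - y)"
      using K(1)[OF V_diff] by (simp add: linear_diff[OF P])
  qed
  note iw = L2_time_sn_integrable[OF w'] and iP = L2_time_ip_integrable[OF w' Pw]
  have W_diff: "W t - W s = (\<integral>r. indicator {s<..t} r * sn (w' r) \<partial>?M)"
    if "0 \<le> s" "s \<le> t" "t \<le> T" for s t
    unfolding W_def by (rule Ioc_integral_diff[OF iw that])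
  have W_mono: "W s \<le> W t" if "0 \<le> s" "s \<le> t" "t \<le> T" for s t
  proof -
    have "0 \<le> (\<integral>r. indicator {s<..t} r * sn (w' r) \<partial>?M)"
    proof (rule integral_nonneg_AE)
      show "AE r in ?M. 0 \<le> indicator {s<..t} r * sn (w' r)"
        using L2_time_AE[OF w'] by eventually_elim (simp add: sn_nonneg)
    qed
    then show ?thesis using W_diff[OF that] by linarith
  qed
  have incr: "\<bar>D t - D s\<bar> \<le> (2 * K) * (W t - W s)\<^sup>2" if st: "0 \<le> s" "s \<le> t" "t \<le> T" for s t
  proof -
    have V: "c s \<in> V" "c t \<in> V" using st by (auto intro: cV)
    note PcV = PV[OF V(1)] PV[OF V(2)]
    let ?y = "P (c t) + P (c s)"
    have y: "?y \<in> V" by (rule V_add[OF PcV(2,1)])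
    \<comment> \<open>Symmetry of \<open>P\<close> factors the difference of the two quadratic
      values into the increment and the sum \<open>?y\<close>.\<close>
    have "ip (P (c t)) (c t) - ip (P (c s)) (c s) = ip (c t - c s) ?y"
      using Psym[OF V(1,2)] Psym[OF V(2,1)] Psym[OF V(1,1)] Psym[OF V(2,2)] ip_commute[OF V(1) PcV(2)]
      by (simp add: ip_diff_left[OF V(2,1) y] ip_add_right[OF PcV(2,1) V(1)] ip_add_right[OF PcV(2,1) V(2)])
    also have "\<dots> = (\<integral>r. indicator {s<..t} r * ip (w' r) ?y \<partial>?M)"
      by (rule increment_ip[OF y st])
    finally have q: "ip (P (c t)) (c t) - ip (P (c s)) (c s) = (\<integral>r. indicator {s<..t} r * ip (w' r) ?y \<partial>?M)" .
    note I1 = integrable_lebesgue_on_Ioc[OF L2_time_ip_integrable[OF w' L2_time_const[OF y]] st(1,3)]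
    note I2 = integrable_lebesgue_on_Ioc[OF iP st(1,3)]
    note I3 = integrable_lebesgue_on_Ioc[OF iw st(1,3)]
    have "D t - D s = (\<integral>r. indicator {s<..t} r * ip (w' r) ?y \<partial>?M)
        - 2 * (\<integral>r. indicator {s<..t} r * ip (w' r) (P (w r)) \<partial>?M)"
      using q Ioc_integral_diff[OF iP st] unfolding D_def by linarith
    also have "\<dots> = (\<integral>r. indicator {s<..t} r * ip (w' r) ?y - 2 * (indicator {s<..t} r * ip (w' r) (P (w r))) \<partial>?M)"
      using I1 I2 by simp
    finally have "\<bar>D t - D s\<bar> \<le> (\<integral>r. \<bar>indicator {s<..t} r * ip (w' r) ?y - 2 * (indicator {s<..t} r * ip (w' r) (P (w r)))\<bar> \<partial>?M)"
      using integral_norm_bound[of ?M "\<lambda>r. indicator {s<..t} r * ip (w' r) ?y - 2 * (indicator {s<..t} r * ip (w' r) (P (w r)))"]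
      by (simp only: real_norm_def)
    \<comment> \<open>For r between \<open>s\<close> and \<open>t\<close>, both \<open>c s\<close>
      and \<open>c t\<close> are within \<open>W t - W s\<close> of \<open>c r\<close>, so
      \<open>?y - 2 *\<^sub>R P (w r)\<close> has seminorm at most
      \<open>2 * K * (W t - W s)\<close>. Integrating \<open>sn (w' r)\<close> then supplies the
      second factor \<open>W t - W s\<close>.\<close>
    also have "\<dots> \<le> (\<integral>r. indicator {s<..t} r * sn (w' r) * (2 * K * (W t - W s)) \<partial>?M)"
    proof (rule integral_mono_AE)
      show "integrable ?M (\<lambda>r. \<bar>indicator {s<..t} r * ip (w' r) ?y - 2 * (indicator {s<..t} r * ip (w' r) (P (w r)))\<bar>)"
        using I1 I2 by simp
      show "integrable ?M (\<lambda>r. indicator {s<..t} r * sn (w' r) * (2 * K * (W t - W s)))"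
        by (rule integrable_mult_left) (rule I3)
      show "AE r in ?M. \<bar>indicator {s<..t} r * ip (w' r) ?y - 2 * (indicator {s<..t} r * ip (w' r) (P (w r)))\<bar>
          \<le> indicator {s<..t} r * sn (w' r) * (2 * K * (W t - W s))"
        using L2_time_AE[OF w'] L2_time_AE[OF w] cw
      proof eventually_elim
        case (elim r)
        show ?case
        proof (cases "r \<in> {s<..t}")
          case True
          then have r: "0 \<le> r" "r \<le> T" "s \<le> r" "r \<le> t" using st by auto
          have cr: "c r \<in> V" by (rule cV) (use r in simp)
          have near: "sn (P a - P (w r)) \<le> K * (W t - W s)" if a: "a \<in> V" "sn (a - c r) \<le> W t - W s" for a
          proof -
            have "sn (a - w r) \<le> sn (a - c r) + sn (c r - w r)" by (rule sn_triangle_via[OF a(1) cr elim(2)])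
            then have "sn (a - w r) \<le> W t - W s" using elim(3) a(2) by simp
            from mult_left_mono[OF this K(2)] show ?thesis
              using K(1)[OF V_diff[OF a(1) elim(2)]] by (simp add: linear_diff[OF P])
          qed
          have "sn (c t - c r) \<le> W t - W r" unfolding W_diff[OF r(1) r(4) st(3)] by (rule increment_sn[OF r(1) r(4) st(3)])
          then have 1: "sn (c t - c r) \<le> W t - W s" using W_mono[OF st(1) r(3) r(2)] by linarith
          have "sn (c r - c s) \<le> W r - W s" unfolding W_diff[OF st(1) r(3) r(2)] by (rule increment_sn[OF st(1) r(3) r(2)])
          then have 2: "sn (c s - c r) \<le> W t - W s"
            using W_mono[OF r(1) r(4) st(3)] sn_minus_commute[OF V(1) cr] by linarith
          note PwV = PV[OF elim(2)]
          have d: "P (c t) - P (w r) \<in> V" "P (c s) - P (w r) \<in> V" by (rule V_diff[OF PcV(2) PwV] V_diff[OF PcV(1) PwV])+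
          have eq: "?y - 2 *\<^sub>R P (w r) = (P (c t) - P (w r)) + (P (c s) - P (w r))"
            by (simp add: scaleR_2)
          have "ip (w' r) ?y - 2 * ip (w' r) (P (w r)) = ip (w' r) (?y - 2 *\<^sub>R P (w r))"
            by (simp only: ip_diff_right[OF y V_scaleR[OF PwV] elim(1)] ip_scaleR_right[OF PwV elim(1)])
          also have "\<bar>\<dots>\<bar> \<le> sn (w' r) * sn (?y - 2 *\<^sub>R P (w r))"
            by (rule Cauchy_Schwarz[OF elim(1) V_diff[OF y V_scaleR[OF PwV]]])
          also have "\<dots> \<le> sn (w' r) * (2 * K * (W t - W s))"
          proof (rule mult_left_mono[OF _ sn_nonneg[OF elim(1)]])
            show "sn (?y - 2 *\<^sub>R P (w r)) \<le> 2 * K * (W t - W s)"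
              unfolding eq using sn_triangle[OF d] near[OF V(2) 1] near[OF V(1) 2] by linarith
          qed
          finally show ?thesis using True by simp
        qed simp
      qed
    qed
    also have "\<dots> = (2 * K) * (W t - W s)\<^sup>2"
      unfolding W_diff[OF st] by (simp add: power2_eq_square)
    finally show ?thesis .
  qed
  have incr2: "\<bar>D t - D s\<bar> \<le> (2 * K) * (W t - W s)\<^sup>2" if "s \<in> {0..\<tau>}" "t \<in> {0..\<tau>}" for s t
  proof (cases "s \<le> t")
    case True
    show ?thesis by (rule incr) (use that True \<tau> in auto)
  next
    case False
    have "\<bar>D s - D t\<bar> \<le> (2 * K) * (W s - W t)\<^sup>2" by (rule incr) (use that False \<tau> in auto)
    then show ?thesis by (simp only: abs_minus_commute power2_commute)
  qed
  have "D \<tau> = D 0"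
  proof (rule constant_of_quadratic_modulus[OF _ _ _ incr2])
    show "continuous_on {0..\<tau>} W"
      unfolding W_def by (rule continuous_on_subset[OF continuous_on_Ioc_integral[OF iw]]) (use \<tau> in auto)
    show "W 0 \<le> W \<tau>" by (rule W_mono) (use \<tau> in auto)
  qed (use \<tau> in auto)
  then show ?thesis unfolding D_def by simp
qed

end

section \<open>Weak convergence in time\<close>

text \<open>An interchange of limits: the error \<open>\<delta> k\<close> is uniform in
  \<open>n\<close>, so \<open>k\<close> can be fixed before \<open>n\<close> is sent to
  infinity.\<close>

lemma null_sequence_uniform_approx:
  fixes x :: "nat \<Rightarrow> real"
  assumes a: "\<And>k. (\<lambda>n. a k n) \<longlonglongrightarrow> (0::real)" and \<delta>: "\<delta> \<longlonglongrightarrow> (0::real)"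
    and le: "\<And>k n. \<bar>x n - a k n\<bar> \<le> \<delta> k"
  shows "x \<longlonglongrightarrow> 0"
proof (rule LIMSEQ_I)
  fix e :: real assume e: "0 < e"
  then have e2: "0 < e / 2" by simp
  from order_tendstoD(2)[OF \<delta> e2] obtain k where k: "\<delta> k < e / 2"
    by (meson eventually_sequentially order_refl)
  from LIMSEQ_D[OF a[of k] e2] obtain N where N: "\<And>n. N \<le> n \<Longrightarrow> norm (a k n - 0) < e / 2" by blast
  have "norm (x n - 0) < e" if "N \<le> n" for n
    using N[OF that] k le[of n k] unfolding real_norm_def by linarith
  then show "\<exists>N. \<forall>n\<ge>N. norm (x n - 0) < e" by blast
qed

text \<open>Cauchy-Schwarz against an indicator. The bound depends on \<open>h\<close> only through
  \<open>R\<close>, which makes it uniform along a bounded sequence.\<close>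

lemma Lsq_indicator_bound:
  fixes h :: "'x \<Rightarrow> real"
  assumes M: "finite_measure M" and A: "A \<in> sets M" and h: "h \<in> Lsq M" and R: "Lsq_inner M h h \<le> R"
  shows "\<bar>\<integral>t. indicator A t * h t \<partial>M\<bar> \<le> sqrt (measure M A) * sqrt R"
proof -
  interpret finite_measure M by fact
  interpret L: semi_inner_space "Lsq M" "Lsq_inner M :: ('x \<Rightarrow> real) \<Rightarrow> _" by (rule semi_inner_space_Lsq)
  have ind: "indicat_real A \<in> Lsq M"
  proof (rule Lsq_dominated)
    show "integrable M (\<lambda>_. 1::real)" by simp
    show "indicat_real A \<in> borel_measurable M" using A by simp
  qed (simp add: indicator_def)
  have "\<bar>Lsq_inner M (indicator A) h\<bar> \<le> sqrt (Lsq_inner M (indicator A) (indicat_real A)) * sqrt (Lsq_inner M h h)"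
    using L.Cauchy_Schwarz[OF ind h] by (simp only: seminorm_def)
  also have "Lsq_inner M (indicator A) (indicat_real A) = measure M A"
  proof -
    have "Lsq_inner M (indicator A) (indicat_real A) = (\<integral>t. indicat_real A t \<partial>M)"
      unfolding Lsq_inner_def by (rule Bochner_Integration.integral_cong) (auto simp: indicator_def)
    also have "\<dots> = measure M A" using A by (simp add: Int_absorb2 sets.sets_into_space)
    finally show ?thesis .
  qed
  also have "sqrt (measure M A) * sqrt (Lsq_inner M h h) \<le> sqrt (measure M A) * sqrt R"
    using R by (intro mult_left_mono) simp_all
  finally show ?thesis by (simp only: Lsq_inner_def inner_real_def)
qed

text \<open>Half-open intervals form an intersection-stable generator of the Borel sets. Complements
  are handled by the integral over all of [0, T]; disjoint unions need the uniform bound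
  \<open>R\<close>, since convergence on each piece alone would allow mass to escape into ever later
  pieces.\<close>

lemma weak_null_indicator:
  fixes h :: "nat \<Rightarrow> real \<Rightarrow> real"
  assumes T: "0 \<le> T" and h: "\<And>n. h n \<in> Lsq (lebesgue_on {0..T})"
    and R: "\<And>n. Lsq_inner (lebesgue_on {0..T}) (h n) (h n) \<le> R"
    and null: "\<And>s t. 0 \<le> s \<Longrightarrow> s \<le> t \<Longrightarrow> t \<le> T \<Longrightarrow>
      (\<lambda>n. \<integral>r. indicator {s<..t} r * h n r \<partial>lebesgue_on {0..T}) \<longlonglongrightarrow> 0"
    and A: "A \<in> sets (lebesgue_on {0..T})"
  shows "(\<lambda>n. \<integral>r. indicator A r * h n r \<partial>lebesgue_on {0..T}) \<longlonglongrightarrow> 0"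
proof -
  let ?M = "lebesgue_on {0..T}"
  interpret finite_measure ?M by (rule finite_measure_lebesgue_on) simp
  note hi = integrable_Lsq[OF h]
  have hm: "h n \<in> borel_measurable ?M" for n by (rule LsqD(1)[OF h])
  have int: "(\<lambda>r. indicator B r * h n r) \<in> borel_measurable ?M" "integrable ?M (\<lambda>r. indicator B r * h n r)"
    if "B \<in> sets borel" for B n
  proof -
    have "indicat_real B \<in> borel_measurable ?M"
      using that by (simp add: measurable_completion measurable_restrict_space1)
    then show m: "(\<lambda>r. indicator B r * h n r) \<in> borel_measurable ?M" using hm by (rule borel_measurable_times)
    show "integrable ?M (\<lambda>r. indicator B r * h n r)"
      by (rule Bochner_Integration.integrable_bound[OF hi[of n] m]) (auto intro!: AE_I2 simp: indicator_def)
  qed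
  have AEcong: "(\<integral>r. indicator B r * h n r \<partial>?M) = (\<integral>r. indicator C r * h n r \<partial>?M)"
    if B: "(\<lambda>r. indicator B r * h n r) \<in> borel_measurable ?M" and C: "(\<lambda>r. indicator C r * h n r) \<in> borel_measurable ?M"
      and eq: "AE r in ?M. indicator B r = (indicator C r :: real)" for B C n
    by (rule integral_cong_AE[OF B C]) (use eq in \<open>auto elim!: eventually_mono\<close>)
  have not0: "AE r in ?M. r \<notin> {0}" by (rule AE_lebesgue_on_not_in) auto
  have borel: "(\<lambda>n. \<integral>r. indicator B r * h n r \<partial>?M) \<longlonglongrightarrow> 0" if B: "B \<in> sets borel" for B
  proof -
    have total: "(\<lambda>n. \<integral>r. h n r \<partial>?M) \<longlonglongrightarrow> 0"
    proof -
      have "AE r in ?M. indicator {0<..T} r = (indicator UNIV r :: real)"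
        using not0 AE_space by eventually_elim (auto simp: indicator_def)
      from AEcong[OF int(1) int(1) this] have "(\<integral>r. indicator {0<..T} r * h n r \<partial>?M) = (\<integral>r. h n r \<partial>?M)" for n
        by simp
      with null[of 0 T] T show ?thesis by simp
    qed
    have "Int_stable (range (\<lambda>(a, b). {a<..b::real}))"
      unfolding Int_stable_def
    proof (intro ballI)
      fix A B assume "A \<in> range (\<lambda>(a, b). {a<..b::real})" "B \<in> range (\<lambda>(a, b). {a<..b::real})"
      then obtain a b c d where "A = {a<..b}" "B = {c<..d}" by auto
      then have "A \<inter> B = (\<lambda>(a, b). {a<..b}) (max a c, min b d)" by auto
      then show "A \<inter> B \<in> range (\<lambda>(a, b). {a<..b})" by (rule range_eqI)
    qed
    moreover have "range (\<lambda>(a, b). {a<..b::real}) \<subseteq> Pow UNIV" by auto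
    moreover have "B \<in> sigma_sets UNIV (range (\<lambda>(a, b). {a<..b::real}))"
      using B unfolding borel_sigma_sets_Ioc by simp
    ultimately show ?thesis
    proof (induction rule: sigma_sets_induct_disjoint)
      case (basic A)
      then obtain a b where ab: "A = {a<..b}" by auto
      \<comment> \<open>The interval is clipped to [0, T], up to the null point 0; the maximum with
        \<open>s\<close> in \<open>t\<close> yields an empty interval when nothing of (a, b] is
        left.\<close>
      define s where "s = max 0 (min a T)"
      define t where "t = max s (min b T)"
      have st: "0 \<le> s" "s \<le> t" "t \<le> T" using T by (auto simp: s_def t_def)
      have "AE r in ?M. indicator {s<..t} r = (indicator A r :: real)"
        using not0 AE_space by eventually_elim (auto simp: indicator_def ab s_def t_def)
      from AEcong[OF int(1) int(1) this] null[OF st] show ?case by (simp add: ab)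
    next
      case empty show ?case by simp
    next
      case (compl A)
      then have A: "A \<in> sets borel" by (simp add: borel_sigma_sets_Ioc)
      have "(\<integral>r. indicator (UNIV - A) r * h n r \<partial>?M) = (\<integral>r. h n r \<partial>?M) - (\<integral>r. indicator A r * h n r \<partial>?M)" for n
      proof -
        have "indicator (UNIV - A) r * h n r = h n r - indicator A r * h n r" for r by (auto simp: indicator_def)
        then show ?thesis using hi int(2)[OF A] by simp
      qed
      then show ?case using tendsto_diff[OF total compl.IH] by simp
    next
      case (union F)
      then have F: "F i \<in> sets borel" for i by (auto simp: borel_sigma_sets_Ioc)
      \<comment> \<open>What remains of the union after \<open>k\<close> sets. These remainders
        decrease to the empty set, so their measure inside [0, T] tends to 0 and bounds the error
        uniformly in \<open>n\<close>.\<close>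
      define G where "G k = (\<Union>i. F i) - (\<Union>i<k. F i)" for k :: nat
      have Gb: "G k \<in> sets borel" for k unfolding G_def using F by auto
      have GM: "G k \<inter> {0..T} \<in> sets ?M" for k using Gb[of k] by (simp add: sets_restrict_space_iff)
      have "(\<lambda>k. measure ?M (G k \<inter> {0..T})) \<longlonglongrightarrow> measure ?M (\<Inter>k. G k \<inter> {0..T})"
        by (rule finite_Lim_measure_decseq) (use GM in \<open>auto simp: decseq_def G_def\<close>)
      moreover have "(\<Inter>k. G k \<inter> {0..T}) = {}"
      proof -
        have "x \<notin> (\<Inter>k. G k)" for x
        proof
          assume x: "x \<in> (\<Inter>k. G k)"
          then have "x \<in> G 0" by blast
          then obtain i where "x \<in> F i" unfolding G_def by blast
          moreover have "x \<in> G (Suc i)" using x by blast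
          ultimately show False unfolding G_def by blast
        qed
        then show ?thesis by blast
      qed
      ultimately have mG: "(\<lambda>k. measure ?M (G k \<inter> {0..T})) \<longlonglongrightarrow> 0" by simp
      have lim: "(\<lambda>k. sqrt (measure ?M (G k \<inter> {0..T})) * sqrt R) \<longlonglongrightarrow> 0"
        using tendsto_mult[OF tendsto_real_sqrt[OF mG] tendsto_const, of "sqrt R"] by simp
      show ?case
      proof (rule null_sequence_uniform_approx[OF _ lim])
        show "(\<lambda>n. \<Sum>i<k. \<integral>r. indicator (F i) r * h n r \<partial>?M) \<longlonglongrightarrow> 0" for k
          using tendsto_sum[of "{..<k}" "\<lambda>i n. \<integral>r. indicator (F i) r * h n r \<partial>?M" "\<lambda>_. 0"] union.IH by simp
        fix k n
        have disj: "(\<Sum>i<k. indicat_real (F i) r) = indicator (\<Union>i<k. F i) r" for r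
          by (rule indicator_UN_disjoint[symmetric])
             (use union.hyps(1) in \<open>auto intro: disjoint_family_on_mono\<close>)
        have "indicator (\<Union>i. F i) r * h n r - (\<Sum>i<k. indicator (F i) r * h n r) = indicator (G k) r * h n r" for r
          unfolding sum_distrib_right[symmetric] disj left_diff_distrib[symmetric] G_def
          by (auto simp: indicator_def)
        moreover have "(\<integral>r. indicator (\<Union>i. F i) r * h n r - (\<Sum>i<k. indicator (F i) r * h n r) \<partial>?M)
           = (\<integral>r. indicator (\<Union>i. F i) r * h n r \<partial>?M) - (\<Sum>i<k. \<integral>r. indicator (F i) r * h n r \<partial>?M)"
          unfolding Bochner_Integration.integral_sum[OF int(2)[OF F], symmetric]
        proof (rule Bochner_Integration.integral_diff)
          show "integrable ?M (\<lambda>r. indicator (\<Union>i. F i) r * h n r)" by (rule int(2)) (use F in auto)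
          show "integrable ?M (\<lambda>r. \<Sum>i<k. indicator (F i) r * h n r)"
            by (rule Bochner_Integration.integrable_sum) (rule int(2)[OF F])
        qed
        ultimately have "(\<integral>r. indicator (\<Union>i. F i) r * h n r \<partial>?M) - (\<Sum>i<k. \<integral>r. indicator (F i) r * h n r \<partial>?M)
            = (\<integral>r. indicator (G k) r * h n r \<partial>?M)" by simp
        also have "\<dots> = (\<integral>r. indicator (G k \<inter> {0..T}) r * h n r \<partial>?M)"
          by (rule Bochner_Integration.integral_cong) (auto simp: indicator_def)
        also have "\<bar>\<dots>\<bar> \<le> sqrt (measure ?M (G k \<inter> {0..T})) * sqrt R"
          by (rule Lsq_indicator_bound[OF finite_measure_axioms GM h R])
        finally show "\<bar>(\<integral>r. indicator (\<Union>i. F i) r * h n r \<partial>?M) - (\<Sum>i<k. \<integral>r. indicator (F i) r * h n r \<partial>?M)\<bar>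
            \<le> sqrt (measure ?M (G k \<inter> {0..T})) * sqrt R" .
      qed
    qed
  qed
  obtain B where B: "B \<in> sets borel" "AE x in ?M. indicator A x = (indicator B x :: real)"
    by (rule lebesgue_on_sets_borel[OF _ A]) auto
  have "(\<integral>r. indicator A r * h n r \<partial>?M) = (\<integral>r. indicator B r * h n r \<partial>?M)" for n
    by (rule AEcong[OF _ int(1)[OF B(1)] B(2)]) (use A hm in \<open>intro borel_measurable_times borel_measurable_indicator\<close>)
  then show ?thesis using borel[OF B(1)] by simp
qed

context semi_inner_space
begin

lemma L2_time_sn_Lsq: "w \<in> L2_time V ip T \<Longrightarrow> (\<lambda>t. sn (w t)) \<in> Lsq (lebesgue_on {0..T})"
  using L2_timeD(2) borel_measurable_integrable[OF L2_time_sn_integrable] by (simp add: Lsq_def)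

text \<open>Cauchy-Schwarz at each time, and once more for the real functions
  \<open>sn (w t)\<close> and \<open>sn (z t)\<close>, as the square-integrable real functions form
  a semi-inner product space themselves.\<close>

lemma L2_time_Cauchy_Schwarz:
  assumes w: "w \<in> L2_time V ip T" and z: "z \<in> L2_time V ip T"
  shows "\<bar>\<integral>t. ip (w t) (z t) \<partial>lebesgue_on {0..T}\<bar>
    \<le> sqrt (\<integral>t. (sn (w t))\<^sup>2 \<partial>lebesgue_on {0..T}) * sqrt (\<integral>t. (sn (z t))\<^sup>2 \<partial>lebesgue_on {0..T})"
proof -
  let ?M = "lebesgue_on {0..T}"
  interpret L: semi_inner_space "Lsq ?M" "Lsq_inner ?M :: (real \<Rightarrow> real) \<Rightarrow> _" by (rule semi_inner_space_Lsq)
  note W = L2_time_sn_Lsq[OF w] and Z = L2_time_sn_Lsq[OF z]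
  have "\<bar>\<integral>t. ip (w t) (z t) \<partial>?M\<bar> \<le> (\<integral>t. \<bar>ip (w t) (z t)\<bar> \<partial>?M)"
    using integral_norm_bound[of ?M "\<lambda>t. ip (w t) (z t)"] by (simp only: real_norm_def)
  also have "\<dots> \<le> Lsq_inner ?M (\<lambda>t. sn (w t)) (\<lambda>t. sn (z t))"
    unfolding Lsq_inner_def
  proof (rule integral_mono_AE)
    show "integrable ?M (\<lambda>t. \<bar>ip (w t) (z t)\<bar>)" using L2_time_ip_integrable[OF w z] by simp
    show "integrable ?M (\<lambda>t. sn (w t) \<bullet> sn (z t))" by (rule Lsq_inner_integrable[OF W Z])
    show "AE t in ?M. \<bar>ip (w t) (z t)\<bar> \<le> sn (w t) \<bullet> sn (z t)"
      using L2_time_AE[OF w] L2_time_AE[OF z] unfolding inner_real_def by eventually_elim (rule Cauchy_Schwarz)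
  qed
  also have "\<dots> \<le> sqrt (Lsq_inner ?M (\<lambda>t. sn (w t)) (\<lambda>t. sn (w t))) * sqrt (Lsq_inner ?M (\<lambda>t. sn (z t)) (\<lambda>t. sn (z t)))"
    using L.Cauchy_Schwarz[OF W Z] unfolding seminorm_def by linarith
  finally show ?thesis by (simp only: Lsq_inner_def inner_real_def power2_eq_square)
qed

text \<open>A simple function has finitely many values \<open>y\<close>. On each level set the
  pairing is \<open>ip (z n t) y\<close> against an indicator, and these scalar sequences are
  bounded in L2 by Cauchy-Schwarz.\<close>

lemma weak_null_simple:
  assumes T: "0 \<le> T" and z: "\<And>n. z n \<in> L2_time V ip T"
    and R: "\<And>n. (\<integral>t. (sn (z n t))\<^sup>2 \<partial>lebesgue_on {0..T}) \<le> R"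
    and null: "\<And>x s t. x \<in> V \<Longrightarrow> 0 \<le> s \<Longrightarrow> s \<le> t \<Longrightarrow> t \<le> T \<Longrightarrow>
      (\<lambda>n. \<integral>r. indicator {s<..t} r * ip (z n r) x \<partial>lebesgue_on {0..T}) \<longlonglongrightarrow> 0"
    and s: "simple_into V (lebesgue_on {0..T}) s"
  shows "(\<lambda>n. \<integral>t. ip (z n t) (s t) \<partial>lebesgue_on {0..T}) \<longlonglongrightarrow> 0"
proof -
  let ?M = "lebesgue_on {0..T}"
  let ?Y = "s ` space ?M" and ?A = "\<lambda>y. s -` {y} \<inter> space ?M"
  have fin: "finite ?Y" and A: "\<And>y. y \<in> ?Y \<Longrightarrow> ?A y \<in> sets ?M"
    using simple_intoD(1)[OF s] unfolding simple_function_def by blast+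
  have Y: "y \<in> V" if "y \<in> ?Y" for y using simple_intoD(2)[OF s] that by blast
  have int: "integrable ?M (\<lambda>t. ip (z n t) y)" if "y \<in> ?Y" for n y
    by (rule L2_time_ip_integrable[OF z L2_time_const[OF Y[OF that]]])
  have "(\<integral>t. ip (z n t) (s t) \<partial>?M) = (\<Sum>y\<in>?Y. \<integral>t. indicator (?A y) t * ip (z n t) y \<partial>?M)" for n
  proof -
    have "(\<integral>t. ip (z n t) (s t) \<partial>?M) = (\<integral>t. (\<Sum>y\<in>?Y. indicator (?A y) t * ip (z n t) y) \<partial>?M)"
    proof (rule Bochner_Integration.integral_cong[OF refl])
      fix t assume t: "t \<in> space ?M"
      have "(\<Sum>y\<in>?Y. indicator (?A y) t * ip (z n t) y) = (\<Sum>y\<in>?Y. if y = s t then ip (z n t) y else 0)"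
      proof (rule sum.cong[OF refl])
        fix y
        show "indicator (?A y) t * ip (z n t) y = (if y = s t then ip (z n t) y else 0)"
        proof (cases "y = s t")
          case True
          then have "t \<in> ?A y" using t by blast
          then have "indicat_real (?A y) t = 1" by (rule indicator_simps(1))
          then show ?thesis using True by simp
        next
          case False
          then have "t \<notin> ?A y" by blast
          then have "indicat_real (?A y) t = 0" by (rule indicator_simps(2))
          then show ?thesis using False by (simp only: mult_zero_left if_False)
        qed
      qed
      also have "\<dots> = ip (z n t) (s t)"
        using t unfolding sum.delta[OF fin] by (simp only: imageI if_True)
      finally show "ip (z n t) (s t) = (\<Sum>y\<in>?Y. indicator (?A y) t * ip (z n t) y)" by (rule sym)
    qed
    also have "\<dots> = (\<Sum>y\<in>?Y. \<integral>t. indicator (?A y) t * ip (z n t) y \<partial>?M)"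
    proof (rule Bochner_Integration.integral_sum)
      fix y assume "y \<in> ?Y"
      from integrable_mult_indicator[OF A[OF this] int[OF this]]
      show "integrable ?M (\<lambda>t. indicator (?A y) t * ip (z n t) y)" by (simp only: real_scaleR_def)
    qed
    finally show ?thesis .
  qed
  moreover have "(\<lambda>n. \<integral>t. indicator (?A y) t * ip (z n t) y \<partial>?M) \<longlonglongrightarrow> 0" if y: "y \<in> ?Y" for y
  proof (rule weak_null_indicator[where h = "\<lambda>n t. ip (z n t) y", OF T _ _ null[OF Y[OF y]] A[OF y]])
    fix n
    have m: "(\<lambda>t. ip (z n t) y) \<in> borel_measurable ?M"
      by (rule borel_measurable_integrable[OF int[OF y]])
    have i: "integrable ?M (\<lambda>t. (sn y)\<^sup>2 * (sn (z n t))\<^sup>2)"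
      by (rule integrable_mult_right) (rule L2_timeD(2)[OF z])
    have le: "AE t in ?M. (ip (z n t) y)\<^sup>2 \<le> (sn y)\<^sup>2 * (sn (z n t))\<^sup>2"
      using L2_time_AE[OF z[of n]]
    proof eventually_elim
      case (elim t)
      from power_mono[OF Cauchy_Schwarz[OF elim Y[OF y]] abs_ge_zero, of 2]
      show ?case unfolding power_mult_distrib power2_abs by (subst mult.commute)
    qed
    have i2: "integrable ?M (\<lambda>t. (ip (z n t) y)\<^sup>2)"
    proof (rule Bochner_Integration.integrable_bound[OF i])
      show "(\<lambda>t. (ip (z n t) y)\<^sup>2) \<in> borel_measurable ?M" using m by measurable
      show "AE t in ?M. norm ((ip (z n t) y)\<^sup>2) \<le> norm ((sn y)\<^sup>2 * (sn (z n t))\<^sup>2)"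
        using le by (rule eventually_mono) (simp only: real_norm_def abs_mult abs_power2)
    qed
    then show "(\<lambda>t. ip (z n t) y) \<in> Lsq ?M" using m by (simp add: Lsq_def)
    have "Lsq_inner ?M (\<lambda>t. ip (z n t) y) (\<lambda>t. ip (z n t) y) = (\<integral>t. (ip (z n t) y)\<^sup>2 \<partial>?M)"
      by (simp add: Lsq_inner_def power2_eq_square)
    also have "\<dots> \<le> (\<integral>t. (sn y)\<^sup>2 * (sn (z n t))\<^sup>2 \<partial>?M)" by (rule integral_mono_AE[OF i2 i le])
    also have "\<dots> \<le> (sn y)\<^sup>2 * R"
      unfolding integral_mult_right_zero by (rule mult_left_mono[OF R zero_le_power2])
    finally show "Lsq_inner ?M (\<lambda>t. ip (z n t) y) (\<lambda>t. ip (z n t) y) \<le> (sn y)\<^sup>2 * R" .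
  qed
  then have "(\<lambda>n. \<Sum>y\<in>?Y. \<integral>t. indicator (?A y) t * ip (z n t) y \<partial>?M) \<longlonglongrightarrow> (\<Sum>y\<in>?Y. 0)"
    by (rule tendsto_sum)
  ultimately show ?thesis by (simp only: sum.neutral_const)
qed

text \<open>Strong measurability only provides convergence almost everywhere. Resetting a simple
  function to 0 wherever its seminorm exceeds twice that of \<open>b\<close> creates the dominating
  function for convergence in L2.\<close>

lemma L2_time_simple_approx:
  assumes b: "b \<in> L2_time V ip T"
  obtains s where "\<And>k::nat. simple_into V (lebesgue_on {0..T}) (s k)"
    "(\<lambda>k. \<integral>t. (sn (b t - s k t))\<^sup>2 \<partial>lebesgue_on {0..T}) \<longlonglongrightarrow> 0"
    "\<And>k. s k \<in> L2_time V ip T"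
proof -
  let ?M = "lebesgue_on {0..T}"
  have S: "{0..T} \<in> sets lebesgue" by simp
  note bm = L2_timeD(1)[OF b]
  obtain r where r: "\<And>k::nat. simple_into V ?M (r k)" "AE t in ?M. (\<lambda>k. sn (r k t - b t)) \<longlonglongrightarrow> 0"
    using strongly_measurableE[OF bm] by blast
  have [measurable]: "(\<lambda>t. sn (b t)) \<in> borel_measurable ?M" by (rule strongly_measurable_sn[OF S bm])
  have [measurable]: "(\<lambda>t. sn (r k t)) \<in> borel_measurable ?M" for k
    by (rule strongly_measurable_sn[OF S strongly_measurable_simple[OF r(1)]])
  define E where "E k = {t \<in> space ?M. sn (r k t) \<le> 2 * sn (b t)}" for k
  have E: "E k \<in> sets ?M" for k unfolding E_def by measurable
  define s where "s k t = (if t \<in> E k then r k t else 0)" for k t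
  have s: "simple_into V ?M (s k)" for k
    unfolding simple_into_def
  proof
    show "simple_function ?M (s k)"
      unfolding s_def
      by (rule simple_function_If_set[OF simple_intoD(1)[OF r(1)] simple_function_const])
         (use E sets.Int_space_eq2 in blast)
    show "s k ` space ?M \<subseteq> V"
      using simple_intoD(2)[OF r(1)] V_zero unfolding s_def by auto
  qed
  have sn0: "sn 0 = 0" using sn_scaleR[of 0 0] V_zero by simp
  have snle: "sn (s k t) \<le> 2 * sn (b t)" if "t \<in> space ?M" "b t \<in> V" for k t
    using sn_nonneg[OF that(2)] that(1) sn0 by (auto simp: s_def E_def)
  \<comment> \<open>The truncated function contributes at most 2 and \<open>b\<close> itself 1 to
    the factor 3, whose square is 9.\<close>
  have bound: "(sn (b t - s k t))\<^sup>2 \<le> 9 * (sn (b t))\<^sup>2" if "t \<in> space ?M" "b t \<in> V" for k t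
  proof -
    have sV: "s k t \<in> V" by (rule simple_intoD(2)[OF s that(1)])
    have "sn (b t - s k t) \<le> 3 * sn (b t)"
      using sn_triangle_diff[OF that(2) sV] snle[OF that, of k] by linarith
    from power_mono[OF this sn_nonneg[OF V_diff[OF that(2) sV]], of 2]
    show ?thesis by (simp add: power_mult_distrib)
  qed
  have lim: "AE t in ?M. (\<lambda>k. (sn (b t - s k t))\<^sup>2) \<longlonglongrightarrow> 0"
    using r(2) L2_time_AE[OF b] AE_space
  proof eventually_elim
    case (elim t)
    have rV: "r k t \<in> V" for k by (rule simple_intoD(2)[OF r(1) elim(3)])
    show ?case
    \<comment> \<open>At a null value of \<open>b\<close> the truncation may act for every
      \<open>k\<close>, but there \<open>bound\<close> already forces the error to be 0. Elsewhere
      the factor 2 leaves room, so the truncation is eventually inactive.\<close>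
    proof (cases "sn (b t) = 0")
      case True
      have "(sn (b t - s k t))\<^sup>2 = 0" for k
        using bound[OF elim(3,2), of k] True zero_le_power2[of "sn (b t - s k t)"] by simp
      then show ?thesis by simp
    next
      case False
      then have "0 < sn (b t)" using sn_nonneg[OF elim(2)] by linarith
      from order_tendstoD(2)[OF elim(1) this]
      have ev: "\<forall>\<^sub>F k in sequentially. (sn (r k t - b t))\<^sup>2 = (sn (b t - s k t))\<^sup>2"
      proof eventually_elim
        case (elim k)
        have "sn (r k t) \<le> sn (r k t - b t) + sn (b t)"
          using sn_triangle[OF V_diff[OF rV \<open>b t \<in> V\<close>] \<open>b t \<in> V\<close>, of k] by simp
        then have "t \<in> E k" using elim \<open>t \<in> space ?M\<close> unfolding E_def by simp
        then have "s k t = r k t" by (simp add: s_def)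
        then show ?case using sn_minus_commute[OF rV \<open>b t \<in> V\<close>, of k] by simp
      qed
      have "(\<lambda>k. (sn (r k t - b t))\<^sup>2) \<longlonglongrightarrow> 0"
        by (rule null_sequence_sq[THEN iffD2]) (rule elim(1))
      from Lim_transform_eventually[OF this ev] show ?thesis .
    qed
  qed
  have sL2: "s k \<in> L2_time V ip T" for k
  proof (rule L2_time_dominated[OF strongly_measurable_simple[OF s]])
    show "integrable ?M (\<lambda>t. 4 * (sn (b t))\<^sup>2)" using L2_timeD(2)[OF b] by simp
    show "AE t in ?M. (sn (s k t))\<^sup>2 \<le> 4 * (sn (b t))\<^sup>2"
      using L2_time_AE[OF b] AE_space
    proof eventually_elim
      case (elim t)
      from power_mono[OF snle[OF elim(2,1)] sn_nonneg[OF simple_intoD(2)[OF s elim(2)]], of k 2]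
      show ?case by (simp add: power_mult_distrib)
    qed
  qed
  have "(\<lambda>k. \<integral>t. (sn (b t - s k t))\<^sup>2 \<partial>?M) \<longlonglongrightarrow> (\<integral>t. 0 \<partial>?M)"
  proof (rule integral_dominated_convergence[OF _ _ _ lim])
    show "integrable ?M (\<lambda>t. 9 * (sn (b t))\<^sup>2)" using L2_timeD(2)[OF b] by simp
    show "(\<lambda>t. (sn (b t - s k t))\<^sup>2) \<in> borel_measurable ?M" for k
      by (rule borel_measurable_integrable[OF L2_timeD(2)[OF L2_time_diff[OF b sL2]]])
    show "AE t in ?M. norm ((sn (b t - s k t))\<^sup>2) \<le> 9 * (sn (b t))\<^sup>2" for k
      using L2_time_AE[OF b] AE_space by eventually_elim (simp add: bound)
  qed simp
  then show ?thesis by (intro that[OF s _ sL2]) simp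
qed

text \<open>Simple functions are dense in L2 in time, and the bound \<open>R\<close> controls the
  replacement of \<open>b\<close> by \<open>s k\<close> uniformly in \<open>n\<close>.\<close>

lemma weak_null:
  assumes T: "0 \<le> T" and z: "\<And>n. z n \<in> L2_time V ip T"
    and R: "\<And>n. (\<integral>t. (sn (z n t))\<^sup>2 \<partial>lebesgue_on {0..T}) \<le> R"
    and null: "\<And>x s t. x \<in> V \<Longrightarrow> 0 \<le> s \<Longrightarrow> s \<le> t \<Longrightarrow> t \<le> T \<Longrightarrow>
      (\<lambda>n. \<integral>r. indicator {s<..t} r * ip (z n r) x \<partial>lebesgue_on {0..T}) \<longlonglongrightarrow> 0"
    and b: "b \<in> L2_time V ip T"
  shows "(\<lambda>n. \<integral>t. ip (z n t) (b t) \<partial>lebesgue_on {0..T}) \<longlonglongrightarrow> 0"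
proof -
  let ?M = "lebesgue_on {0..T}"
  obtain s where s: "\<And>k::nat. simple_into V ?M (s k)"
    "(\<lambda>k. \<integral>t. (sn (b t - s k t))\<^sup>2 \<partial>?M) \<longlonglongrightarrow> 0" "\<And>k. s k \<in> L2_time V ip T"
    using L2_time_simple_approx[OF b] by blast
  have lim: "(\<lambda>k. sqrt R * sqrt (\<integral>t. (sn (b t - s k t))\<^sup>2 \<partial>?M)) \<longlonglongrightarrow> 0"
    using tendsto_mult[OF tendsto_const tendsto_real_sqrt[OF s(2)], of "sqrt R"] by simp
  show ?thesis
  proof (rule null_sequence_uniform_approx[OF weak_null_simple[OF T z R null s(1)] lim])
    fix k n
    note d = L2_time_diff[OF b s(3)]
    have "(\<integral>t. ip (z n t) (b t - s k t) \<partial>?M) = (\<integral>t. ip (z n t) (b t) - ip (z n t) (s k t) \<partial>?M)"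
    proof (rule integral_cong_AE)
      show "(\<lambda>t. ip (z n t) (b t - s k t)) \<in> borel_measurable ?M"
        by (rule borel_measurable_integrable[OF L2_time_ip_integrable[OF z d]])
      show "(\<lambda>t. ip (z n t) (b t) - ip (z n t) (s k t)) \<in> borel_measurable ?M"
        by (intro borel_measurable_diff borel_measurable_integrable L2_time_ip_integrable z b s)
      show "AE t in ?M. ip (z n t) (b t - s k t) = ip (z n t) (b t) - ip (z n t) (s k t)"
        using L2_time_AE[OF z[of n]] L2_time_AE[OF b] L2_time_AE[OF s(3)[of k]]
        by eventually_elim (rule ip_diff_right)
    qed
    also have "\<dots> = (\<integral>t. ip (z n t) (b t) \<partial>?M) - (\<integral>t. ip (z n t) (s k t) \<partial>?M)"
      by (rule Bochner_Integration.integral_diff[OF L2_time_ip_integrable[OF z b] L2_time_ip_integrable[OF z s(3)]])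
    finally have "\<bar>(\<integral>t. ip (z n t) (b t) \<partial>?M) - (\<integral>t. ip (z n t) (s k t) \<partial>?M)\<bar>
        \<le> sqrt (\<integral>t. (sn (z n t))\<^sup>2 \<partial>?M) * sqrt (\<integral>t. (sn (b t - s k t))\<^sup>2 \<partial>?M)"
      using L2_time_Cauchy_Schwarz[OF z[of n] d[of k]] by (simp only:)
    also have "\<dots> \<le> sqrt R * sqrt (\<integral>t. (sn (b t - s k t))\<^sup>2 \<partial>?M)"
      by (intro mult_right_mono real_sqrt_le_mono R) simp
    finally show "\<bar>(\<integral>t. ip (z n t) (b t) \<partial>?M) - (\<integral>t. ip (z n t) (s k t) \<partial>?M)\<bar>
        \<le> sqrt R * sqrt (\<integral>t. (sn (b t - s k t))\<^sup>2 \<partial>?M)" .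
  qed
qed

end

section \<open>Convergence of Yosida approximations\<close>

context semi_inner_space
begin

lemma ip_le_half_sq:
  assumes x: "x \<in> V" and y: "y \<in> V" shows "2 * ip x y \<le> (sn x)\<^sup>2 + (sn y)\<^sup>2"
proof -
  have "2 * (sn x * sn y) \<le> (sn x)\<^sup>2 + (sn y)\<^sup>2"
    using sum_squares_bound[of "sn x" "sn y"] by (simp only: mult.assoc)
  then show ?thesis using Cauchy_Schwarz[OF x y] by linarith
qed

lemma sn_cong_null:
  assumes "x \<in> V" "y \<in> V" "sn (x - y) = 0" shows "sn x = sn y"
  using ip_null_left[OF assms(1,2,1,3)] ip_null_right[OF assms(1,2,2,3)] by (simp only: seminorm_def)

lemma has_initial_valueE:
  assumes "has_initial_value V ip T w x"
  obtains c where "\<And>t. t \<in> {0..T} \<Longrightarrow> c t \<in> V"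
    "\<And>t. t \<in> {0..T} \<Longrightarrow> ((\<lambda>s. sn (c s - c t)) \<longlongrightarrow> 0) (at t within {0..T})"
    "AE t in lebesgue_on {0..T}. sn (c t - w t) = 0" "sn (c 0 - x) = 0"
  using assms unfolding has_initial_value_def by blast

text \<open>The difference of the continuous representatives represents the difference of the
  solutions. Its value at 0 is merely a null vector, since each initial value is attained up to null
  vectors.\<close>

lemma H1_time_diff_representative:
  assumes T: "0 \<le> T" and x: "x \<in> V"
    and w: "w \<in> H1_time V ip T" "has_initial_value V ip T w x"
    and z: "z \<in> H1_time V ip T" "has_initial_value V ip T z x"
  obtains c where "time_representative V ip T (\<lambda>t. w t - z t)
      (\<lambda>t. time_derivative V ip T w t - time_derivative V ip T z t) c" "sn (c 0) = 0"
proof -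
  obtain b where b: "\<And>t. t \<in> {0..T} \<Longrightarrow> b t \<in> V"
    "\<And>t. t \<in> {0..T} \<Longrightarrow> ((\<lambda>s. sn (b s - b t)) \<longlongrightarrow> 0) (at t within {0..T})"
    "AE t in lebesgue_on {0..T}. sn (b t - w t) = 0" "sn (b 0 - x) = 0"
    by (rule has_initial_valueE[OF w(2)]) blast
  obtain c where c: "\<And>t. t \<in> {0..T} \<Longrightarrow> c t \<in> V"
    "\<And>t. t \<in> {0..T} \<Longrightarrow> ((\<lambda>s. sn (c s - c t)) \<longlongrightarrow> 0) (at t within {0..T})"
    "AE t in lebesgue_on {0..T}. sn (c t - z t) = 0" "sn (c 0 - x) = 0"
    by (rule has_initial_valueE[OF z(2)]) blast
  note W = time_derivative_props[OF w(1)] and Z = time_derivative_props[OF z(1)]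
  have "time_representative V ip T (\<lambda>t. w t - z t)
      (\<lambda>t. time_derivative V ip T w t - time_derivative V ip T z t) (\<lambda>t. b t - c t)"
  proof (unfold_locales, rule L2_time_diff[OF W(1) Z(1)], rule L2_time_diff[OF W(2) Z(2)],
      rule weak_time_derivative_diff[OF W(3) Z(3)])
    fix t assume t: "t \<in> {0..T}"
    show "b t - c t \<in> V" by (rule V_diff[OF b(1)[OF t] c(1)[OF t]])
    have lim: "((\<lambda>s. sn (b s - b t) + sn (c s - c t)) \<longlongrightarrow> 0) (at t within {0..T})"
      using tendsto_add[OF b(2)[OF t] c(2)[OF t]] by simp
    show "((\<lambda>s. sn ((b s - c s) - (b t - c t))) \<longlongrightarrow> 0) (at t within {0..T})"
    proof (rule Lim_null_comparison[OF _ lim])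
      show "\<forall>\<^sub>F s in at t within {0..T}. norm (sn ((b s - c s) - (b t - c t))) \<le> sn (b s - b t) + sn (c s - c t)"
        unfolding eventually_at_topological
      proof (intro exI[of _ UNIV] conjI ballI impI)
        fix s assume s: "s \<in> {0..T}"
        have V: "b s - b t \<in> V" "c s - c t \<in> V" by (rule V_diff b(1) c(1) s t)+
        have "0 \<le> sn ((b s - b t) - (c s - c t))" by (rule sn_nonneg[OF V_diff[OF V]])
        moreover have eq: "(b s - c s) - (b t - c t) = (b s - b t) - (c s - c t)" by simp
        ultimately show "norm (sn ((b s - c s) - (b t - c t))) \<le> sn (b s - b t) + sn (c s - c t)"
          unfolding eq real_norm_def using sn_triangle_diff[OF V] by linarith
      qed simp_all
    qed
  next
    show "AE t in lebesgue_on {0..T}. sn ((b t - c t) - (w t - z t)) = 0"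
      using b(3) c(3) L2_time_AE[OF W(1)] L2_time_AE[OF Z(1)] AE_space
    proof eventually_elim
      case (elim t)
      then have t: "t \<in> {0..T}" by simp
      have V: "b t - w t \<in> V" "c t - z t \<in> V" by (rule V_diff b(1) c(1) t elim(3,4))+
      have eq: "(b t - c t) - (w t - z t) = (b t - w t) - (c t - z t)" by simp
      show ?case
        unfolding eq using sn_triangle_diff[OF V] sn_nonneg[OF V_diff[OF V]] elim(1,2) by linarith
    qed
  qed
  moreover have "sn (b 0 - c 0) = 0"
  proof -
    have 0: "0 \<in> {0..T}" using T by simp
    show ?thesis
      using sn_triangle_via[OF b(1)[OF 0] x c(1)[OF 0]] sn_minus_commute[OF x c(1)[OF 0]]
        sn_nonneg[OF V_diff[OF b(1)[OF 0] c(1)[OF 0]]] b(4) c(4) by linarith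
  qed
  ultimately show ?thesis by (rule that)
qed

text \<open>
  Monotonicity tests the difference of the two equations with \<open>y - w\<close>, where \<open>y = wn - \<mu> an\<close> is the
  resolvent value; the remaining term \<open>\<mu> an\<close> contributes the dissipation of \<open>an - a\<close>.
\<close>

lemma yosida_difference:
  assumes A: "A \<subseteq> V \<times> V" "monotone_rel ip A" and \<mu>: "0 < \<mu>"
    and w: "(w, a) \<in> A" and wn: "(wn, an) \<in> yosida \<mu> A"
  shows "an \<in> V" "ip (a - an) (wn - w) \<le> \<mu> * (ip (a - an) a - (sn (a - an))\<^sup>2)"
proof -
  from wn obtain y where y: "(wn, y) \<in> resolvent \<mu> A" "an = (1 / \<mu>) *\<^sub>R (wn - y)"
    unfolding yosida_def by auto
  then obtain b where b: "(y, b) \<in> A" "wn = y + \<mu> *\<^sub>R b" unfolding resolvent_def by auto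
  have an: "an = b" using y(2) b(2) \<mu> by simp
  have V: "w \<in> V" "a \<in> V" "y \<in> V" "an \<in> V" using A(1) w b(1) unfolding an by auto
  then show "an \<in> V" by blast
  have d: "a - an \<in> V" "y - w \<in> V" using V V_diff by blast+
  have "0 \<le> ip (w - y) (a - an)" using A(2) w b(1) unfolding monotone_rel_def an by blast
  then have mono: "ip (a - an) (y - w) \<le> 0"
    using ip_commute[OF d] ip_minus_right[OF d(2,1)] ip_commute[OF d(1) V_minus[OF d(2)]] by simp
  have eq: "wn - w = (y - w) + \<mu> *\<^sub>R an" unfolding b(2) an by simp
  have "ip (a - an) (wn - w) = ip (a - an) (y - w) + \<mu> * ip (a - an) an"
    unfolding eq by (simp only: ip_add_right[OF d(2) V_scaleR[OF V(4)] d(1)] ip_scaleR_right[OF V(4) d(1)])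
  also have "ip (a - an) an = ip (a - an) a - (sn (a - an))\<^sup>2"
    unfolding sn_sq[OF d(1)] by (simp only: ip_diff_right[OF V(2,4) d(1)])
  finally show "ip (a - an) (wn - w) \<le> \<mu> * (ip (a - an) a - (sn (a - an))\<^sup>2)" using mono by linarith
qed

text \<open>The abstract form of the argument, with \<open>P\<close> for the inverse of
  \<open>Q\<close> and \<open>g\<close> for \<open>R f\<close>. The constants
  \<open>\<kappa>\<close> and \<open>K\<close> bound \<open>P\<close> from below and above, which
  makes the energy \<open>ip (P x) x\<close> comparable to the squared seminorm.\<close>

theorem yosida_H1_convergence:
  assumes T: "0 \<le> T" and A: "A \<subseteq> V \<times> V" "monotone_rel ip A"
    and P: "linear P" and PV: "\<And>x. x \<in> V \<Longrightarrow> P x \<in> V"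
    and Psym: "\<And>x y. x \<in> V \<Longrightarrow> y \<in> V \<Longrightarrow> ip (P x) y = ip x (P y)"
    and \<kappa>: "0 < \<kappa>" "\<And>x. x \<in> V \<Longrightarrow> \<kappa> * (sn x)\<^sup>2 \<le> ip (P x) x"
    and K: "0 \<le> K" "\<And>x. x \<in> V \<Longrightarrow> sn (P x) \<le> K * sn x"
    and g: "g \<in> L2_time V ip T" and init: "init \<in> V"
    and w: "w \<in> H1_time V ip T" "has_initial_value V ip T w init"
    and sol: "AE t in lebesgue_on {0..T}. (w t, g t - P (time_derivative V ip T w t)) \<in> A"
    and wn: "\<And>n. wn n \<in> H1_time V ip T" "\<And>n. has_initial_value V ip T (wn n) init"
    and soln: "\<And>n. AE t in lebesgue_on {0..T}. (wn n t, g t - P (time_derivative V ip T (wn n) t)) \<in> yosida (\<mu> n) A"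
    and \<mu>: "\<And>n. 0 < \<mu> n" "\<mu> \<longlonglongrightarrow> 0"
  shows "(\<lambda>n. H1_time_norm V ip T (\<lambda>t. wn n t - w t)) \<longlonglongrightarrow> 0"
proof -
  let ?M = "lebesgue_on {0..T}"
  interpret M: finite_measure ?M by (rule finite_measure_lebesgue_on) simp
  define D where "D n t = wn n t - w t" for n t
  define \<delta> where "\<delta> n t = time_derivative V ip T (wn n) t - time_derivative V ip T w t" for n t
  define p where "p n t = P (\<delta> n t)" for n t
  define a where "a t = g t - P (time_derivative V ip T w t)" for t
  note W = time_derivative_props[OF w(1)] and Wn = time_derivative_props[OF wn(1)]
  have PL2: "(\<lambda>t. P (z t)) \<in> L2_time V ip T" if "z \<in> L2_time V ip T" for z
  proof (rule L2_time_Lipschitz[where L = P and K = K, OF semi_inner_space_axioms semi_inner_space_axioms that PV _ linear_0[OF P]])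
    fix x y assume "x \<in> V" "y \<in> V"
    then show "sn (P x - P y) \<le> K * sn (x - y)"
      using K(2)[OF V_diff] by (simp add: linear_diff[OF P])
  qed
  have \<delta>L: "\<delta> n \<in> L2_time V ip T" for n unfolding \<delta>_def by (rule L2_time_diff[OF Wn(2) W(2)])
  have DL: "D n \<in> L2_time V ip T" for n unfolding D_def by (rule L2_time_diff[OF Wn(1) W(1)])
  have pL: "p n \<in> L2_time V ip T" for n unfolding p_def by (rule PL2[OF \<delta>L])
  have aL: "a \<in> L2_time V ip T" unfolding a_def by (rule L2_time_diff[OF g PL2[OF W(2)]])
  have "\<exists>c. time_representative V ip T (D n) (\<delta> n) c \<and> sn (c 0) = 0" for n
    unfolding D_def \<delta>_def by (rule H1_time_diff_representative[OF T init wn w]) blast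
  then obtain c where c: "\<And>n. time_representative V ip T (D n) (\<delta> n) (c n)" and c0: "\<And>n. sn (c n 0) = 0"
    by metis
  have cV: "c n t \<in> V" if "t \<in> {0..T}" for n t by (rule time_representative.cV[OF c that])
  \<comment> \<open>All bounds uniform in \<open>n\<close> are multiples of this number, which
    involves only \<open>g\<close> and the limit solution.\<close>
  define \<alpha> where "\<alpha> = (\<integral>t. (sn (a t))\<^sup>2 \<partial>?M)"

  have key: "AE t in ?M. ip (\<delta> n t) (P (D n t)) \<le> \<mu> n * (ip (p n t) (a t) - (sn (p n t))\<^sup>2)" for n
    using sol soln[of n] L2_time_AE[OF \<delta>L[of n]] L2_time_AE[OF DL[of n]]
  proof eventually_elim
    case (elim t)
    \<comment> \<open>The datum \<open>g\<close> cancels in the difference of the two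
      equations.\<close>
    have eq: "a t - (g t - P (time_derivative V ip T (wn n) t)) = p n t"
      unfolding a_def p_def \<delta>_def by (simp add: linear_diff[OF P])
    have "ip (p n t) (D n t) \<le> \<mu> n * (ip (p n t) (a t) - (sn (p n t))\<^sup>2)"
      using yosida_difference(2)[OF A \<mu>(1) elim(1,2)] unfolding a_def[symmetric] eq D_def .
    then show ?case unfolding p_def Psym[OF elim(3,4)] .
  qed
  have energy: "\<kappa> * (sn (c n \<tau>))\<^sup>2 \<le> 2 * (\<integral>r. indicator {0<..\<tau>} r * (\<mu> n * (ip (p n r) (a r) - (sn (p n r))\<^sup>2)) \<partial>?M)"
    if \<tau>: "\<tau> \<in> {0..T}" for n \<tau>
  proof -
    have 0: "0 \<in> {0..T}" using T by simp
    have \<tau>': "0 \<le> (0::real)" "\<tau> \<le> T" using \<tau> by auto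
    \<comment> \<open>The initial difference is only a null vector, so the initial energy vanishes
      through Cauchy-Schwarz.\<close>
    have "ip (P (c n 0)) (c n 0) = 0"
      using Cauchy_Schwarz[OF PV[OF cV[OF 0]] cV[OF 0], of n n] c0[of n] by simp
    then have "ip (P (c n \<tau>)) (c n \<tau>) = 2 * (\<integral>r. indicator {0<..\<tau>} r * ip (\<delta> n r) (P (D n r)) \<partial>?M)"
      using time_representative.energy_identity[OF c PV P Psym K(2,1) \<tau>, of n] by simp
    also have "\<dots> \<le> 2 * (\<integral>r. indicator {0<..\<tau>} r * (\<mu> n * (ip (p n r) (a r) - (sn (p n r))\<^sup>2)) \<partial>?M)"
    proof (intro mult_left_mono integral_mono_AE)
      show "integrable ?M (\<lambda>r. indicator {0<..\<tau>} r * ip (\<delta> n r) (P (D n r)))"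
        by (rule integrable_lebesgue_on_Ioc[OF L2_time_ip_integrable[OF \<delta>L PL2[OF DL]] \<tau>'])
      show "integrable ?M (\<lambda>r. indicator {0<..\<tau>} r * (\<mu> n * (ip (p n r) (a r) - (sn (p n r))\<^sup>2)))"
        by (intro integrable_lebesgue_on_Ioc[OF _ \<tau>'] integrable_mult_right Bochner_Integration.integrable_diff
            L2_time_ip_integrable pL aL L2_timeD(2))
      show "AE r in ?M. indicator {0<..\<tau>} r * ip (\<delta> n r) (P (D n r))
          \<le> indicator {0<..\<tau>} r * (\<mu> n * (ip (p n r) (a r) - (sn (p n r))\<^sup>2))"
        using key[of n] by eventually_elim (rule mult_left_mono, simp_all)
    qed simp
    finally show ?thesis using \<kappa>(2)[OF cV[OF \<tau>], of n] by linarith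
  qed
  have ipa: "integrable ?M (\<lambda>r. ip (p n r) (a r))" for n by (rule L2_time_ip_integrable[OF pL aL])
  \<comment> \<open>A crude pointwise bound is enough here:
    \<open>ip (p n r) (a r) - (sn (p n r))\<^sup>2\<close> never exceeds
    \<open>(sn (a r))\<^sup>2\<close>, on any subinterval. This gives the order
    \<open>\<mu> n\<close> uniformly in \<tau>.\<close>
  have c_bound: "\<kappa> * (sn (c n \<tau>))\<^sup>2 \<le> 2 * \<mu> n * \<alpha>" if \<tau>: "\<tau> \<in> {0..T}" for n \<tau>
  proof -
    have "(\<integral>r. indicator {0<..\<tau>} r * (\<mu> n * (ip (p n r) (a r) - (sn (p n r))\<^sup>2)) \<partial>?M) \<le> (\<integral>r. \<mu> n * (sn (a r))\<^sup>2 \<partial>?M)"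
    proof (rule integral_mono_AE)
      show "integrable ?M (\<lambda>r. indicator {0<..\<tau>} r * (\<mu> n * (ip (p n r) (a r) - (sn (p n r))\<^sup>2)))"
        using \<tau> by (intro integrable_lebesgue_on_Ioc integrable_mult_right Bochner_Integration.integrable_diff
            ipa L2_timeD(2)[OF pL]) auto
      show "integrable ?M (\<lambda>r. \<mu> n * (sn (a r))\<^sup>2)" by (rule integrable_mult_right) (rule L2_timeD(2)[OF aL])
      show "AE r in ?M. indicator {0<..\<tau>} r * (\<mu> n * (ip (p n r) (a r) - (sn (p n r))\<^sup>2)) \<le> \<mu> n * (sn (a r))\<^sup>2"
        using L2_time_AE[OF pL[of n]] L2_time_AE[OF aL]
      proof eventually_elim
        case (elim r)
        have "ip (p n r) (a r) - (sn (p n r))\<^sup>2 \<le> (sn (a r))\<^sup>2"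
          using ip_le_half_sq[OF elim] zero_le_power2[of "sn (a r)"] zero_le_power2[of "sn (p n r)"] by linarith
        from mult_left_mono[OF this less_imp_le[OF \<mu>(1)]]
        have "\<mu> n * (ip (p n r) (a r) - (sn (p n r))\<^sup>2) \<le> \<mu> n * (sn (a r))\<^sup>2" .
        moreover have "0 \<le> \<mu> n * (sn (a r))\<^sup>2" using \<mu>(1)[of n] by simp
        ultimately show ?case by (simp add: indicator_def)
      qed
    qed
    also have "\<dots> = \<mu> n * \<alpha>" unfolding \<alpha>_def by (rule integral_mult_right_zero)
    finally show ?thesis using energy[OF \<tau>, of n] by linarith
  qed
  have p_le: "(\<integral>t. (sn (p n t))\<^sup>2 \<partial>?M) \<le> (\<integral>t. ip (p n t) (a t) \<partial>?M)" for n
  proof -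
    have T': "T \<in> {0..T}" using T by simp
    have m: "integrable ?M (\<lambda>r. \<mu> n * (ip (p n r) (a r) - (sn (p n r))\<^sup>2))"
      by (intro integrable_mult_right Bochner_Integration.integrable_diff ipa L2_timeD(2)[OF pL])
    have "AE r in ?M. r \<notin> {0}" by (rule AE_lebesgue_on_not_in) auto
    then have "AE r in ?M. indicator {0<..T} r * (\<mu> n * (ip (p n r) (a r) - (sn (p n r))\<^sup>2))
        = \<mu> n * (ip (p n r) (a r) - (sn (p n r))\<^sup>2)"
      using AE_space by eventually_elim (auto simp: indicator_def)
    then have "(\<integral>r. indicator {0<..T} r * (\<mu> n * (ip (p n r) (a r) - (sn (p n r))\<^sup>2)) \<partial>?M)
        = (\<integral>r. \<mu> n * (ip (p n r) (a r) - (sn (p n r))\<^sup>2) \<partial>?M)"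
      by (rule integral_cong_AE[rotated 2])
         (intro borel_measurable_integrable integrable_lebesgue_on_Ioc[OF m order_refl order_refl] m)+
    also have "\<dots> = \<mu> n * ((\<integral>t. ip (p n t) (a t) \<partial>?M) - (\<integral>t. (sn (p n t))\<^sup>2 \<partial>?M))"
      unfolding integral_mult_right_zero by (simp only: Bochner_Integration.integral_diff[OF ipa L2_timeD(2)[OF pL]])
    finally have "0 \<le> 2 * (\<mu> n * ((\<integral>t. ip (p n t) (a t) \<partial>?M) - (\<integral>t. (sn (p n t))\<^sup>2 \<partial>?M)))"
      using energy[OF T', of n] mult_nonneg_nonneg[OF less_imp_le[OF \<kappa>(1)] zero_le_power2[of "sn (c n T)"]] by linarith
    then show ?thesis using \<mu>(1)[of n] by (simp add: zero_le_mult_iff)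
  qed
  have p_bound: "(\<integral>t. (sn (p n t))\<^sup>2 \<partial>?M) \<le> \<alpha>" for n
  proof -
    \<comment> \<open>Young's inequality: one of the two copies of the integral of
      \<open>(sn (p n t))\<^sup>2\<close> gained from \<open>p_le\<close> absorbs the term with
      \<open>p n\<close> on the right.\<close>
    have "(\<integral>t. 2 * ip (p n t) (a t) \<partial>?M) \<le> (\<integral>t. (sn (p n t))\<^sup>2 + (sn (a t))\<^sup>2 \<partial>?M)"
    proof (rule integral_mono_AE)
      show "AE t in ?M. 2 * ip (p n t) (a t) \<le> (sn (p n t))\<^sup>2 + (sn (a t))\<^sup>2"
        using L2_time_AE[OF pL[of n]] L2_time_AE[OF aL] by eventually_elim (rule ip_le_half_sq)
    qed (intro integrable_mult_right Bochner_Integration.integrable_add ipa L2_timeD(2) pL aL)+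
    then have "2 * (\<integral>t. ip (p n t) (a t) \<partial>?M) \<le> (\<integral>t. (sn (p n t))\<^sup>2 \<partial>?M) + \<alpha>"
      unfolding \<alpha>_def integral_mult_right_zero
        Bochner_Integration.integral_add[OF L2_timeD(2)[OF pL] L2_timeD(2)[OF aL]] .
    then show ?thesis using p_le[of n] by linarith
  qed
  \<comment> \<open>Ellipticity of \<open>P\<close> and Cauchy-Schwarz give
    \<open>\<kappa> * sn (\<delta> n t) \<le> sn (p n t)\<close> at almost every time, so bounds on
    \<open>p n\<close> pass to the difference of the derivatives.\<close>
  have \<delta>_le: "(\<integral>t. (sn (\<delta> n t))\<^sup>2 \<partial>?M) \<le> inverse (\<kappa>\<^sup>2) * (\<integral>t. (sn (p n t))\<^sup>2 \<partial>?M)" for n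
  proof -
    have "(\<integral>t. (sn (\<delta> n t))\<^sup>2 \<partial>?M) \<le> (\<integral>t. inverse (\<kappa>\<^sup>2) * (sn (p n t))\<^sup>2 \<partial>?M)"
    proof (rule integral_mono_AE)
      show "AE t in ?M. (sn (\<delta> n t))\<^sup>2 \<le> inverse (\<kappa>\<^sup>2) * (sn (p n t))\<^sup>2"
        using L2_time_AE[OF \<delta>L[of n]]
      proof eventually_elim
        case (elim t)
        have "\<kappa> * (sn (\<delta> n t))\<^sup>2 \<le> sn (p n t) * sn (\<delta> n t)"
          using \<kappa>(2)[OF elim] Cauchy_Schwarz[OF PV[OF elim] elim] unfolding p_def by linarith
        then have m: "(\<kappa> * sn (\<delta> n t)) * sn (\<delta> n t) \<le> sn (p n t) * sn (\<delta> n t)"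
          by (simp only: power2_eq_square mult.assoc)
        have p0: "0 \<le> sn (p n t)" unfolding p_def by (rule sn_nonneg[OF PV[OF elim]])
        have "\<kappa> * sn (\<delta> n t) \<le> sn (p n t)"
        proof (cases "sn (\<delta> n t) = 0")
          case False
          then have "0 < sn (\<delta> n t)" using sn_nonneg[OF elim] by linarith
          with m show ?thesis by (rule mult_right_le_imp_le)
        qed (use p0 in simp)
        from power_mono[OF this mult_nonneg_nonneg[OF less_imp_le[OF \<kappa>(1)] sn_nonneg[OF elim]], of 2]
        have "\<kappa>\<^sup>2 * (sn (\<delta> n t))\<^sup>2 \<le> (sn (p n t))\<^sup>2" by (simp only: power_mult_distrib)
        then show ?case using \<kappa>(1) by (simp add: field_simps)
      qed
    qed (intro integrable_mult_right L2_timeD(2) \<delta>L pL)+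
    then show ?thesis unfolding integral_mult_right_zero .
  qed
  have \<delta>_bound: "(\<integral>t. (sn (\<delta> n t))\<^sup>2 \<partial>?M) \<le> inverse (\<kappa>\<^sup>2) * \<alpha>" for n
    using \<delta>_le[of n] mult_left_mono[OF p_bound[of n], of "inverse (\<kappa>\<^sup>2)"] by simp
  have c_null: "(\<lambda>n. sn (c n \<tau>)) \<longlonglongrightarrow> 0" if \<tau>: "\<tau> \<in> {0..T}" for \<tau>
  proof -
    have lim: "(\<lambda>n. 2 * \<mu> n * \<alpha> / \<kappa>) \<longlonglongrightarrow> 0"
      using tendsto_mult[OF tendsto_const \<mu>(2), of "2 * \<alpha> / \<kappa>"] by (simp add: mult_ac)
    have "(\<lambda>n. (sn (c n \<tau>))\<^sup>2) \<longlonglongrightarrow> 0"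
    proof (rule tendsto_sandwich[OF always_eventually always_eventually tendsto_const lim])
      show "\<forall>n. (sn (c n \<tau>))\<^sup>2 \<le> 2 * \<mu> n * \<alpha> / \<kappa>"
        using c_bound[OF \<tau>] \<kappa>(1) by (simp add: field_simps)
    qed simp
    then show ?thesis unfolding null_sequence_sq .
  qed
  \<comment> \<open>By symmetry of \<open>P\<close>, pairing \<open>p n\<close> with
    \<open>a\<close> is pairing \<open>\<delta> n\<close> with \<open>P (a t)\<close>, so the latter
    is the fixed function to test with.\<close>
  have weak: "(\<lambda>n. \<integral>t. ip (\<delta> n t) (P (a t)) \<partial>?M) \<longlonglongrightarrow> 0"
  proof (rule weak_null[OF T \<delta>L \<delta>_bound _ PL2[OF aL]])
    fix x s t assume x: "x \<in> V" and st: "0 \<le> s" "s \<le> t" "t \<le> T"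
    have st': "s \<in> {0..T}" "t \<in> {0..T}" using st by auto
    have lim: "(\<lambda>n. (sn (c n t) + sn (c n s)) * sn x) \<longlonglongrightarrow> 0"
      using tendsto_mult[OF tendsto_add[OF c_null[OF st'(2)] c_null[OF st'(1)]] tendsto_const, of "sn x"] by simp
    \<comment> \<open>The integral of \<open>ip (\<delta> n r) x\<close> over (s, t] is an increment
      of \<open>c n\<close>, and the increments vanish in the limit because \<open>c n\<close> tends
      to 0 at every single time.\<close>
    have "(\<lambda>n. ip (c n t - c n s) x) \<longlonglongrightarrow> 0"
    proof (rule Lim_null_comparison[OF always_eventually lim], rule allI)
      fix n
      have "\<bar>ip (c n t - c n s) x\<bar> \<le> sn (c n t - c n s) * sn x"
        by (rule Cauchy_Schwarz[OF V_diff[OF cV[OF st'(2)] cV[OF st'(1)]] x])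
      also have "\<dots> \<le> (sn (c n t) + sn (c n s)) * sn x"
        by (rule mult_right_mono[OF sn_triangle_diff[OF cV[OF st'(2)] cV[OF st'(1)]] sn_nonneg[OF x]])
      finally show "norm (ip (c n t - c n s) x) \<le> (sn (c n t) + sn (c n s)) * sn x" by (simp only: real_norm_def)
    qed
    then show "(\<lambda>n. \<integral>r. indicator {s<..t} r * ip (\<delta> n r) x \<partial>?M) \<longlonglongrightarrow> 0"
      by (simp only: time_representative.increment_ip[OF c x st])
  qed
  have "(\<integral>t. ip (\<delta> n t) (P (a t)) \<partial>?M) = (\<integral>t. ip (p n t) (a t) \<partial>?M)" for n
  proof (rule integral_cong_AE)
    show "AE t in ?M. ip (\<delta> n t) (P (a t)) = ip (p n t) (a t)"
      unfolding p_def using L2_time_AE[OF \<delta>L[of n]] L2_time_AE[OF aL] by eventually_elim (rule Psym[symmetric])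
  qed (intro borel_measurable_integrable L2_time_ip_integrable \<delta>L PL2 pL aL)+
  with weak have lim_pa: "(\<lambda>n. \<integral>t. ip (p n t) (a t) \<partial>?M) \<longlonglongrightarrow> 0" by (simp only:)
  have lim_\<delta>: "(\<lambda>n. \<integral>t. (sn (\<delta> n t))\<^sup>2 \<partial>?M) \<longlonglongrightarrow> 0"
  proof (rule tendsto_sandwich[OF always_eventually always_eventually tendsto_const])
    show "(\<lambda>n. inverse (\<kappa>\<^sup>2) * (\<integral>t. ip (p n t) (a t) \<partial>?M)) \<longlonglongrightarrow> 0"
      using tendsto_mult[OF tendsto_const lim_pa, of "inverse (\<kappa>\<^sup>2)"] by simp
    show "\<forall>n. (\<integral>t. (sn (\<delta> n t))\<^sup>2 \<partial>?M) \<le> inverse (\<kappa>\<^sup>2) * (\<integral>t. ip (p n t) (a t) \<partial>?M)"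
    proof
      fix n
      have "inverse (\<kappa>\<^sup>2) * (\<integral>t. (sn (p n t))\<^sup>2 \<partial>?M) \<le> inverse (\<kappa>\<^sup>2) * (\<integral>t. ip (p n t) (a t) \<partial>?M)"
        by (rule mult_left_mono[OF p_le]) simp
      then show "(\<integral>t. (sn (\<delta> n t))\<^sup>2 \<partial>?M) \<le> inverse (\<kappa>\<^sup>2) * (\<integral>t. ip (p n t) (a t) \<partial>?M)"
        using \<delta>_le[of n] by linarith
    qed
    show "\<forall>n. 0 \<le> (\<integral>t. (sn (\<delta> n t))\<^sup>2 \<partial>?M)" by simp
  qed
  have lim_D: "(\<lambda>n. \<integral>t. (sn (D n t))\<^sup>2 \<partial>?M) \<longlonglongrightarrow> 0"
  proof (rule tendsto_sandwich[OF always_eventually always_eventually tendsto_const])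
    let ?m = "measure ?M (space ?M)"
    show "(\<lambda>n. (2 * \<mu> n * \<alpha> / \<kappa>) * ?m) \<longlonglongrightarrow> 0"
      using tendsto_mult[OF tendsto_const \<mu>(2), of "2 * \<alpha> / \<kappa> * ?m"] by (simp add: mult_ac)
    show "\<forall>n. (\<integral>t. (sn (D n t))\<^sup>2 \<partial>?M) \<le> (2 * \<mu> n * \<alpha> / \<kappa>) * ?m"
    proof
      fix n
      have "(\<integral>t. (sn (D n t))\<^sup>2 \<partial>?M) \<le> (\<integral>t. 2 * \<mu> n * \<alpha> / \<kappa> \<partial>?M)"
      proof (rule integral_mono_AE[OF L2_timeD(2)[OF DL]])
        show "AE t in ?M. (sn (D n t))\<^sup>2 \<le> 2 * \<mu> n * \<alpha> / \<kappa>"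
          using time_representative.cw[OF c[of n]] L2_time_AE[OF DL[of n]] AE_space
        proof eventually_elim
          case (elim t)
          then have t: "t \<in> {0..T}" by simp
          have "sn (D n t) = sn (c n t)" by (rule sn_cong_null[OF cV[OF t] elim(2,1), symmetric])
          then show ?case using c_bound[OF t, of n] \<kappa>(1) by (simp add: field_simps)
        qed
      qed simp
      also have "\<dots> = (2 * \<mu> n * \<alpha> / \<kappa>) * ?m" by simp
      finally show "(\<integral>t. (sn (D n t))\<^sup>2 \<partial>?M) \<le> (2 * \<mu> n * \<alpha> / \<kappa>) * ?m" .
    qed
    show "\<forall>n. 0 \<le> (\<integral>t. (sn (D n t))\<^sup>2 \<partial>?M)" by simp
  qed
  \<comment> \<open>The norm in the conclusion refers to the derivative chosen for the difference,
    which equals \<open>\<delta> n\<close> only up to null vectors.\<close>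
  have "(\<integral>t. (sn (time_derivative V ip T (\<lambda>t. wn n t - w t) t))\<^sup>2 \<partial>?M) = (\<integral>t. (sn (\<delta> n t))\<^sup>2 \<partial>?M)" for n
  proof (rule integral_cong_AE)
    note E = time_derivative_diff[OF wn(1)[of n] w(1)]
    note F = time_derivative_props(2)[OF E(1)]
    show "AE t in ?M. (sn (time_derivative V ip T (\<lambda>t. wn n t - w t) t))\<^sup>2 = (sn (\<delta> n t))\<^sup>2"
      using E(2) L2_time_AE[OF F] L2_time_AE[OF \<delta>L[of n]]
    proof eventually_elim
      case (elim t)
      from sn_cong_null[OF elim(2,3)] elim(1) show ?case unfolding \<delta>_def by simp
    qed
    show "(\<lambda>t. (sn (time_derivative V ip T (\<lambda>t. wn n t - w t) t))\<^sup>2) \<in> borel_measurable ?M"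
      by (rule borel_measurable_integrable[OF L2_timeD(2)[OF F]])
  qed (rule borel_measurable_integrable[OF L2_timeD(2)[OF \<delta>L]])
  then have "H1_time_norm V ip T (\<lambda>t. wn n t - w t) = sqrt ((\<integral>t. (sn (D n t))\<^sup>2 \<partial>?M) + (\<integral>t. (sn (\<delta> n t))\<^sup>2 \<partial>?M))" for n
    unfolding H1_time_norm_def D_def by (simp only:)
  moreover have "(\<lambda>n. sqrt ((\<integral>t. (sn (D n t))\<^sup>2 \<partial>?M) + (\<integral>t. (sn (\<delta> n t))\<^sup>2 \<partial>?M))) \<longlonglongrightarrow> sqrt (0 + 0)"
    by (intro tendsto_real_sqrt tendsto_add lim_D lim_\<delta>)
  ultimately show ?thesis by (simp only: add_0 real_sqrt_zero)
qed

end

section \<open>Tensors\<close>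

lemma coercive_tensorD:
  assumes "coercive_tensor C"
  shows "linear C" "C x \<bullet> y = x \<bullet> C y" "\<exists>c>0. \<forall>x. c * (norm x)\<^sup>2 \<le> C x \<bullet> x" "0 \<le> C x \<bullet> x"
proof -
  show "linear C" "C x \<bullet> y = x \<bullet> C y" and ex: "\<exists>c>0. \<forall>x. c * (norm x)\<^sup>2 \<le> C x \<bullet> x"
    using assms unfolding coercive_tensor_def by blast+
  then obtain c where "c > 0" "c * (norm x)\<^sup>2 \<le> C x \<bullet> x" by blast
  moreover have "0 \<le> c * (norm x)\<^sup>2" using \<open>c > 0\<close> by simp
  ultimately show "0 \<le> C x \<bullet> x" by linarith
qed

lemma coercive_tensor_add:
  assumes C: "coercive_tensor C" and B: "coercive_tensor B"
  shows "coercive_tensor (\<lambda>x. C x + B x)"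
proof -
  obtain c where c: "c > 0" "\<And>x. c * (norm x)\<^sup>2 \<le> C x \<bullet> x" using coercive_tensorD(3)[OF C] by blast
  have "c * (norm x)\<^sup>2 \<le> (C x + B x) \<bullet> x" for x
    using c(2)[of x] coercive_tensorD(4)[OF B, of x] unfolding inner_add_left by linarith
  moreover have "(C x + B x) \<bullet> y = x \<bullet> (C y + B y)" for x y
    unfolding inner_add_left inner_add_right coercive_tensorD(2)[OF C, of x y] coercive_tensorD(2)[OF B, of x y] ..
  ultimately show ?thesis
    unfolding coercive_tensor_def
    using c(1) linear_compose_add[OF coercive_tensorD(1)[OF C] coercive_tensorD(1)[OF B]] by blast
qed

text \<open>Coercivity gives injectivity, and finite dimension turns it into surjectivity. The
  constant \<open>c / K\<^sup>2\<close> of the inverse comes from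
  \<open>norm x \<le> norm (inv S x) * K\<close>, inserted into the coercivity of \<open>S\<close>
  at \<open>inv S x\<close>.\<close>

lemma coercive_tensor_inv:
  fixes S :: "'d::finite symmat \<Rightarrow> 'd symmat"
  assumes S: "coercive_tensor S"
  shows "coercive_tensor (inv S)" "S (inv S x) = x" "inv S (S x) = x"
proof -
  obtain c where c: "c > 0" "\<And>x. c * (norm x)\<^sup>2 \<le> S x \<bullet> x" using coercive_tensorD(3)[OF S] by blast
  note lin = coercive_tensorD(1)[OF S]
  have inj: "inj S"
    unfolding linear_injective_0[OF lin]
  proof (intro allI impI)
    fix x assume "S x = 0"
    then have "c * (norm x)\<^sup>2 \<le> 0" using c(2)[of x] by simp
    then show "x = 0" using c(1) by (simp add: mult_le_0_iff)
  qed
  then have surj: "surj S" by (rule linear_inj_imp_surj[OF lin])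
  show r: "S (inv S x) = x" for x by (rule surj_f_inv_f[OF surj])
  show "inv S (S x) = x" by (rule inv_f_f[OF inj])
  have sym: "inv S x \<bullet> y = x \<bullet> inv S y" for x y
    using coercive_tensorD(2)[OF S, of "inv S x" "inv S y"] unfolding r by (rule sym)
  have "bounded_linear S" using lin by (simp add: linear_conv_bounded_linear)
  then obtain K where K: "K > 0" "\<And>x. norm (S x) \<le> norm x * K" using bounded_linear.pos_bounded by blast
  have "c / K\<^sup>2 * (norm x)\<^sup>2 \<le> inv S x \<bullet> x" for x
  proof -
    have "norm x \<le> norm (inv S x) * K" using K(2)[of "inv S x"] unfolding r .
    from power_mono[OF this norm_ge_zero, of 2]
    have "(norm x)\<^sup>2 / K\<^sup>2 \<le> (norm (inv S x))\<^sup>2" using K(1) by (simp add: power_mult_distrib field_simps)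
    from mult_left_mono[OF this less_imp_le[OF c(1)]]
    have "c / K\<^sup>2 * (norm x)\<^sup>2 \<le> c * (norm (inv S x))\<^sup>2" by simp
    also have "\<dots> \<le> S (inv S x) \<bullet> inv S x" by (rule c(2))
    also have "\<dots> = inv S x \<bullet> x" unfolding r by (rule inner_commute)
    finally show ?thesis .
  qed
  moreover have "0 < c / K\<^sup>2" using c(1) K(1) by simp
  ultimately show "coercive_tensor (inv S)"
    unfolding coercive_tensor_def using inj_linear_imp_inv_linear[OF lin inj] sym by blast
qed

text \<open>\<open>D = B (C + B)\<inverse> C = C - C (C + B)\<inverse> C\<close>, and with \<open>y = (C + B)\<inverse> C x\<close> one has
  \<open>D x = B y = C (x - y)\<close>, so that \<open>D x \<bullet> x = C (x - y) \<bullet> (x - y) + B y \<bullet> y\<close>.\<close>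

lemma D_tensor_props:
  fixes C B :: "'d::finite symmat \<Rightarrow> 'd symmat"
  assumes C: "coercive_tensor C" and B: "coercive_tensor B"
  shows "linear (D_tensor C B)" "D_tensor C B x \<bullet> y = x \<bullet> D_tensor C B y" "0 \<le> D_tensor C B x \<bullet> x"
proof -
  let ?S = "\<lambda>x. C x + B x"
  note S = coercive_tensor_inv[OF coercive_tensor_add[OF C B]]
  note lC = coercive_tensorD(1)[OF C] and lB = coercive_tensorD(1)[OF B]
    and lS = coercive_tensorD(1)[OF S(1)]
  show "linear (D_tensor C B)" unfolding D_tensor_def by (intro linear_compose lC lB lS)
  have D: "D_tensor C B x = C x - C (inv ?S (C x))" for x
    using S(2)[of "C x"] unfolding D_tensor_def o_def by (simp add: algebra_simps)
  show "D_tensor C B x \<bullet> y = x \<bullet> D_tensor C B y"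
    unfolding D inner_diff_left inner_diff_right
    using coercive_tensorD(2)[OF C, of x y] coercive_tensorD(2)[OF C, of "inv ?S (C x)" y]
      coercive_tensorD(2)[OF C, of x "inv ?S (C y)"] coercive_tensorD(2)[OF S(1), of "C x" "C y"] by simp
  define y where "y = inv ?S (C x)"
  have By: "D_tensor C B x = B y" unfolding D_tensor_def y_def by simp
  have Cxy: "D_tensor C B x = C (x - y)" unfolding D y_def linear_diff[OF lC] ..
  have "D_tensor C B x \<bullet> x = D_tensor C B x \<bullet> (x - y) + D_tensor C B x \<bullet> y"
    by (simp add: inner_diff_right)
  also have "\<dots> = C (x - y) \<bullet> (x - y) + B y \<bullet> y" using By Cxy by simp
  finally show "0 \<le> D_tensor C B x \<bullet> x"
    using coercive_tensorD(4)[OF C, of "x - y"] coercive_tensorD(4)[OF B, of y] by linarith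
qed

section \<open>The state space\<close>

lemma linear_sym_part: "linear (sym_part :: real^'d^'d \<Rightarrow> ('d::finite) symmat)"
proof -
  have t: "transpose (M + N) = transpose M + transpose N" "transpose (c *\<^sub>R M) = c *\<^sub>R transpose M"
    for M N :: "real^'d^'d" and c
    by (simp_all add: transpose_def vec_eq_iff)
  have Rep: "Rep_symmat (sym_part M) = (1/2) *\<^sub>R (M + transpose M)" for M :: "real^'d^'d"
    unfolding sym_part_def by (rule Abs_symmat_inverse) (simp add: t add.commute)
  show ?thesis
    by (rule linearI) (simp_all add: Rep_symmat_inject[symmetric] Rep_symmat_ops Rep t algebra_simps)
qed

context
  fixes \<Omega> :: "(real^('d::finite)) set" and C B :: "'d symmat \<Rightarrow> 'd symmat"
  assumes open_dom: "open \<Omega>" and bounded_dom: "bounded \<Omega>"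
    and C: "coercive_tensor C" and B: "coercive_tensor B"
begin

private abbreviation (input) "M \<equiv> lebesgue_on \<Omega>"
private abbreviation (input) "D \<equiv> D_tensor C B"
private abbreviation (input) "sg \<equiv> sym_gradient \<Omega>"

lemma sym_gradient_Lsq: "u \<in> H1 \<Omega> \<Longrightarrow> sg u \<in> Lsq M"
  unfolding sym_gradient_def[abs_def]
  by (rule Lsq_linear[OF H1_weak_gradient(2)[OF open_dom bounded_dom] linear_sym_part])

lemma D_sym_gradient_Lsq: "u \<in> H1 \<Omega> \<Longrightarrow> (\<lambda>x. D (sg u x)) \<in> Lsq M"
  by (rule Lsq_linear[OF sym_gradient_Lsq D_tensor_props(1)[OF C B]])

text \<open>\<open>sg (u + v)\<close> is formed from the gradient chosen for the sum and matches
  \<open>sg u + sg v\<close> only almost everywhere, which is enough under the integral.\<close>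

lemma D_form_add:
  assumes u: "u \<in> H1 \<Omega>" and v: "v \<in> H1 \<Omega>" and z: "z \<in> H1 \<Omega>"
  shows "Lsq_inner M (\<lambda>x. D (sg (u + v) x)) (sg z)
    = Lsq_inner M (\<lambda>x. D (sg u x)) (sg z) + Lsq_inner M (\<lambda>x. D (sg v x)) (sg z)"
proof -
  note uv = H1_add[OF open_dom bounded_dom u v]
  have "Lsq_inner M (\<lambda>x. D (sg (u + v) x)) (sg z) = Lsq_inner M (\<lambda>x. D (sg u x) + D (sg v x)) (sg z)"
  proof (rule Lsq_inner_cong)
    show "AE x in M. D (sg (u + v) x) = D (sg u x) + D (sg v x)"
      using uv(2) unfolding sym_gradient_def plus_fun_def
      by eventually_elim (simp add: linear_add[OF linear_sym_part] linear_add[OF D_tensor_props(1)[OF C B]])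
    show "(\<lambda>x. D (sg (u + v) x)) \<in> borel_measurable M"
      unfolding plus_fun_def by (rule LsqD(1)[OF D_sym_gradient_Lsq[OF uv(1)]])
  qed (simp_all add: LsqD(1) Lsq_add D_sym_gradient_Lsq sym_gradient_Lsq u v z)
  then show ?thesis
    unfolding Lsq_inner_add[OF D_sym_gradient_Lsq[OF u] D_sym_gradient_Lsq[OF v] sym_gradient_Lsq[OF z]] .
qed

lemma D_form_scaleR:
  assumes u: "u \<in> H1 \<Omega>" and z: "z \<in> H1 \<Omega>"
  shows "Lsq_inner M (\<lambda>x. D (sg (c *\<^sub>R u) x)) (sg z) = c * Lsq_inner M (\<lambda>x. D (sg u x)) (sg z)"
proof -
  note cu = H1_scaleR[OF open_dom bounded_dom u, of c]
  have "Lsq_inner M (\<lambda>x. D (sg (c *\<^sub>R u) x)) (sg z) = Lsq_inner M (\<lambda>x. c *\<^sub>R D (sg u x)) (sg z)"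
  proof (rule Lsq_inner_cong)
    show "AE x in M. D (sg (c *\<^sub>R u) x) = c *\<^sub>R D (sg u x)"
      using cu(2) unfolding sym_gradient_def scaleR_fun_def
      by eventually_elim (simp add: linear_cmul[OF linear_sym_part] linear_cmul[OF D_tensor_props(1)[OF C B]])
    show "(\<lambda>x. D (sg (c *\<^sub>R u) x)) \<in> borel_measurable M"
      unfolding scaleR_fun_def by (rule LsqD(1)[OF D_sym_gradient_Lsq[OF cu(1)]])
  qed (simp_all add: LsqD(1) Lsq_scaleR D_sym_gradient_Lsq sym_gradient_Lsq u z)
  then show ?thesis unfolding Lsq_inner_scaleR .
qed

lemma D_form_commute:
  "Lsq_inner M (\<lambda>x. D (sg u x)) (sg v) = Lsq_inner M (\<lambda>x. D (sg v x)) (sg u)"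
  unfolding Lsq_inner_def
  by (rule Bochner_Integration.integral_cong[OF refl]) (rule trans[OF D_tensor_props(2)[OF C B] inner_commute])

lemma D_form_nonneg: "0 \<le> Lsq_inner M (\<lambda>x. D (sg u x)) (sg u)"
  unfolding Lsq_inner_def by (rule integral_nonneg_AE) (simp add: D_tensor_props(3)[OF C B])

text \<open>This instance opens the abstract theory to the state space. Symmetry and nonnegativity
  hold for arbitrary triples; linearity is obtained on the carrier, where the almost everywhere
  identities for gradients apply.\<close>

lemma semi_inner_space_H: "semi_inner_space (H_space \<Omega> \<Gamma>) (H_inner \<Omega> C B)"
proof
  show "subspace (H_space \<Omega> \<Gamma>)" by (rule subspace_H_space[OF open_dom bounded_dom])
  fix x y z :: "'d state" and c :: real
  obtain u v q where x: "x = (u, v, q)" by (cases x) blast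
  obtain u' v' q' where y: "y = (u', v', q')" by (cases y) blast
  obtain u'' v'' q'' where z: "z = (u'', v'', q'')" by (cases z) blast
  show "H_inner \<Omega> C B x y = H_inner \<Omega> C B y x"
    unfolding x y H_inner_def prod.case
    using D_form_commute[of u u'] Lsq_inner_commute[of M v v'] Lsq_inner_commute[of M q q'] by linarith
  show "0 \<le> H_inner \<Omega> C B x x"
    unfolding x H_inner_def prod.case by (intro add_nonneg_nonneg D_form_nonneg Lsq_inner_nonneg)
  assume "x \<in> H_space \<Omega> \<Gamma>" "z \<in> H_space \<Omega> \<Gamma>"
  then have X: "u \<in> H1 \<Omega>" "v \<in> Lsq M" "q \<in> Lsq M" and Z: "u'' \<in> H1 \<Omega>" "v'' \<in> Lsq M" "q'' \<in> Lsq M"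
    unfolding x z H_space_def mem_Times_iff fst_conv snd_conv by (blast intro: H1_D_subset_H1)+
  show "H_inner \<Omega> C B (c *\<^sub>R x) z = c * H_inner \<Omega> C B x z"
    unfolding x z H_inner_def scaleR_Pair prod.case D_form_scaleR[OF X(1) Z(1)]
    by (simp add: scaleR_fun_def Lsq_inner_scaleR distrib_left)
  assume "y \<in> H_space \<Omega> \<Gamma>"
  then have Y: "u' \<in> H1 \<Omega>" "v' \<in> Lsq M" "q' \<in> Lsq M"
    unfolding y H_space_def mem_Times_iff fst_conv snd_conv by (blast intro: H1_D_subset_H1)+
  show "H_inner \<Omega> C B (x + y) z = H_inner \<Omega> C B x z + H_inner \<Omega> C B y z"
    unfolding x y z H_inner_def add_Pair prod.case D_form_add[OF X(1) Y(1) Z(1)]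
    by (simp add: plus_fun_def Lsq_inner_add[OF X(2) Y(2) Z(2)] Lsq_inner_add[OF X(3) Y(3) Z(3)])
qed

text \<open>\<open>R_map\<close> preserves differences and embeds L2 isometrically as the middle
  component, so it is Lipschitz with constant 1.\<close>

lemma R_map_L2_time:
  assumes f: "f \<in> L2_time (Lsq M) (Lsq_inner M) T"
  shows "(\<lambda>t. R_map (f t)) \<in> L2_time (H_space \<Omega> \<Gamma>) (H_inner \<Omega> C B) T"
proof (rule L2_time_Lipschitz[where L = R_map and K = 1, OF semi_inner_space_Lsq semi_inner_space_H f])
  interpret H: semi_inner_space "H_space \<Omega> \<Gamma>" "H_inner \<Omega> C B" by (rule semi_inner_space_H)
  have zero: "(0, 0, 0) \<in> H_space \<Omega> \<Gamma>" using H.V_zero by (simp add: zero_prod_def)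
  show "R_map x \<in> H_space \<Omega> \<Gamma>" if "x \<in> Lsq M" for x
    using zero that unfolding R_map_def H_space_def by blast
  show "R_map 0 = 0" by (simp add: R_map_def zero_prod_def)
  fix x y :: "real^'d \<Rightarrow> real^'d"
  \<comment> \<open>The gradient chosen for the zero displacement need not be literally 0, so its
    form value is not 0 by computation. It is read off from the value of \<open>H_inner\<close> at
    the zero vector, whose other two summands vanish.\<close>
  have "H_inner \<Omega> C B (0, 0, 0) (0, 0, 0) = 0"
    using H.ip_zero_left[OF H.V_zero] by (simp add: zero_prod_def)
  moreover have "0 \<le> Lsq_inner M (\<lambda>x. D (sg 0 x)) (sg 0)" by (rule D_form_nonneg)
  moreover have "Lsq_inner M (0::real^'d \<Rightarrow> real^'d) 0 = 0" "Lsq_inner M (0::real^'d \<Rightarrow> 'd symmat) 0 = 0"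
    by (simp_all add: Lsq_inner_def zero_fun_def)
  ultimately have "H_inner \<Omega> C B (R_map z) (R_map z) = Lsq_inner M z z" for z
    unfolding H_inner_def R_map_def prod.case by linarith
  moreover have "R_map x - R_map y = R_map (x - y)" by (simp add: R_map_def)
  ultimately show "seminorm (H_inner \<Omega> C B) (R_map x - R_map y) \<le> 1 * seminorm (Lsq_inner M) (x - y)"
    by (simp add: seminorm_def)
qed

text \<open>\<open>inv\<close> is taken on the whole type of triples, so injectivity has to hold
  there and not only on the state space. It does, because \<open>Q_map\<close> acts at each point by
  the identity, by the factor 1/\<rho> and by the invertible tensor C + B.\<close>

lemma inv_Q_map:
  assumes \<rho>: "0 < \<rho>"
  shows "inv (Q_map C B \<rho>) (a, b, c) = (a, \<lambda>x. \<rho> *\<^sub>R b x, \<lambda>x. inv (\<lambda>y. C y + B y) (c x))"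
proof (rule inv_f_eq)
  note S = coercive_tensor_inv[OF coercive_tensor_add[OF C B]]
  show "Q_map C B \<rho> (a, \<lambda>x. \<rho> *\<^sub>R b x, \<lambda>x. inv (\<lambda>y. C y + B y) (c x)) = (a, b, c)"
    using \<rho> S(2) by (simp add: Q_map_def)
  show "inj (Q_map C B \<rho>)"
  proof (rule inj_on_inverseI)
    show "(\<lambda>(a, b, c). (a, \<lambda>x. \<rho> *\<^sub>R b x, \<lambda>x. inv (\<lambda>y. C y + B y) (c x))) (Q_map C B \<rho> x) = x" for x
      using \<rho> S(3) by (cases x) (simp add: Q_map_def)
  qed
qed

text \<open>The inverse of \<open>Q_map\<close> leaves the displacement untouched, so it does not
  interfere with \<open>D_tensor\<close> in the inner product. On the other two components, which
  carry the plain L2 product, it is the scalar \<rho> and the symmetric coercive tensor (C +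
  B)^(-1); symmetry and the two-sided bounds follow componentwise.\<close>

lemma inv_Q_map_props:
  assumes \<rho>: "0 < \<rho>"
  shows "linear (inv (Q_map C B \<rho>))"
    and "x \<in> H_space \<Omega> \<Gamma> \<Longrightarrow> inv (Q_map C B \<rho>) x \<in> H_space \<Omega> \<Gamma>"
    and "H_inner \<Omega> C B (inv (Q_map C B \<rho>) x) y = H_inner \<Omega> C B x (inv (Q_map C B \<rho>) y)"
    and "\<exists>\<kappa>>0. \<forall>x\<in>H_space \<Omega> \<Gamma>. \<kappa> * H_inner \<Omega> C B x x \<le> H_inner \<Omega> C B (inv (Q_map C B \<rho>) x) x"
    and "\<exists>K\<ge>0. \<forall>x\<in>H_space \<Omega> \<Gamma>. H_inner \<Omega> C B (inv (Q_map C B \<rho>) x) (inv (Q_map C B \<rho>) x) \<le> K\<^sup>2 * H_inner \<Omega> C B x x"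
proof -
  define G where "G = inv (\<lambda>y. C y + B y)"
  have G: "coercive_tensor G" unfolding G_def by (rule coercive_tensor_inv[OF coercive_tensor_add[OF C B]])
  note lin = coercive_tensorD(1)[OF G] and sym = coercive_tensorD(2)[OF G]
  note P = inv_Q_map[OF \<rho>, folded G_def]
  let ?P = "inv (Q_map C B \<rho>)" and ?H = "H_space \<Omega> \<Gamma>" and ?ip = "H_inner \<Omega> C B"
  show "linear ?P"
  proof (rule linearI)
    fix x y :: "'d state" and r :: real
    show "?P (x + y) = ?P x + ?P y"
      by (cases x, cases y) (simp add: P plus_fun_def algebra_simps linear_add[OF lin])
    show "?P (r *\<^sub>R x) = r *\<^sub>R ?P x"
      by (cases x) (simp add: P scaleR_fun_def algebra_simps linear_cmul[OF lin])
  qed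
  show "?P x \<in> ?H" if "x \<in> ?H"
    using that by (cases x) (auto simp: P H_space_def intro: Lsq_scaleR Lsq_linear[OF _ lin])
  show "?ip (?P x) y = ?ip x (?P y)"
  proof -
    obtain u v q where x: "x = (u, v, q)" by (cases x) blast
    obtain u' v' q' where y: "y = (u', v', q')" by (cases y) blast
    have "Lsq_inner M (\<lambda>x. G (q x)) q' = Lsq_inner M q (\<lambda>x. G (q' x))"
      unfolding Lsq_inner_def sym ..
    then show ?thesis unfolding x y P H_inner_def prod.case by (simp add: Lsq_inner_def)
  qed
  obtain c where c: "c > 0" "\<And>x. c * (norm x)\<^sup>2 \<le> G x \<bullet> x" using coercive_tensorD(3)[OF G] by blast
  have "bounded_linear G" using lin by (simp add: linear_conv_bounded_linear)
  then obtain L where L: "L > 0" "\<And>x. norm (G x) \<le> norm x * L" using bounded_linear.pos_bounded by blast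
  have Gq: "(\<lambda>x. G (q x)) \<in> Lsq M" if "q \<in> Lsq M" for q by (rule Lsq_linear[OF that lin])
  have low: "c * Lsq_inner M q q \<le> Lsq_inner M (\<lambda>x. G (q x)) q" if q: "q \<in> Lsq M" for q
  proof -
    have "(\<integral>x. c * (q x \<bullet> q x) \<partial>M) \<le> (\<integral>x. G (q x) \<bullet> q x \<partial>M)"
    proof (rule integral_mono)
      show "c * (q x \<bullet> q x) \<le> G (q x) \<bullet> q x" for x using c(2)[of "q x"] by (simp only: power2_norm_eq_inner)
    qed (intro integrable_mult_right Lsq_inner_integrable Gq q)+
    then show ?thesis by (simp add: Lsq_inner_def)
  qed
  have high: "Lsq_inner M (\<lambda>x. G (q x)) (\<lambda>x. G (q x)) \<le> L\<^sup>2 * Lsq_inner M q q" if q: "q \<in> Lsq M" for q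
  proof -
    have "(\<integral>x. G (q x) \<bullet> G (q x) \<partial>M) \<le> (\<integral>x. L\<^sup>2 * (q x \<bullet> q x) \<partial>M)"
    proof (rule integral_mono)
      show "G (q x) \<bullet> G (q x) \<le> L\<^sup>2 * (q x \<bullet> q x)" for x
        using power_mono[OF L(2)[of "q x"] norm_ge_zero, of 2]
        by (simp add: power_mult_distrib power2_norm_eq_inner mult.commute)
    qed (intro integrable_mult_right Lsq_inner_integrable Gq q)+
    then show ?thesis by (simp add: Lsq_inner_def)
  qed
  show "\<exists>\<kappa>>0. \<forall>x\<in>?H. \<kappa> * ?ip x x \<le> ?ip (?P x) x"
  \<comment> \<open>The lower bounds on the three components are 1, \<rho> and the coercivity
    constant \<open>c\<close>.\<close>
  proof (intro exI[of _ "min 1 (min \<rho> c)"] conjI ballI)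
    let ?k = "min 1 (min \<rho> c)"
    show "0 < ?k" using \<rho> c(1) by simp
    fix x assume "x \<in> ?H"
    obtain u v q where x: "x = (u, v, q)" by (cases x) blast
    from \<open>x \<in> ?H\<close> have q: "q \<in> Lsq M" unfolding x H_space_def by blast
    have "?k * Lsq_inner M (\<lambda>x. D (sg u x)) (sg u) \<le> 1 * Lsq_inner M (\<lambda>x. D (sg u x)) (sg u)"
      by (rule mult_right_mono[OF _ D_form_nonneg]) simp
    moreover have "?k * Lsq_inner M v v \<le> \<rho> * Lsq_inner M v v" "?k * Lsq_inner M q q \<le> c * Lsq_inner M q q"
      by (rule mult_right_mono[OF _ Lsq_inner_nonneg], simp)+
    ultimately show "?k * ?ip x x \<le> ?ip (?P x) x"
      using low[OF q] unfolding x P H_inner_def prod.case Lsq_inner_scaleR distrib_left by linarith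
  qed
  show "\<exists>K\<ge>0. \<forall>x\<in>?H. ?ip (?P x) (?P x) \<le> K\<^sup>2 * ?ip x x"
  \<comment> \<open>The sum dominates each of the component bounds 1, \<rho> and \<open>L\<close>,
    hence its square dominates their squares.\<close>
  proof (intro exI[of _ "1 + \<rho> + L"] conjI ballI)
    let ?K = "1 + \<rho> + L"
    show "0 \<le> ?K" using \<rho> L(1) by simp
    fix x assume "x \<in> ?H"
    obtain u v q where x: "x = (u, v, q)" by (cases x) blast
    from \<open>x \<in> ?H\<close> have q: "q \<in> Lsq M" unfolding x H_space_def by blast
    have K: "1\<^sup>2 \<le> ?K\<^sup>2" "\<rho>\<^sup>2 \<le> ?K\<^sup>2" "L\<^sup>2 \<le> ?K\<^sup>2"
      using \<rho> L(1) by (intro power_mono; simp)+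
    have "1\<^sup>2 * Lsq_inner M (\<lambda>x. D (sg u x)) (sg u) \<le> ?K\<^sup>2 * Lsq_inner M (\<lambda>x. D (sg u x)) (sg u)"
      by (rule mult_right_mono[OF K(1) D_form_nonneg])
    moreover have "\<rho>\<^sup>2 * Lsq_inner M v v \<le> ?K\<^sup>2 * Lsq_inner M v v" "L\<^sup>2 * Lsq_inner M q q \<le> ?K\<^sup>2 * Lsq_inner M q q"
      by (rule mult_right_mono[OF K(2) Lsq_inner_nonneg] mult_right_mono[OF K(3) Lsq_inner_nonneg])+
    moreover have "Lsq_inner M (\<lambda>x. \<rho> *\<^sub>R v x) (\<lambda>x. \<rho> *\<^sub>R v x) = \<rho>\<^sup>2 * Lsq_inner M v v"
      by (simp add: Lsq_inner_def power2_eq_square mult.assoc)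
    ultimately show "?ip (?P x) (?P x) \<le> ?K\<^sup>2 * ?ip x x"
      using high[OF q] unfolding x P H_inner_def prod.case distrib_left power_one mult_1 by linarith
  qed
qed

end

text \<open>What remains is to recognise the concrete problem as an instance of the abstract
  convergence: \<open>P\<close> is the inverse of \<open>Q_map C B \<rho>\<close>, the datum is
  \<open>R_map (f t)\<close>, and the two uses of \<open>solves\<close> provide the equation and its
  approximations.\<close>

theorem proposition3p18:
  fixes \<Omega> \<Gamma>N \<Gamma>D :: "('d::{finite,linorder}) rvec set"
    and C B :: "'d symmat \<Rightarrow> 'd symmat"
    and \<rho> T :: real
    and A :: "(('d rvec \<Rightarrow> 'd symmat) \<times> ('d rvec \<Rightarrow> 'd symmat)) set"
    and u0 v0 :: "'d rvec \<Rightarrow> 'd rvec"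
    and z0 q0 :: "'d rvec \<Rightarrow> 'd symmat"
    and f :: "real \<Rightarrow> 'd rvec \<Rightarrow> 'd rvec"
    and u v :: "real \<Rightarrow> 'd rvec \<Rightarrow> 'd rvec"
    and q :: "real \<Rightarrow> 'd rvec \<Rightarrow> 'd symmat"
    and un vn :: "nat \<Rightarrow> real \<Rightarrow> 'd rvec \<Rightarrow> 'd rvec"
    and qn :: "nat \<Rightarrow> real \<Rightarrow> 'd rvec \<Rightarrow> 'd symmat"
    and lam :: "nat \<Rightarrow> real"
  defines "H \<equiv> H_space \<Omega> \<Gamma>D"
    and "ipH \<equiv> H_inner \<Omega> C B"
    and "\<A> \<equiv> evolution_operator \<Omega> \<Gamma>D C B A"
  assumes "bounded_domain \<Omega>" and "lipschitz_boundary \<Omega>"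
    and "boundary_partition \<Omega> \<Gamma>N \<Gamma>D"
    and "groeger_regular \<Omega> \<Gamma>N"
    and "\<rho> > 0" and "T > 0"
    and "coercive_tensor C" and "coercive_tensor B"
    and "maximal_monotone (Lsq (lebesgue_on \<Omega>)) (Lsq_inner (lebesgue_on \<Omega>)) A"
    and "pointwise_resolvents (lebesgue_on \<Omega>) A"
    and "maximal_monotone H ipH \<A>"
    and "u0 \<in> H1_D \<Omega> \<Gamma>D" and "v0 \<in> H1_D \<Omega> \<Gamma>D" and "z0 \<in> Lsq (lebesgue_on \<Omega>)"
    and "q0 = (\<lambda>x. C (sym_gradient \<Omega> u0 x) - (C (z0 x) + B (z0 x)))"
    and "(u0, v0, q0) \<in> Domain \<A>"
    and "f \<in> H1_time (Lsq (lebesgue_on \<Omega>)) (Lsq_inner (lebesgue_on \<Omega>)) T"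
    and "solves \<Omega> \<Gamma>D C B \<rho> T \<A> f (u0, v0, q0) (\<lambda>t. (u t, v t, q t))"
    and "\<And>n. lam n > 0" and "decseq lam" and "lam \<longlonglongrightarrow> 0"
    and "\<And>n. solves \<Omega> \<Gamma>D C B \<rho> T (yosida (lam n) \<A>) f (u0, v0, q0)
                (\<lambda>t. (un n t, vn n t, qn n t))"
  shows "(\<lambda>n. H1_time_norm H ipH T
            (\<lambda>t. (un n t, vn n t, qn n t) - (u t, v t, q t))) \<longlonglongrightarrow> 0"
proof -
  note C = \<open>coercive_tensor C\<close> and B = \<open>coercive_tensor B\<close> and \<rho> = \<open>\<rho> > 0\<close>
  have dom: "open \<Omega>" "bounded \<Omega>" using \<open>bounded_domain \<Omega>\<close> by (simp_all add: bounded_domain_def)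
  have semi: "semi_inner_space H ipH"
    unfolding H_def ipH_def by (rule semi_inner_space_H[OF dom C B])
  interpret semi_inner_space H ipH by (rule semi)
  let ?P = "inv (Q_map C B \<rho>)"
  note P1 = inv_Q_map_props(1)[OF dom C B \<rho>]
    and P2 = inv_Q_map_props(2)[OF dom C B \<rho>, where \<Gamma> = \<Gamma>D, folded H_def]
    and P3 = inv_Q_map_props(3)[OF dom C B \<rho>, folded ipH_def]
    and P4 = inv_Q_map_props(4)[OF dom C B \<rho>, where \<Gamma> = \<Gamma>D, folded H_def ipH_def]
    and P5 = inv_Q_map_props(5)[OF dom C B \<rho>, where \<Gamma> = \<Gamma>D, folded H_def ipH_def]
  obtain \<kappa> where \<kappa>: "\<kappa> > 0" "\<And>x. x \<in> H \<Longrightarrow> \<kappa> * ipH x x \<le> ipH (?P x) x" using P4 by blast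
  obtain K where K: "K \<ge> 0" "\<And>x. x \<in> H \<Longrightarrow> ipH (?P x) (?P x) \<le> K\<^sup>2 * ipH x x" using P5 by blast
  have A: "\<A> \<subseteq> H \<times> H" "monotone_rel ipH \<A>"
    using \<open>maximal_monotone H ipH \<A>\<close> unfolding maximal_monotone_def by blast+
  have x0: "(u0, v0, q0) \<in> H" using \<open>(u0, v0, q0) \<in> Domain \<A>\<close> A(1) by blast
  have "f \<in> L2_time (Lsq (lebesgue_on \<Omega>)) (Lsq_inner (lebesgue_on \<Omega>)) T"
    using \<open>f \<in> H1_time _ _ T\<close> unfolding H1_time_def by blast
  then have g: "(\<lambda>t. R_map (f t)) \<in> L2_time H ipH T"
    unfolding H_def ipH_def by (rule R_map_L2_time[OF dom C B])
  note sol = \<open>solves \<Omega> \<Gamma>D C B \<rho> T \<A> f (u0, v0, q0) _\<close>[unfolded solves_def, folded H_def ipH_def]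
  note soln = \<open>\<And>n. solves \<Omega> \<Gamma>D C B \<rho> T (yosida (lam n) \<A>) f (u0, v0, q0) _\<close>[unfolded solves_def, folded H_def ipH_def]
  show ?thesis
  proof (rule yosida_H1_convergence[where A = \<A> and P = ?P and \<kappa> = \<kappa> and K = K and \<mu> = lam
        and g = "\<lambda>t. R_map (f t)" and init = "(u0, v0, q0)"])
    show "\<kappa> * (sn x)\<^sup>2 \<le> ipH (?P x) x" if "x \<in> H" for x
      unfolding sn_sq[OF that] by (rule \<kappa>(2)[OF that])
    \<comment> \<open>The bound on the inverse was obtained for squared norms with
      \<open>K\<^sup>2\<close>; taking roots uses \<open>0 \<le> K\<close>.\<close>
    show "sn (?P x) \<le> K * sn x" if "x \<in> H" for x
      using real_sqrt_le_mono[OF K(2)[OF that]] K(1) by (simp add: seminorm_def real_sqrt_mult)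
    show "0 \<le> T" using \<open>T > 0\<close> by simp
    show "ipH (?P x) y = ipH x (?P y)" for x y by (rule P3)
    show "(\<lambda>t. (u t, v t, q t)) \<in> H1_time H ipH T"
      "has_initial_value H ipH T (\<lambda>t. (u t, v t, q t)) (u0, v0, q0)"
      "AE t in lebesgue_on {0..T}. ((u t, v t, q t), R_map (f t)
        - ?P (time_derivative H ipH T (\<lambda>t. (u t, v t, q t)) t)) \<in> \<A>"
      using sol by blast+
    show "(\<lambda>t. (un n t, vn n t, qn n t)) \<in> H1_time H ipH T"
      "has_initial_value H ipH T (\<lambda>t. (un n t, vn n t, qn n t)) (u0, v0, q0)"
      "AE t in lebesgue_on {0..T}. ((un n t, vn n t, qn n t), R_map (f t)
        - ?P (time_derivative H ipH T (\<lambda>t. (un n t, vn n t, qn n t)) t)) \<in> yosida (lam n) \<A>" for n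
      using soln[of n] by blast+
  qed (rule A P1 P2 \<kappa>(1) K(1) g x0 \<open>\<And>n. lam n > 0\<close> \<open>lam \<longlonglongrightarrow> 0\<close>; assumption)+
qed

end
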